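(* Let $(\Sigma,\tau)$ be a real hyperelliptic curve of genus $g\ge 2$ with hyperelliptic projection $\pi:\Sigma\to\mathbb{C}P^1=\mathbb{C}\cup\{\infty\}$ and Weierstrass set $W\subset\mathbb{C}$, and let $\xi\to\Sigma$ be a real line bundle of degree $2g+1$ over $(\Sigma,\tau)$. Let $V=\bigoplus_{w\in W}\xi_w^*$, with its induced anti-linear involution, and let $Q_0,Q_1$ be the quadratic forms on $V$ described in the context. Suppose that the real points of $W$ are $r_1<r_2<\dots<r_{2n}$ and that the points of $W$ with positive imaginary part are $a_1+ib_1,\dots,a_s+ib_s$, where $s=g+1-n$ and $b_j>0$. Assume that $\infty\in\pi(\Sigma^\tau)$ and, if $n>0$, that the interval $(-\infty,r_1]$ is even. Then there is a choice of coordinates $x_1,\dots,x_{2n},z_1,\dots,z_s,w_1,\dots,w_s$ on $V$, given by a basis of $V$ whose elements are fixed by the anti-linear involution, in which $Q_0$ and $Q_1$ are expressed respectively as the polynomials $$q_0=\sum_{i=1}^{n}\epsilon_i\left(x_{2i-1}^2-x_{2i}^2\right)+\sum_{j=1}^{s}\left(z_j^2-w_j^2\right),$$ $$q_1=\sum_{i=1}^{n}\epsilon_i\left(r_{2i-1}x_{2i-1}^2-r_{2i}x_{2i}^2\right)+\sum_{j=1}^{s}\left(a_jz_j^2-a_jw_j^2+2b_jz_jw_j\right),$$ where $\epsilon_i=(-1)^{N_i+1}\in\{\pm1\}$ and $N_i$ is the number of odd intervals to the right of $r_{2i-1}$. (In particular $\epsilon_1=1$ when $n>0$.)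
   Context: A hyperelliptic curve of genus $g\ge2$ is a compact Riemann surface $\Sigma$ with a 2-fold ramified cover $\pi:\Sigma\to\mathbb{C}P^1$; $\iota$ is the involution interchanging the sheets, and $W\subset\mathbb{C}P^1$ is the set of $2g+2$ branch points (Weierstrass points), identified with $\pi^{-1}(W)\subset\Sigma$. An affine coordinate $t$ on $\mathbb{C}P^1=\mathbb{C}\cup\{\infty\}$ is fixed with $\infty\notin W$; $t_w\in\mathbb{C}$ is the coordinate of $w\in W$. A real hyperelliptic curve $(\Sigma,\tau)$ is such a curve with an anti-holomorphic involution $\tau$ satisfying $\pi\circ\tau=\tau_{P^1}\circ\pi$, where $\tau_{P^1}$ is the standard complex conjugation on $\mathbb{C}P^1$; then $W$ is invariant under conjugation. $\Sigma^\tau$ denotes the fixed point set. A real line bundle over $(\Sigma,\tau)$ is a holomorphic line bundle $\xi$ admitting an anti-holomorphic, fibrewise anti-linear lift $\tilde\tau$ of $\tau$ with $\tilde\tau^2=\mathrm{Id}$; it induces a real structure on $\xi^*$. Choose a meromorphic section $u$ of $\xi^*$ that is invariant under the induced real structure and has no zeros or poles on $W$ or over $\infty$. Let $D$ be its divisor and write $\pi(D)=\sum_i m_i\alpha_i$ with $\alpha_i\in\mathbb{C}$, $m_i\in\mathbb{Z}$, $\sum_i m_i=-2g-1$. The values $u_w\in\xi_w^*$, $w\in W$, form a basis of $V=\bigoplus_{w\in W}\xi_w^*$, and the induced anti-linear involution on $V$ sends $\sum_w\lambda_wu_w$ to $\sum_w\overline{\lambda_w}\,u_{\nu(w)}$,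 where $\nu$ is the permutation of $W$ given by complex conjugation. The quadratic forms $Q_0,Q_1$ on $V$ are those which are diagonal in the basis $\{u_w\}$ with $$Q_0(u_w^2)=\prod_i(t_w-\alpha_i)^{m_i}\prod_{w'\in W,\,w'\ne w}(t_w-t_{w'}),\qquad Q_1(u_w^2)=t_w\,Q_0(u_w^2).$$ Here $Q(v^2)$ denotes the value of the quadratic form $Q$ at $v$. (Intrinsically, up to a common nonzero scalar fixed by this normalization, they are the components of the pencil $S^2(V)\to H^0(\mathbb{C}P^1,h^{-2g-1}(W))$, $h$ the hyperplane bundle, determined by an isomorphism $\xi^*\otimes\iota^*\xi^*\cong\pi^*(h)^{-2g-1}$.) When $n>0$, $\pi(\Sigma^\tau)\cap\mathbb{C}$ is the union of the intervals $(-\infty,r_1],[r_2,r_3],\dots,[r_{2n-2},r_{2n-1}],[r_{2n},\infty)$ in $\mathbb{R}$. Such an interval $I$ is called odd if $\sum_{\alpha_i\in I}m_i$ is odd, and even otherwise. *)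

theory Defs
  imports "HOL-Complex_Analysis.Complex_Analysis" "HOL-Homology.Homology"
    "HOL-Library.Function_Algebras"
begin

section \<open>Riemann surfaces\<close>

record 'a surface =
  topo :: "'a topology"
  charts :: "('a set \<times> ('a \<Rightarrow> complex)) set"

abbreviation points :: "'a surface \<Rightarrow> 'a set" where
  "points S \<equiv> topspace (topo S)"

definition riemann_surface :: "'a surface \<Rightarrow> bool" where
  "riemann_surface S \<longleftrightarrow>
     Hausdorff_space (topo S) \<and> connected_space (topo S) \<and>
     (\<Union>(C, \<kappa>)\<in>charts S. C) = points S \<and>
     (\<forall>(C, \<kappa>)\<in>charts S. openin (topo S) C \<and> open (\<kappa> ` C) \<and>
        homeomorphic_map (subtopology (topo S) C) (top_of_set (\<kappa> ` C)) \<kappa>) \<and>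
     (\<forall>(C, \<kappa>)\<in>charts S. \<forall>(C', \<kappa>')\<in>charts S.
        (\<lambda>z. \<kappa>' (inv_into C \<kappa> z)) holomorphic_on \<kappa> ` (C \<inter> C'))"

definition compact_riemann_surface :: "'a surface \<Rightarrow> bool" where
  "compact_riemann_surface S \<longleftrightarrow> riemann_surface S \<and> compact_space (topo S)"

text \<open>First homology is free abelian of rank \<open>2g\<close>.\<close>

definition has_genus :: "'a surface \<Rightarrow> nat \<Rightarrow> bool" where
  "has_genus S g \<longleftrightarrow> homology_group 1 (topo S) \<cong> free_Abelian_group {..<2 * g}"

definition holomorphic_map :: "'a surface \<Rightarrow> 'b surface \<Rightarrow> ('a \<Rightarrow> 'b) \<Rightarrow> bool" where
  "holomorphic_map S T f \<longleftrightarrow>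
     continuous_map (topo S) (topo T) f \<and>
     (\<forall>(C, \<kappa>)\<in>charts S. \<forall>(D, \<mu>)\<in>charts T.
        (\<lambda>z. \<mu> (f (inv_into C \<kappa> z))) holomorphic_on \<kappa> ` {x \<in> C. f x \<in> D})"

definition antiholomorphic_map :: "'a surface \<Rightarrow> 'b surface \<Rightarrow> ('a \<Rightarrow> 'b) \<Rightarrow> bool" where
  "antiholomorphic_map S T f \<longleftrightarrow>
     continuous_map (topo S) (topo T) f \<and>
     (\<forall>(C, \<kappa>)\<in>charts S. \<forall>(D, \<mu>)\<in>charts T.
        (\<lambda>z. cnj (\<mu> (f (inv_into C \<kappa> z)))) holomorphic_on \<kappa> ` {x \<in> C. f x \<in> D})"

definition chart_at :: "'a surface \<Rightarrow> 'a \<Rightarrow> 'a set \<times> ('a \<Rightarrow> complex)" where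
  "chart_at S p = (SOME c. c \<in> charts S \<and> p \<in> fst c)"

text \<open>Order at \<open>p\<close> of a complex-valued function defined near \<open>p\<close>; it does not depend
  on the chart.\<close>

definition ord_at :: "'a surface \<Rightarrow> ('a \<Rightarrow> complex) \<Rightarrow> 'a \<Rightarrow> int" where
  "ord_at S f p = (case chart_at S p of (C, \<kappa>) \<Rightarrow> zorder (\<lambda>z. f (inv_into C \<kappa> z)) (\<kappa> p))"

definition ramification_index :: "'a surface \<Rightarrow> 'b surface \<Rightarrow> ('a \<Rightarrow> 'b) \<Rightarrow> 'a \<Rightarrow> int" where
  "ramification_index S T f p =
     (case chart_at T (f p) of (D, \<mu>) \<Rightarrow> ord_at S (\<lambda>x. \<mu> (f x) - \<mu> (f p)) p)"

text \<open>The condition on all fibres excludes constant maps.\<close>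

definition ramified_cover :: "'a surface \<Rightarrow> 'b surface \<Rightarrow> ('a \<Rightarrow> 'b) \<Rightarrow> nat \<Rightarrow> bool" where
  "ramified_cover S T f d \<longleftrightarrow>
     holomorphic_map S T f \<and>
     (\<forall>q\<in>points T. finite {p \<in> points S. f p = q} \<and>
        (\<Sum>p | p \<in> points S \<and> f p = q. ramification_index S T f p) = int d)"

text \<open>The Riemann sphere: \<open>Some z\<close> is the point with affine coordinate \<open>z\<close>,
  \<open>None\<close> is the point at infinity.\<close>

definition CP1 :: "complex option surface" where
  "CP1 = \<lparr>topo = Alexandroff_compactification euclidean,
          charts = {(range Some, the),
                    (UNIV - {Some 0}, \<lambda>q. case q of None \<Rightarrow> 0 | Some z \<Rightarrow> inverse z)}\<rparr>"


section \<open>Real hyperelliptic curves\<close>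

definition hyperelliptic_curve :: "'a surface \<Rightarrow> ('a \<Rightarrow> complex option) \<Rightarrow> nat \<Rightarrow> bool" where
  "hyperelliptic_curve S \<pi> g \<longleftrightarrow>
     compact_riemann_surface S \<and> has_genus S g \<and> g \<ge> 2 \<and> ramified_cover S CP1 \<pi> 2"

definition real_hyperelliptic_curve ::
    "'a surface \<Rightarrow> ('a \<Rightarrow> complex option) \<Rightarrow> ('a \<Rightarrow> 'a) \<Rightarrow> nat \<Rightarrow> bool" where
  "real_hyperelliptic_curve S \<pi> \<tau> g \<longleftrightarrow>
     hyperelliptic_curve S \<pi> g \<and>
     antiholomorphic_map S S \<tau> \<and>
     (\<forall>p\<in>points S. \<tau> (\<tau> p) = p) \<and>
     (\<forall>p\<in>points S. \<pi> (\<tau> p) = map_option cnj (\<pi> p))"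

definition real_points :: "'a surface \<Rightarrow> ('a \<Rightarrow> 'a) \<Rightarrow> 'a set" where
  "real_points S \<tau> = {p \<in> points S. \<tau> p = p}"

text \<open>Weierstrass points as points of the surface; each branch point in the projective line
  has exactly one preimage, so this set is also the preimage of the branch locus.\<close>

definition weierstrass :: "'a surface \<Rightarrow> ('a \<Rightarrow> complex option) \<Rightarrow> 'a set" where
  "weierstrass S \<pi> = {p \<in> points S. ramification_index S CP1 \<pi> p = 2}"

definition branch_points :: "'a surface \<Rightarrow> ('a \<Rightarrow> complex option) \<Rightarrow> complex option set" where
  "branch_points S \<pi> = \<pi> ` weierstrass S \<pi>"


section \<open>Line bundles\<close>

text \<open>A line bundle is a family of fibres with fibrewise addition and scaling and a collection
  of local trivialisations \<open>(U, \<phi>)\<close>, where \<open>\<phi> x\<close> maps the fibre over \<open>x \<in> U\<close> to the complex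
  numbers. Fibres over different points may share elements; the total space is the disjoint
  union of the fibres.\<close>

record ('a, 'e) line_bundle =
  fibre :: "'a \<Rightarrow> 'e set"
  fadd :: "'a \<Rightarrow> 'e \<Rightarrow> 'e \<Rightarrow> 'e"
  fscale :: "'a \<Rightarrow> complex \<Rightarrow> 'e \<Rightarrow> 'e"
  trivs :: "('a set \<times> ('a \<Rightarrow> 'e \<Rightarrow> complex)) set"

definition frame :: "('a, 'e) line_bundle \<Rightarrow> ('a \<Rightarrow> 'e \<Rightarrow> complex) \<Rightarrow> 'a \<Rightarrow> 'e" where
  "frame L \<phi> x = inv_into (fibre L x) (\<phi> x) 1"

text \<open>The vector space axioms on the fibres follow from the existence of linear
  trivialisations, and the transition functions are the functions \<open>\<phi>'\<close> of the frame of \<open>\<phi>\<close>.\<close>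

definition holomorphic_line_bundle :: "'a surface \<Rightarrow> ('a, 'e) line_bundle \<Rightarrow> bool" where
  "holomorphic_line_bundle S L \<longleftrightarrow>
     (\<Union>(U, \<phi>)\<in>trivs L. U) = points S \<and>
     (\<forall>(U, \<phi>)\<in>trivs L. openin (topo S) U \<and>
        (\<forall>x\<in>U. bij_betw (\<phi> x) (fibre L x) UNIV \<and>
           (\<forall>e\<in>fibre L x. \<forall>e'\<in>fibre L x.
              fadd L x e e' \<in> fibre L x \<and> \<phi> x (fadd L x e e') = \<phi> x e + \<phi> x e') \<and>
           (\<forall>c. \<forall>e\<in>fibre L x.
              fscale L x c e \<in> fibre L x \<and> \<phi> x (fscale L x c e) = c * \<phi> x e))) \<and>
     (\<forall>(U, \<phi>)\<in>trivs L. \<forall>(U', \<phi>')\<in>trivs L. \<forall>(C, \<kappa>)\<in>charts S.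
        (\<lambda>z. let x = inv_into C \<kappa> z in \<phi>' x (frame L \<phi> x)) holomorphic_on \<kappa> ` (C \<inter> U \<inter> U'))"

text \<open>Functionals are extended by zero outside the fibre.\<close>

definition dual_bundle :: "('a, 'e) line_bundle \<Rightarrow> ('a, 'e \<Rightarrow> complex) line_bundle" where
  "dual_bundle L =
     \<lparr>fibre = (\<lambda>x. {f. (\<forall>e\<in>fibre L x. \<forall>e'\<in>fibre L x. f (fadd L x e e') = f e + f e') \<and>
                        (\<forall>c. \<forall>e\<in>fibre L x. f (fscale L x c e) = c * f e) \<and>
                        (\<forall>e. e \<notin> fibre L x \<longrightarrow> f e = 0)}),
      fadd = (\<lambda>x f f' e. f e + f' e),
      fscale = (\<lambda>x c f e. c * f e),
      trivs = (\<lambda>(U, \<phi>). (U, \<lambda>x f. f (frame L \<phi> x))) ` trivs L\<rparr>"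

text \<open>Nice meromorphy of the local expressions fixes the values: the section takes its limit
  value wherever there is no pole, and zero at the poles.\<close>

definition meromorphic_section ::
    "'a surface \<Rightarrow> ('a, 'e) line_bundle \<Rightarrow> ('a \<Rightarrow> 'e) \<Rightarrow> bool" where
  "meromorphic_section S L s \<longleftrightarrow>
     (\<forall>x\<in>points S. s x \<in> fibre L x) \<and>
     (\<forall>(U, \<phi>)\<in>trivs L. \<forall>(C, \<kappa>)\<in>charts S.
        (\<lambda>z. let x = inv_into C \<kappa> z in \<phi> x (s x)) nicely_meromorphic_on \<kappa> ` (C \<inter> U))"

definition nonzero_section ::
    "'a surface \<Rightarrow> ('a, 'e) line_bundle \<Rightarrow> ('a \<Rightarrow> 'e) \<Rightarrow> bool" where
  "nonzero_section S L s \<longleftrightarrow> (\<exists>x\<in>points S. s x \<noteq> fscale L x 0 (s x))"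

definition triv_at :: "('a, 'e) line_bundle \<Rightarrow> 'a \<Rightarrow> 'a set \<times> ('a \<Rightarrow> 'e \<Rightarrow> complex)" where
  "triv_at L p = (SOME c. c \<in> trivs L \<and> p \<in> fst c)"

definition section_ord ::
    "'a surface \<Rightarrow> ('a, 'e) line_bundle \<Rightarrow> ('a \<Rightarrow> 'e) \<Rightarrow> 'a \<Rightarrow> int" where
  "section_ord S L s p = (case triv_at L p of (U, \<phi>) \<Rightarrow> ord_at S (\<lambda>x. \<phi> x (s x)) p)"

text \<open>The degree of a line bundle is the degree of the divisor of any nonzero meromorphic
  section.\<close>

definition has_degree :: "'a surface \<Rightarrow> ('a, 'e) line_bundle \<Rightarrow> int \<Rightarrow> bool" where
  "has_degree S L d \<longleftrightarrow>
     (\<exists>s. meromorphic_section S L s \<and> nonzero_section S L s) \<and>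
     (\<forall>s. meromorphic_section S L s \<and> nonzero_section S L s \<longrightarrow>
        (\<Sum>p | p \<in> points S \<and> section_ord S L s p \<noteq> 0. section_ord S L s p) = d)"

text \<open>\<open>\<sigma> x\<close> maps the fibre over \<open>x\<close> to the fibre over \<open>\<tau> x\<close>. Since \<open>\<sigma>\<close> is fibrewise anti-linear
  and \<open>\<tau>\<close> is anti-holomorphic, \<open>\<sigma>\<close> is anti-holomorphic on the total space iff the conjugate of
  its coefficient with respect to local frames is holomorphic on the base.\<close>

definition real_structure ::
    "'a surface \<Rightarrow> ('a \<Rightarrow> 'a) \<Rightarrow> ('a, 'e) line_bundle \<Rightarrow> ('a \<Rightarrow> 'e \<Rightarrow> 'e) \<Rightarrow> bool" where
  "real_structure S \<tau> L \<sigma> \<longleftrightarrow>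
     (\<forall>x\<in>points S. \<forall>e\<in>fibre L x.
        \<sigma> x e \<in> fibre L (\<tau> x) \<and> \<sigma> (\<tau> x) (\<sigma> x e) = e \<and>
        (\<forall>e'\<in>fibre L x. \<sigma> x (fadd L x e e') = fadd L (\<tau> x) (\<sigma> x e) (\<sigma> x e')) \<and>
        (\<forall>c. \<sigma> x (fscale L x c e) = fscale L (\<tau> x) (cnj c) (\<sigma> x e))) \<and>
     (\<forall>(U, \<phi>)\<in>trivs L. \<forall>(U', \<phi>')\<in>trivs L. \<forall>(C, \<kappa>)\<in>charts S.
        (\<lambda>z. let x = inv_into C \<kappa> z in cnj (\<phi>' (\<tau> x) (\<sigma> x (frame L \<phi> x))))
          holomorphic_on \<kappa> ` {x \<in> C \<inter> U. \<tau> x \<in> U'})"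

text \<open>The real structure on the dual bundle induced by \<open>\<sigma>\<close>, as a map from the dual fibre over
  \<open>x\<close> to the dual fibre over \<open>\<tau> x\<close>.\<close>

definition dual_real_structure ::
    "('a \<Rightarrow> 'a) \<Rightarrow> ('a, 'e) line_bundle \<Rightarrow> ('a \<Rightarrow> 'e \<Rightarrow> 'e) \<Rightarrow>
     'a \<Rightarrow> ('e \<Rightarrow> complex) \<Rightarrow> 'e \<Rightarrow> complex" where
  "dual_real_structure \<tau> L \<sigma> x f =
     (\<lambda>e. if e \<in> fibre L (\<tau> x) then cnj (f (\<sigma> (\<tau> x) e)) else 0)"


section \<open>The space V and the forms on it\<close>

definition vscale :: "complex \<Rightarrow> ('a \<Rightarrow> 'e \<Rightarrow> complex) \<Rightarrow> 'a \<Rightarrow> 'e \<Rightarrow> complex" where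
  "vscale c v = (\<lambda>p e. c * v p e)"

interpretation vfun: vector_space vscale
  by unfold_locales (auto simp: vscale_def fun_eq_iff algebra_simps)

text \<open>The direct sum of the dual fibres over the Weierstrass points, as a subspace of the
  space of all functions \<open>'a \<Rightarrow> 'e \<Rightarrow> complex\<close>.\<close>

definition weierstrass_space ::
    "'a surface \<Rightarrow> ('a \<Rightarrow> complex option) \<Rightarrow> ('a, 'e) line_bundle \<Rightarrow> ('a \<Rightarrow> 'e \<Rightarrow> complex) set" where
  "weierstrass_space S \<pi> L =
     {v. (\<forall>p\<in>weierstrass S \<pi>. v p \<in> fibre (dual_bundle L) p) \<and>
         (\<forall>p. p \<notin> weierstrass S \<pi> \<longrightarrow> v p = (\<lambda>e. 0))}"

definition weierstrass_conj ::
    "'a surface \<Rightarrow> ('a \<Rightarrow> complex option) \<Rightarrow> ('a \<Rightarrow> 'a) \<Rightarrow> ('a, 'e) line_bundle \<Rightarrow>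
     ('a \<Rightarrow> 'e \<Rightarrow> 'e) \<Rightarrow> ('a \<Rightarrow> 'e \<Rightarrow> complex) \<Rightarrow> 'a \<Rightarrow> 'e \<Rightarrow> complex" where
  "weierstrass_conj S \<pi> \<tau> L \<sigma> v =
     (\<lambda>p. if p \<in> weierstrass S \<pi> then dual_real_structure \<tau> L \<sigma> (\<tau> p) (v (\<tau> p)) else (\<lambda>e. 0))"

text \<open>The multiplicity of \<open>\<alpha>\<close> in the push-forward to the affine line of the divisor of a
  section.\<close>

definition pushforward_mult ::
    "'a surface \<Rightarrow> ('a \<Rightarrow> complex option) \<Rightarrow> ('a, 'e) line_bundle \<Rightarrow> ('a \<Rightarrow> 'e) \<Rightarrow> complex \<Rightarrow> int" where
  "pushforward_mult S \<pi> L s \<alpha> = (\<Sum>p | p \<in> points S \<and> \<pi> p = Some \<alpha>. section_ord S L s p)"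

definition Q0_coeff ::
    "'a surface \<Rightarrow> ('a \<Rightarrow> complex option) \<Rightarrow> ('a, 'e) line_bundle \<Rightarrow>
     ('a \<Rightarrow> 'e \<Rightarrow> complex) \<Rightarrow> 'a \<Rightarrow> complex" where
  "Q0_coeff S \<pi> L u w =
     (let t = (\<lambda>p. the (\<pi> p)); m = pushforward_mult S \<pi> (dual_bundle L) u in
       (\<Prod>\<alpha> | m \<alpha> \<noteq> 0. (t w - \<alpha>) powi m \<alpha>) * (\<Prod>w'\<in>weierstrass S \<pi> - {w}. t w - t w'))"

definition Q1_coeff ::
    "'a surface \<Rightarrow> ('a \<Rightarrow> complex option) \<Rightarrow> ('a, 'e) line_bundle \<Rightarrow>
     ('a \<Rightarrow> 'e \<Rightarrow> complex) \<Rightarrow> 'a \<Rightarrow> complex" where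
  "Q1_coeff S \<pi> L u w = the (\<pi> w) * Q0_coeff S \<pi> L u w"

text \<open>The quadratic form that is diagonal in the basis given by the values of \<open>u\<close> on \<open>A\<close>, with
  value \<open>d w\<close> at the basis vector indexed by \<open>w\<close>.\<close>

definition diagonal_form ::
    "'a set \<Rightarrow> ('a \<Rightarrow> 'e \<Rightarrow> complex) \<Rightarrow> ('a \<Rightarrow> complex) \<Rightarrow> ('a \<Rightarrow> 'e \<Rightarrow> complex) \<Rightarrow> complex" where
  "diagonal_form A u d v = (\<Sum>w\<in>A. d w * (THE c. v w = (\<lambda>e. c * u w e))\<^sup>2)"

definition Q0 ::
    "'a surface \<Rightarrow> ('a \<Rightarrow> complex option) \<Rightarrow> ('a, 'e) line_bundle \<Rightarrow>
     ('a \<Rightarrow> 'e \<Rightarrow> complex) \<Rightarrow> ('a \<Rightarrow> 'e \<Rightarrow> complex) \<Rightarrow> complex" where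
  "Q0 S \<pi> L u = diagonal_form (weierstrass S \<pi>) u (Q0_coeff S \<pi> L u)"

definition Q1 ::
    "'a surface \<Rightarrow> ('a \<Rightarrow> complex option) \<Rightarrow> ('a, 'e) line_bundle \<Rightarrow>
     ('a \<Rightarrow> 'e \<Rightarrow> complex) \<Rightarrow> ('a \<Rightarrow> 'e \<Rightarrow> complex) \<Rightarrow> complex" where
  "Q1 S \<pi> L u = diagonal_form (weierstrass S \<pi>) u (Q1_coeff S \<pi> L u)"


section \<open>Odd intervals and signs\<close>

definition real_intervals :: "nat \<Rightarrow> (nat \<Rightarrow> real) \<Rightarrow> real set set" where
  "real_intervals n r =
     {{..r 1}, {r (2 * n)..}} \<union> {{r (2 * k)..r (2 * k + 1)} |k. 1 \<le> k \<and> k < n}"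

definition odd_interval :: "(complex \<Rightarrow> int) \<Rightarrow> real set \<Rightarrow> bool" where
  "odd_interval m I \<longleftrightarrow> odd (\<Sum>\<alpha> | m \<alpha> \<noteq> 0 \<and> \<alpha> \<in> complex_of_real ` I. m \<alpha>)"

definition odd_count :: "(complex \<Rightarrow> int) \<Rightarrow> nat \<Rightarrow> (nat \<Rightarrow> real) \<Rightarrow> nat \<Rightarrow> nat" where
  "odd_count m n r i =
     card {I \<in> real_intervals n r. odd_interval m I \<and> I \<subseteq> {r (2 * i - 1)<..}}"

end

theory Submission
  imports Defs
begin

text \<open>In the basis \<open>u\<^sub>w\<close> both forms are diagonal, so a complex conjugate pair of branch points
  contributes a hyperbolic plane, and a real branch point \<open>r\<^sub>k\<close> contributes the sign of
  \<open>\<Prod>\<^sub>i (r\<^sub>k - \<alpha>\<^sub>i) ^ m\<^sub>i \<cdot> \<Prod>\<^sub>w (r\<^sub>k - t\<^sub>w)\<close>, where \<open>w\<close> runs over the other branch points.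
  Since conjugate factors multiply to positive numbers, this sign depends only on the number of
  branch points to the right of \<open>r\<^sub>k\<close> and on the parity of the sum of the \<open>m\<^sub>i\<close> over the real
  \<open>\<alpha>\<^sub>i\<close> to the right of \<open>r\<^sub>k\<close>. Over \<open>x\<close> in a gap \<open>(r\<^bsub>2i-1\<^esub>, r\<^bsub>2i\<^esub>)\<close> the involution \<open>\<tau>\<close> exchanges the
  two preimages; the invariant section \<open>u\<close> has the same order at both, so the multiplicity at
  \<open>x\<close> is even and only the odd intervals count. That the gaps contain no real points of the
  curve follows from \<open>\<infinity>\<close> being the image of a real point, because being the image of a real
  point is a locally constant property away from the branch points and changes across each real
  branch point. Finally \<open>1/u\<close> is a section of \<open>\<xi>\<close>, so the \<open>m\<^sub>i\<close> add up to the odd number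
  \<open>-2g-1\<close>; this gives \<open>\<epsilon>\<^sub>1 = 1\<close>.\<close>

section \<open>Orders of meromorphic functions\<close>

text \<open>Only the real branch points carry an invariant. A vector over \<open>r k\<close> that is
  fixed by the involution stays fixed only under real rescaling, so the sign of \<open>Q0\<close>
  survives there; over a conjugate pair one basis vector may be scaled by any nonzero complex number
  and the other by its conjugate, which absorbs the value of \<open>Q0\<close> completely. To the
  right of \<open>r k\<close> lie \<open>2 * n - k\<close> real branch points, whose factors give
  the sign \<open>(-1) ^ k\<close>, whereas the divisor contributes the same sign at
  \<open>r (2 * i - 1)\<close> and at \<open>r (2 * i)\<close>. Hence the opposite signs within a
  pair and the \<open>+ 1\<close> in the exponent of \<open>\<epsilon>\<close>. The obstacle is that
  orders and ramification indices are defined by charts and trivialisations picked at each point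
  separately, so nothing relates the data at \<open>p\<close> to those at \<open>\<tau> p\<close>.
  Much of the analytic preparation compares orders between trivialisations, between coordinates of
  the sphere, or across an antiholomorphic map.\<close>

lemma nicely_meromorphic_eventually_nonzero:
  assumes F: "F nicely_meromorphic_on A" and z: "z \<in> A"
    and nz: "\<not> (\<forall>\<^sub>F w in nhds z. F w = 0)"
  shows "\<forall>\<^sub>F w in at z. F w \<noteq> 0"
proof (rule ccontr)
  assume *: "\<not> ?thesis"
  have mero: "F meromorphic_on {z}"
    using F z meromorphic_on_subset unfolding nicely_meromorphic_on_def by blast
  from * have "\<exists>\<^sub>F w in at z. F w = 0"
    by (simp add: frequently_def)
  then have ev: "\<forall>\<^sub>F w in at z. F w = 0"
    using mero not_essential_frequently_0_imp_eventually_0 unfolding meromorphic_at_iff by blast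
  \<comment> \<open>Nice meromorphy forces the value at \<open>z\<close>: zero at a pole, the limit
    elsewhere. So vanishing on a punctured neighbourhood extends to \<open>z\<close> itself.\<close>
  have "F z = 0"
  proof -
    from F z consider "F z = 0" | "F \<midarrow>z\<rightarrow> F z"
      unfolding nicely_meromorphic_on_def by blast
    then show ?thesis
    proof cases
      case 2
      moreover have "F \<midarrow>z\<rightarrow> 0"
        using ev by (simp add: tendsto_eventually)
      ultimately show ?thesis
        using LIM_unique by blast
    qed
  qed
  with ev have "\<forall>\<^sub>F w in nhds z. F w = 0"
    by (auto simp: eventually_at_filter elim: eventually_mono)
  with nz show False by blast
qed

lemma zorder_nonvanishing_mult:
  assumes "F meromorphic_on {z}" "\<exists>\<^sub>F w in at z. F w \<noteq> 0" "G analytic_on {z}" "G z \<noteq> 0"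
  shows "zorder (\<lambda>w. G w * F w) z = zorder F z"
proof -
  have "\<exists>\<^sub>F w in at z. G w \<noteq> 0"
    using analytic_at_neq_imp_eventually_neq[OF assms(3,4)]
    by (intro eventually_frequently) auto
  then show ?thesis
    using assms by (subst zorder_mult) (auto intro: analytic_on_imp_meromorphic_on zorder_eq_0I)
qed

lemma dist_cnj_left: "dist (cnj x) y = dist x (cnj y)"
proof -
  have "dist (cnj x) y = cmod (cnj (cnj x - y))" unfolding dist_norm complex_mod_cnj ..
  then show ?thesis by (simp add: dist_norm)
qed

text \<open>Write \<open>F w = g w * (w - z0) powi n\<close> with \<open>g\<close> nonvanishing and
  substitute \<open>w = cnj (\<Psi> z)\<close>. As \<open>deriv \<Psi> z1 \<noteq> 0\<close>, the
  difference quotient \<open>h\<close> of \<open>\<Psi>\<close> at \<open>z1\<close> is holomorphic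
  without zeros nearby, and it exchanges the conjugate of \<open>w - z0\<close> for
  \<open>z - z1\<close> up to a nonvanishing factor. In the application
  \<open>cnj (\<Psi> z)\<close> is the involution read in two charts and \<open>G\<close> comes from
  its lift to the bundle.\<close>

lemma zorder_antiholomorphic_pullback:
  assumes F: "F meromorphic_on {z0}" "\<exists>\<^sub>F w in at z0. F w \<noteq> 0"
    and A: "open A" "z1 \<in> A"
    and \<Psi>: "\<Psi> holomorphic_on A" "\<Psi> z1 = cnj z0" "deriv \<Psi> z1 \<noteq> 0"
    and G: "G holomorphic_on A" "G z1 \<noteq> 0"
    and eq: "\<And>z. z \<in> A \<Longrightarrow> F' z = G z * cnj (F (cnj (\<Psi> z)))"
  shows "zorder F' z1 = zorder F z0"
proof -
  define n where "n = zorder F z0"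
  define g where "g = zor_poly F z0"
  from zorder_exist[of F z0] F obtain r where r: "g z0 \<noteq> 0" "r > 0" "g holomorphic_on cball z0 r"
    "\<And>w. w \<in> cball z0 r - {z0} \<Longrightarrow> F w = g w * (w - z0) powi n \<and> g w \<noteq> 0"
    unfolding meromorphic_at_iff g_def n_def by blast
  define h where "h = (\<lambda>z. if z = z1 then deriv \<Psi> z1 else (\<Psi> z - \<Psi> z1) / (z - z1))"
  have h: "h holomorphic_on A"
    unfolding h_def by (rule pole_lemma_open[OF \<Psi>(1) A(1)])
  obtain d where d: "d > 0" "ball z1 d \<subseteq> A" "inj_on \<Psi> (ball z1 d)"
    using has_complex_derivative_locally_injective[OF \<Psi>(1) A(2,1) \<Psi>(3)] by blast
  have "isCont \<Psi> z1"
    using \<Psi>(1) A holomorphic_on_imp_continuous_on continuous_on_eq_continuous_at by blast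
  then obtain e where e: "e > 0" "\<And>z. dist z z1 < e \<Longrightarrow> dist (\<Psi> z) (cnj z0) < r"
    using r(2) \<Psi>(2) unfolding continuous_at_eps_delta by metis
  define B where "B = ball z1 (min d e)"
  have BA: "B \<subseteq> A" using d by (auto simp: B_def)
  have near: "cnj (\<Psi> z) \<in> ball z0 r" if "z \<in> B" for z
    using e(2)[of z] that by (simp add: B_def dist_commute dist_cnj_left)
  have cg: "(\<lambda>w. cnj (g (cnj w))) holomorphic_on ball (cnj z0) r"
  proof -
    have eqb: "cnj ` ball (cnj z0) r \<subseteq> ball z0 r"
      by (auto simp: dist_cnj_left)
    have "g holomorphic_on cnj ` ball (cnj z0) r"
      using r(3) ball_subset_cball eqb holomorphic_on_subset by blast
    from holomorphic_on_compose_cnj_cnj[OF this open_ball] show ?thesis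
      by (simp add: o_def)
  qed
  have img: "\<Psi> ` B \<subseteq> ball (cnj z0) r"
    using near by (auto simp: dist_cnj_left)
  have cg\<Psi>: "(\<lambda>z. cnj (g (cnj (\<Psi> z)))) holomorphic_on B"
    using holomorphic_on_compose_gen[OF holomorphic_on_subset[OF \<Psi>(1) BA] cg img]
    by (simp add: o_def)
  have hnz: "h z \<noteq> 0" if "z \<in> B" for z
  proof (cases "z = z1")
    case False
    then show ?thesis using d(3) that d(1) by (auto simp: h_def B_def inj_on_def)
  qed (use \<Psi> in \<open>auto simp: h_def\<close>)
  have "zorder F' z1 = n"
  proof (rule zorder_eqI[of B])
    show "open B" "z1 \<in> B" using d e by (auto simp: B_def)
    show "(\<lambda>z. G z * cnj (g (cnj (\<Psi> z))) * h z powi n) holomorphic_on B"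
      using holomorphic_on_subset[OF G(1) BA] holomorphic_on_subset[OF h BA] cg\<Psi> hnz
      by (auto intro!: holomorphic_intros)
    show "G z1 * cnj (g (cnj (\<Psi> z1))) * h z1 powi n \<noteq> 0"
      using G r(1) \<Psi> by (simp add: h_def)
    fix w assume w: "w \<in> B" "w \<noteq> z1"
    then have "\<Psi> w \<noteq> \<Psi> z1" using d(3) d(1) by (auto simp: B_def inj_on_def)
    then have ne: "cnj (\<Psi> w) \<noteq> z0" using \<Psi>(2) by (metis complex_cnj_cnj)
    have "F (cnj (\<Psi> w)) = g (cnj (\<Psi> w)) * (cnj (\<Psi> w) - z0) powi n"
      using r(4)[of "cnj (\<Psi> w)"] near[OF w(1)] ne by auto
    then have "F' w = G w * cnj (g (cnj (\<Psi> w))) * (\<Psi> w - cnj z0) powi n"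
      using eq[of w] w BA by auto
    also have "\<Psi> w - cnj z0 = h w * (w - z1)"
      using w \<Psi>(2) by (simp add: h_def)
    finally show "F' w = G w * cnj (g (cnj (\<Psi> w))) * h w powi n * (w - z1) powi n"
      by (simp add: power_int_mult_distrib)
  qed
  then show ?thesis by (simp add: n_def)
qed

lemma zorder_pos_factor:
  assumes f: "f holomorphic_on A" "open A" "z0 \<in> A" and n: "zorder (\<lambda>z. f z - f z0) z0 = int n"
    and nz: "\<exists>\<^sub>F z in at z0. f z \<noteq> f z0"
  obtains \<rho> g where "\<rho> > 0" "ball z0 \<rho> \<subseteq> A" "g holomorphic_on ball z0 \<rho>"
    "\<And>z. z \<in> ball z0 \<rho> \<Longrightarrow> g z \<noteq> 0 \<and> f z - f z0 = g z * (z - z0) ^ n"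
proof -
  obtain d where d: "d > 0" "ball z0 d \<subseteq> A" using f openE by blast
  \<comment> \<open>The factorisation at a zero needs a connected domain on which the function is
    not identically zero. \<open>A\<close> may be disconnected, hence the ball.\<close>
  have "\<exists>w\<in>ball z0 d. f w - f z0 \<noteq> 0"
  proof (rule ccontr)
    assume *: "\<not> ?thesis"
    have "\<forall>\<^sub>F z in at z0. z \<in> ball z0 d"
      using d(1) by (intro eventually_at_in_open') auto
    then have "\<forall>\<^sub>F z in at z0. f z = f z0"
      by eventually_elim (use * in auto)
    with nz show False by (simp add: frequently_def)
  qed
  moreover have "(\<lambda>z. f z - f z0) holomorphic_on ball z0 d"
    using holomorphic_on_subset[OF f(1) d(2)] by (intro holomorphic_intros)
  ultimately have "\<exists>r>0. cball z0 r \<subseteq> ball z0 d \<and>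
      zor_poly (\<lambda>z. f z - f z0) z0 holomorphic_on cball z0 r \<and>
      (\<forall>w\<in>cball z0 r. f w - f z0 = zor_poly (\<lambda>z. f z - f z0) z0 w * (w - z0) ^ n \<and>
        zor_poly (\<lambda>z. f z - f z0) z0 w \<noteq> 0)"
    using zorder_exist_zero[of "\<lambda>z. f z - f z0" "ball z0 d" z0] d(1) n by simp
  then
  obtain r where r: "r > 0" "cball z0 r \<subseteq> ball z0 d"
    "zor_poly (\<lambda>z. f z - f z0) z0 holomorphic_on cball z0 r"
    "\<And>w. w \<in> cball z0 r \<Longrightarrow> f w - f z0 = zor_poly (\<lambda>z. f z - f z0) z0 w * (w - z0) ^ n \<and>
        zor_poly (\<lambda>z. f z - f z0) z0 w \<noteq> 0"
    by blast
  show ?thesis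
  proof (rule that[of r "zor_poly (\<lambda>z. f z - f z0) z0"])
    show "ball z0 r \<subseteq> A" using r(2) d(2) by (meson ball_subset_cball subset_trans)
    show "zor_poly (\<lambda>z. f z - f z0) z0 holomorphic_on ball z0 r"
      using r(3) ball_subset_cball holomorphic_on_subset by blast
  qed (use r in auto)
qed

lemma zorder_pos_if_nonconst:
  assumes f: "f holomorphic_on A" "open A" "z0 \<in> A"
    and nz: "\<exists>\<^sub>F z in at z0. f z \<noteq> f z0"
  shows "zorder (\<lambda>z. f z - f z0) z0 > 0"
proof -
  have "(\<lambda>z. f z - f z0) holomorphic_on A"
    by (intro holomorphic_intros f)
  then show ?thesis
    using zorder_pos_iff[of "\<lambda>z. f z - f z0" A z0] assms by simp
qed

text \<open>For a simple zero the derivative at \<open>z0\<close> equals the cofactor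
  \<open>g z0\<close>, which is nonzero.\<close>

lemma zorder_1_locally_injective:
  assumes f: "f holomorphic_on A" "open A" "z0 \<in> A" and 1: "zorder (\<lambda>z. f z - f z0) z0 = 1"
    and nz: "\<exists>\<^sub>F z in at z0. f z \<noteq> f z0"
  obtains \<rho> where "\<rho> > 0" "ball z0 \<rho> \<subseteq> A" "inj_on f (ball z0 \<rho>)"
proof -
  from 1 have 1: "zorder (\<lambda>z. f z - f z0) z0 = int 1" by simp
  obtain \<rho> g where g: "\<rho> > 0" "ball z0 \<rho> \<subseteq> A" "g holomorphic_on ball z0 \<rho>"
    "\<And>z. z \<in> ball z0 \<rho> \<Longrightarrow> g z \<noteq> 0 \<and> f z - f z0 = g z * (z - z0) ^ 1"
    by (rule zorder_pos_factor[OF f 1 nz]) (rule that)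
  have "(g has_field_derivative deriv g z0) (at z0)"
    using g(1,3) by (simp add: holomorphic_derivI)
  then have "((\<lambda>z. f z0 + g z * (z - z0)) has_field_derivative g z0) (at z0)"
    by (auto intro!: derivative_eq_intros)
  then have "(f has_field_derivative g z0) (at z0)"
  proof (rule has_field_derivative_transform_within_open)
    show "f z0 + g z * (z - z0) = f z" if "z \<in> ball z0 \<rho>" for z
      using g(4)[OF that] by (simp add: algebra_simps)
  qed (use g(1) in auto)
  then have "deriv f z0 \<noteq> 0" using g(1,4) by (simp add: DERIV_imp_deriv)
  then show ?thesis
    using has_complex_derivative_locally_injective[OF f(1,3,2)] that by blast
qed

text \<open>The cofactor \<open>g\<close> has no zeros on a ball, so it has a holomorphic square
  root \<open>q\<close> there. Then \<open>h = (z - z0) * q\<close> has derivative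
  \<open>q z0 \<noteq> 0\<close>, so on a smaller ball it is a coordinate in which the double cover
  is squaring.\<close>

lemma zorder_2_square:
  assumes f: "f holomorphic_on A" "open A" "z0 \<in> A" and 2: "zorder (\<lambda>z. f z - f z0) z0 = 2"
    and nz: "\<exists>\<^sub>F z in at z0. f z \<noteq> f z0"
  obtains \<rho> h where "\<rho> > 0" "ball z0 \<rho> \<subseteq> A" "h holomorphic_on ball z0 \<rho>"
    "inj_on h (ball z0 \<rho>)" "h z0 = 0" "\<And>z. z \<in> ball z0 \<rho> \<Longrightarrow> f z - f z0 = (h z)\<^sup>2"
proof -
  from 2 have 2: "zorder (\<lambda>z. f z - f z0) z0 = int 2" by simp
  obtain \<rho> g where g: "\<rho> > 0" "ball z0 \<rho> \<subseteq> A" "g holomorphic_on ball z0 \<rho>"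
    "\<And>z. z \<in> ball z0 \<rho> \<Longrightarrow> g z \<noteq> 0 \<and> f z - f z0 = g z * (z - z0) ^ 2"
    by (rule zorder_pos_factor[OF f 2 nz]) (rule that)
  obtain q where q: "q holomorphic_on ball z0 \<rho>" "\<And>z. z \<in> ball z0 \<rho> \<Longrightarrow> g z = (q z)\<^sup>2"
    using contractible_imp_holomorphic_sqrt[OF g(3)] g(4)
    by (metis convex_imp_contractible convex_ball)
  define h where "h = (\<lambda>z. (z - z0) * q z)"
  have h: "h holomorphic_on ball z0 \<rho>" unfolding h_def by (intro holomorphic_intros q)
  have "(q has_field_derivative deriv q z0) (at z0)"
    using g(1) q(1) by (simp add: holomorphic_derivI)
  then have "(h has_field_derivative q z0) (at z0)"
    unfolding h_def by (auto intro!: derivative_eq_intros)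
  moreover have "q z0 \<noteq> 0" using q(2)[of z0] g(4)[of z0] g(1) by auto
  ultimately have "deriv h z0 \<noteq> 0" by (simp add: DERIV_imp_deriv)
  then obtain r where r: "r > 0" "ball z0 r \<subseteq> ball z0 \<rho>" "inj_on h (ball z0 r)"
    using has_complex_derivative_locally_injective[OF h] g(1) by (metis centre_in_ball open_ball)
  show ?thesis
  proof (rule that[of r h])
    show "ball z0 r \<subseteq> A" using r g by blast
    show "h holomorphic_on ball z0 r" using h r(2) holomorphic_on_subset by blast
    show "h z0 = 0" by (simp add: h_def)
    show "f z - f z0 = (h z)\<^sup>2" if "z \<in> ball z0 r" for z
      using g(4)[of z] q(2)[of z] that r(2) by (auto simp: h_def power_mult_distrib mult.commute)
  qed (use r in auto)
qed

section \<open>Charts of a Riemann surface\<close>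

locale rsurface =
  fixes S :: "'a surface"
  assumes rsurface: "riemann_surface S"
begin

lemma chartD:
  assumes "(C, \<kappa>) \<in> charts S"
  shows "openin (topo S) C" "open (\<kappa> ` C)"
    "homeomorphic_map (subtopology (topo S) C) (top_of_set (\<kappa> ` C)) \<kappa>"
    "C \<subseteq> points S"
  using assms rsurface openin_subset unfolding riemann_surface_def by blast+

lemma chart_inj: "(C, \<kappa>) \<in> charts S \<Longrightarrow> inj_on \<kappa> C"
  using homeomorphic_imp_injective_map[OF chartD(3)] chartD(4) by (auto simp: Int_absorb1)

lemma chart_inv [simp]: "(C, \<kappa>) \<in> charts S \<Longrightarrow> x \<in> C \<Longrightarrow> inv_into C \<kappa> (\<kappa> x) = x"
  by (simp add: chart_inj)

lemma chart_at_in: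
  assumes "p \<in> points S" "chart_at S p = (C, \<kappa>)"
  shows "(C, \<kappa>) \<in> charts S" "p \<in> C"
proof -
  have "p \<in> (\<Union>(C, \<kappa>)\<in>charts S. C)"
    using rsurface assms(1) unfolding riemann_surface_def by blast
  then have "\<exists>c. c \<in> charts S \<and> p \<in> fst c" by force
  then have "chart_at S p \<in> charts S \<and> p \<in> fst (chart_at S p)"
    unfolding chart_at_def by (rule someI_ex)
  then show "(C, \<kappa>) \<in> charts S" "p \<in> C" using assms(2) by auto
qed

lemma chart_image_open:
  assumes "(C, \<kappa>) \<in> charts S" "openin (topo S) U"
  shows "open (\<kappa> ` (C \<inter> U))"
proof -
  have "openin (subtopology (topo S) C) (C \<inter> U)"
    using assms(2) openin_subtopology_Int2 by blast
  then have "openin (top_of_set (\<kappa> ` C)) (\<kappa> ` (C \<inter> U))"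
    using homeomorphic_map_openness_eq[OF chartD(3)[OF assms(1)]] by blast
  then show ?thesis using chartD(2)[OF assms(1)] openin_open_trans by blast
qed

lemma chart_vimage_open:
  assumes "(C, \<kappa>) \<in> charts S" "open V"
  shows "openin (topo S) {x \<in> C. \<kappa> x \<in> V}"
proof -
  have "continuous_map (subtopology (topo S) C) (top_of_set (\<kappa> ` C)) \<kappa>"
    using chartD(3)[OF assms(1)] homeomorphic_imp_continuous_map by blast
  moreover have "openin (top_of_set (\<kappa> ` C)) (\<kappa> ` C \<inter> V)"
    using assms(2) openin_open by blast
  ultimately have "openin (subtopology (topo S) C)
      {x \<in> topspace (subtopology (topo S) C). \<kappa> x \<in> \<kappa> ` C \<inter> V}"
    by (rule openin_continuous_map_preimage)
  also have "{x \<in> topspace (subtopology (topo S) C). \<kappa> x \<in> \<kappa> ` C \<inter> V} = {x \<in> C. \<kappa> x \<in> V}"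
    using chartD(4)[OF assms(1)] by auto
  finally show ?thesis using chartD(1)[OF assms(1)] openin_trans_full by blast
qed

text \<open>A chart is a homeomorphism onto an open set, so it matches neighbourhood filters. Local
  facts about functions of a coordinate thereby become statements on the surface that mention no
  chart.\<close>

lemma eventually_nhds_chart:
  assumes c: "(C, \<kappa>) \<in> charts S" and p: "p \<in> C"
  shows "(\<forall>\<^sub>F z in nhds (\<kappa> p). P (inv_into C \<kappa> z)) \<longleftrightarrow> (\<forall>\<^sub>F x in nhdsin (topo S) p. P x)"
proof
  assume "\<forall>\<^sub>F z in nhds (\<kappa> p). P (inv_into C \<kappa> z)"
  then obtain V where V: "open V" "\<kappa> p \<in> V" "\<And>z. z \<in> V \<Longrightarrow> P (inv_into C \<kappa> z)"
    unfolding eventually_nhds by blast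
  have "openin (topo S) {x \<in> C. \<kappa> x \<in> V}" using chart_vimage_open[OF c V(1)] .
  moreover have "P x" if "x \<in> {x \<in> C. \<kappa> x \<in> V}" for x
    using V(3)[of "\<kappa> x"] that chart_inv[OF c, of x] by auto
  ultimately show "\<forall>\<^sub>F x in nhdsin (topo S) p. P x"
    unfolding eventually_nhdsin using p V(2) by blast
next
  assume "\<forall>\<^sub>F x in nhdsin (topo S) p. P x"
  then obtain U where U: "openin (topo S) U" "p \<in> U" "\<And>x. x \<in> U \<Longrightarrow> P x"
    unfolding eventually_nhdsin using p chartD(4)[OF c] by blast
  have "P (inv_into C \<kappa> z)" if "z \<in> \<kappa> ` (C \<inter> U)" for z
    using that U(3) chart_inv[OF c] by auto
  then show "\<forall>\<^sub>F z in nhds (\<kappa> p). P (inv_into C \<kappa> z)"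
    unfolding eventually_nhds using chart_image_open[OF c U(1)] p U(2) by blast
qed

lemma eventually_at_chart:
  assumes c: "(C, \<kappa>) \<in> charts S" and p: "p \<in> C"
  shows "(\<forall>\<^sub>F z in at (\<kappa> p). P (inv_into C \<kappa> z)) \<longleftrightarrow> (\<forall>\<^sub>F x in nhdsin (topo S) p. x \<noteq> p \<longrightarrow> P x)"
proof -
  have "(\<forall>\<^sub>F z in at (\<kappa> p). P (inv_into C \<kappa> z)) \<longleftrightarrow>
        (\<forall>\<^sub>F z in nhds (\<kappa> p). inv_into C \<kappa> z \<noteq> p \<longrightarrow> P (inv_into C \<kappa> z))"
  proof -
    have "\<forall>\<^sub>F z in nhds (\<kappa> p). z \<in> \<kappa> ` C"
      using chartD(2)[OF c] p eventually_nhds by blast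
    then have "\<forall>\<^sub>F z in nhds (\<kappa> p). inv_into C \<kappa> z = p \<longleftrightarrow> z = \<kappa> p"
      by eventually_elim (use chart_inv[OF c] p in auto)
    then show ?thesis
      unfolding eventually_at_filter by (intro eventually_cong) (auto elim: eventually_mono)
  qed
  also have "\<dots> \<longleftrightarrow> (\<forall>\<^sub>F x in nhdsin (topo S) p. x \<noteq> p \<longrightarrow> P x)"
    by (rule eventually_nhds_chart[OF c p])
  finally show ?thesis .
qed

text \<open>Nonempty open subsets of the plane are infinite. Against the finiteness of fibres this
  shows that the projection is nowhere locally constant.\<close>

lemma infinite_nhd:
  assumes "openin (topo S) U" "p \<in> U"
  shows "infinite U"
proof
  assume "finite U"
  have p: "p \<in> points S" using assms openin_subset by blast
  obtain C \<kappa> where c: "chart_at S p = (C, \<kappa>)" by fastforce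
  note c = chart_at_in[OF p c]
  have "finite (\<kappa> ` (C \<inter> U))" using \<open>finite U\<close> by simp
  moreover have "open (\<kappa> ` (C \<inter> U))" "\<kappa> ` (C \<inter> U) \<noteq> {}"
    using chart_image_open[OF c(1) assms(1)] c assms by auto
  ultimately show False using finite_imp_not_open by blast
qed

end

section \<open>Holomorphic line bundles\<close>

locale holo_line_bundle = rsurface S for S :: "'a surface" +
  fixes L :: "('a, 'e) line_bundle"
  assumes holo_line_bundle: "holomorphic_line_bundle S L"
begin

lemma trivD:
  assumes "(U, \<phi>) \<in> trivs L"
  shows "openin (topo S) U" "U \<subseteq> points S"
proof -
  show "openin (topo S) U"
    using assms holo_line_bundle unfolding holomorphic_line_bundle_def by auto
  then show "U \<subseteq> points S" by (rule openin_subset)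
qed

lemma triv_fibre:
  assumes "(U, \<phi>) \<in> trivs L" "x \<in> U"
  shows triv_bij: "bij_betw (\<phi> x) (fibre L x) UNIV"
    and fadd_in: "e \<in> fibre L x \<Longrightarrow> e' \<in> fibre L x \<Longrightarrow> fadd L x e e' \<in> fibre L x"
    and triv_add: "e \<in> fibre L x \<Longrightarrow> e' \<in> fibre L x \<Longrightarrow> \<phi> x (fadd L x e e') = \<phi> x e + \<phi> x e'"
    and fscale_in: "e \<in> fibre L x \<Longrightarrow> fscale L x c e \<in> fibre L x"
    and triv_scale: "e \<in> fibre L x \<Longrightarrow> \<phi> x (fscale L x c e) = c * \<phi> x e"
proof -
  have "openin (topo S) U \<and>
        (\<forall>x\<in>U. bij_betw (\<phi> x) (fibre L x) UNIV \<and>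
           (\<forall>e\<in>fibre L x. \<forall>e'\<in>fibre L x.
              fadd L x e e' \<in> fibre L x \<and> \<phi> x (fadd L x e e') = \<phi> x e + \<phi> x e') \<and>
           (\<forall>c. \<forall>e\<in>fibre L x.
              fscale L x c e \<in> fibre L x \<and> \<phi> x (fscale L x c e) = c * \<phi> x e))"
    using bspec[OF conjunct1[OF conjunct2[OF holo_line_bundle[unfolded holomorphic_line_bundle_def]]] assms(1)]
    by simp
  note * = bspec[OF conjunct2[OF this] assms(2)]
  show "bij_betw (\<phi> x) (fibre L x) UNIV"
    and "e \<in> fibre L x \<Longrightarrow> e' \<in> fibre L x \<Longrightarrow> fadd L x e e' \<in> fibre L x"
    and "e \<in> fibre L x \<Longrightarrow> e' \<in> fibre L x \<Longrightarrow> \<phi> x (fadd L x e e') = \<phi> x e + \<phi> x e'"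
    and "e \<in> fibre L x \<Longrightarrow> fscale L x c e \<in> fibre L x"
    and "e \<in> fibre L x \<Longrightarrow> \<phi> x (fscale L x c e) = c * \<phi> x e"
    using * by blast+
qed

lemma triv_inj:
  assumes "(U, \<phi>) \<in> trivs L" "x \<in> U" "e \<in> fibre L x" "e' \<in> fibre L x" "\<phi> x e = \<phi> x e'"
  shows "e = e'"
  using triv_bij[OF assms(1,2)] assms(3-) by (auto simp: bij_betw_def inj_on_def)

lemma triv_ex:
  assumes "x \<in> points S"
  obtains U \<phi> where "(U, \<phi>) \<in> trivs L" "x \<in> U"
proof -
  have "x \<in> (\<Union>(U, \<phi>)\<in>trivs L. U)"
    using conjunct1[OF holo_line_bundle[unfolded holomorphic_line_bundle_def]] assms by simp
  then show ?thesis using that by force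
qed

lemma triv_at_in:
  assumes "p \<in> points S" "triv_at L p = (U, \<phi>)"
  shows "(U, \<phi>) \<in> trivs L" "p \<in> U"
proof -
  obtain V \<psi> where "(V, \<psi>) \<in> trivs L" "p \<in> V" using triv_ex[OF assms(1)] .
  then have "\<exists>c. c \<in> trivs L \<and> p \<in> fst c" by force
  then have "triv_at L p \<in> trivs L \<and> p \<in> fst (triv_at L p)"
    unfolding triv_at_def by (rule someI_ex)
  then show "(U, \<phi>) \<in> trivs L" "p \<in> U" using assms(2) by auto
qed

lemma frame:
  assumes "(U, \<phi>) \<in> trivs L" "x \<in> U"
  shows frame_in: "frame L \<phi> x \<in> fibre L x" and triv_frame: "\<phi> x (frame L \<phi> x) = 1"
proof -
  have "1 \<in> \<phi> x ` fibre L x" using triv_bij[OF assms] by (auto simp: bij_betw_def)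
  then show "frame L \<phi> x \<in> fibre L x" "\<phi> x (frame L \<phi> x) = 1"
    unfolding frame_def by (auto intro: inv_into_into f_inv_into_f)
qed

lemma expand_frame:
  assumes "(U, \<phi>) \<in> trivs L" "x \<in> U" "e \<in> fibre L x"
  shows "e = fscale L x (\<phi> x e) (frame L \<phi> x)"
  using assms by (intro triv_inj[OF assms(1,2)]) (simp_all add: fscale_in triv_scale frame_in triv_frame)

lemma transition:
  assumes "(U, \<phi>) \<in> trivs L" "x \<in> U" "(U', \<phi>') \<in> trivs L" "x \<in> U'" "e \<in> fibre L x"
  shows "\<phi>' x e = \<phi>' x (frame L \<phi> x) * \<phi> x e"
proof -
  have "\<phi>' x e = \<phi>' x (fscale L x (\<phi> x e) (frame L \<phi> x))"
    using expand_frame[OF assms(1,2,5)] by simp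
  also have "\<dots> = \<phi> x e * \<phi>' x (frame L \<phi> x)"
    using assms by (simp add: triv_scale frame_in)
  finally show ?thesis by simp
qed

lemma transition_inverse:
  assumes "(U, \<phi>) \<in> trivs L" "x \<in> U" "(U', \<phi>') \<in> trivs L" "x \<in> U'"
  shows "\<phi>' x (frame L \<phi> x) * \<phi> x (frame L \<phi>' x) = 1"
  using transition[OF assms frame_in[OF assms(3,4)]] triv_frame[OF assms(3,4)] by simp

lemma transition_holo:
  assumes "(U, \<phi>) \<in> trivs L" "(U', \<phi>') \<in> trivs L" "(C, \<kappa>) \<in> charts S"
  shows "(\<lambda>z. \<phi>' (inv_into C \<kappa> z) (frame L \<phi> (inv_into C \<kappa> z))) holomorphic_on \<kappa> ` (C \<inter> U \<inter> U')"
proof -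
  note * = conjunct2[OF conjunct2[OF holo_line_bundle[unfolded holomorphic_line_bundle_def]]]
  from bspec[OF * assms(1)] have "\<forall>(U', \<phi>')\<in>trivs L. \<forall>(C, \<kappa>)\<in>charts S.
        (\<lambda>z. let x = inv_into C \<kappa> z in \<phi>' x (frame L \<phi> x)) holomorphic_on \<kappa> ` (C \<inter> U \<inter> U')"
    by simp
  from bspec[OF bspec[OF this assms(2), simplified] assms(3)] show ?thesis
    by (simp add: Let_def)
qed

lemma section_in:
  "meromorphic_section S L s \<Longrightarrow> x \<in> points S \<Longrightarrow> s x \<in> fibre L x"
  unfolding meromorphic_section_def by blast

lemma section_mero:
  assumes "meromorphic_section S L s" "(U, \<phi>) \<in> trivs L" "(C, \<kappa>) \<in> charts S"
  shows "(\<lambda>z. \<phi> (inv_into C \<kappa> z) (s (inv_into C \<kappa> z))) nicely_meromorphic_on \<kappa> ` (C \<inter> U)"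
proof -
  note * = conjunct2[OF assms(1)[unfolded meromorphic_section_def]]
  show ?thesis
    using bspec[OF bspec[OF * assms(2), simplified] assms(3)] by (simp add: Let_def)
qed

lemma section_zero_iff:
  assumes "meromorphic_section S L s" "(U, \<phi>) \<in> trivs L" "x \<in> U"
  shows "\<phi> x (s x) = 0 \<longleftrightarrow> s x = fscale L x 0 (s x)"
proof -
  have e: "s x \<in> fibre L x" using assms section_in trivD(2) by blast
  show ?thesis
    using triv_inj[OF assms(2,3) e fscale_in[OF assms(2,3) e, of 0]] triv_scale[OF assms(2,3) e, of 0]
    by (metis mult_zero_left)
qed

lemma section_mero_at:
  assumes "meromorphic_section S L s" "(U, \<phi>) \<in> trivs L" "(C, \<kappa>) \<in> charts S" "p \<in> C" "p \<in> U"
  shows "(\<lambda>z. \<phi> (inv_into C \<kappa> z) (s (inv_into C \<kappa> z))) meromorphic_on {\<kappa> p}"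
proof (rule meromorphic_on_subset)
  show "(\<lambda>z. \<phi> (inv_into C \<kappa> z) (s (inv_into C \<kappa> z))) meromorphic_on \<kappa> ` (C \<inter> U)"
    using section_mero[OF assms(1-3)] by (simp add: nicely_meromorphic_on_def)
qed (use assms(4,5) in auto)

text \<open>The points near which the section vanishes identically form an open and closed set.\<close>

lemma section_nonzero_near:
  assumes s: "meromorphic_section S L s" "nonzero_section S L s" and p: "p \<in> points S"
  shows "\<forall>\<^sub>F x in nhdsin (topo S) p. x \<noteq> p \<longrightarrow> s x \<noteq> fscale L x 0 (s x)"
proof -
  define van where "van x \<longleftrightarrow> s x = fscale L x 0 (s x)" for x
  define Z where "Z = {q \<in> points S. \<forall>\<^sub>F x in nhdsin (topo S) q. van x}"
  \<comment> \<open>The local dichotomy: a section that does not vanish on a whole neighbourhood of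
    \<open>q\<close> vanishes nowhere on some punctured one. This makes the complement of
    \<open>Z\<close> open.\<close>
  have near: "\<forall>\<^sub>F x in nhdsin (topo S) q. x \<noteq> q \<longrightarrow> \<not> van x" if q: "q \<in> points S" "q \<notin> Z" for q
  proof -
    obtain C \<kappa> where "chart_at S q = (C, \<kappa>)" by fastforce
    note c = chart_at_in[OF q(1) this]
    obtain U \<phi> where t: "(U, \<phi>) \<in> trivs L" "q \<in> U" using triv_ex[OF q(1)] .
    let ?F = "\<lambda>z. \<phi> (inv_into C \<kappa> z) (s (inv_into C \<kappa> z))"
    have inU: "\<forall>\<^sub>F x in nhdsin (topo S) q. x \<in> U"
      unfolding eventually_nhdsin using trivD[OF t(1)] t(2) by blast
    have van: "van x \<longleftrightarrow> \<phi> x (s x) = 0" if "x \<in> U" for x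
      using section_zero_iff[OF s(1) t(1) that] by (simp add: van_def)
    have "\<not> (\<forall>\<^sub>F z in nhds (\<kappa> q). ?F z = 0)"
    proof
      assume "\<forall>\<^sub>F z in nhds (\<kappa> q). ?F z = 0"
      then have "\<forall>\<^sub>F x in nhdsin (topo S) q. \<phi> x (s x) = 0"
        using eventually_nhds_chart[OF c, of "\<lambda>x. \<phi> x (s x) = 0"] by simp
      with inU have "\<forall>\<^sub>F x in nhdsin (topo S) q. van x"
        by eventually_elim (use van in blast)
      with q show False by (simp add: Z_def)
    qed
    with nicely_meromorphic_eventually_nonzero[OF section_mero[OF s(1) t(1) c(1)]] c t
    have "\<forall>\<^sub>F z in at (\<kappa> q). ?F z \<noteq> 0" by blast
    then have "\<forall>\<^sub>F x in nhdsin (topo S) q. x \<noteq> q \<longrightarrow> \<phi> x (s x) \<noteq> 0"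
      using eventually_at_chart[OF c, of "\<lambda>x. \<phi> x (s x) \<noteq> 0"] by simp
    with inU show ?thesis by eventually_elim (use van in blast)
  qed
  have "openin (topo S) Z"
  proof (subst openin_subopen, intro ballI)
    fix q assume "q \<in> Z"
    then obtain V where V: "openin (topo S) V" "q \<in> V" "\<And>x. x \<in> V \<Longrightarrow> van x"
      by (auto simp: Z_def eventually_nhdsin)
    then have "V \<subseteq> Z"
      using openin_subset by (fastforce simp: Z_def eventually_nhdsin)
    with V show "\<exists>V. openin (topo S) V \<and> q \<in> V \<and> V \<subseteq> Z" by blast
  qed
  moreover have "openin (topo S) (points S - Z)"
  proof (subst openin_subopen, intro ballI)
    fix q assume q: "q \<in> points S - Z"
    then obtain V where V: "openin (topo S) V" "q \<in> V" "\<And>x. x \<in> V \<Longrightarrow> x \<noteq> q \<Longrightarrow> \<not> van x"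
      using near[of q] unfolding eventually_nhdsin by blast
    have "x \<notin> Z" if "x \<in> V" for x
    proof (cases "x = q")
      case False
      have "x \<in> points S" using V(1) that openin_subset by blast
      then show ?thesis
        using V(3)[OF that False] unfolding Z_def eventually_nhdsin by blast
    qed (use q in simp)
    then have "V \<subseteq> points S - Z" using V(1) openin_subset by blast
    with V show "\<exists>V. openin (topo S) V \<and> q \<in> V \<and> V \<subseteq> points S - Z" by blast
  qed
  moreover have "connected_space (topo S)"
    using rsurface unfolding riemann_surface_def by blast
  ultimately have "Z = {} \<or> Z = points S"
    unfolding connected_space_clopen_in closedin_def Z_def by blast
  moreover have "Z \<noteq> points S"
  proof -
    obtain q where q: "q \<in> points S" "\<not> van q"
      using s(2) unfolding nonzero_section_def van_def by blast
    then have "q \<notin> Z" unfolding Z_def eventually_nhdsin by blast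
    with q show ?thesis by blast
  qed
  ultimately have "p \<notin> Z" using p by blast
  from near[OF p this] show ?thesis by (simp add: van_def)
qed

lemma section_nonzero_near_chart:
  assumes s: "meromorphic_section S L s" "nonzero_section S L s"
    and t: "(U, \<phi>) \<in> trivs L" "p \<in> U" and c: "(C, \<kappa>) \<in> charts S" "p \<in> C"
  shows "\<forall>\<^sub>F z in at (\<kappa> p). \<phi> (inv_into C \<kappa> z) (s (inv_into C \<kappa> z)) \<noteq> 0"
proof -
  have "p \<in> points S" using trivD(2)[OF t(1)] t(2) by blast
  note section_nonzero_near[OF s this]
  moreover have "\<forall>\<^sub>F x in nhdsin (topo S) p. x \<in> U"
    unfolding eventually_nhdsin using trivD[OF t(1)] t(2) by blast
  ultimately have "\<forall>\<^sub>F x in nhdsin (topo S) p. x \<noteq> p \<longrightarrow> \<phi> x (s x) \<noteq> 0"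
    by eventually_elim (use section_zero_iff[OF s(1) t(1)] in blast)
  then show ?thesis
    using eventually_at_chart[OF c, of "\<lambda>x. \<phi> x (s x) \<noteq> 0"] by simp
qed

text \<open>A change of trivialisation multiplies the local expression by a transition function,
  which is holomorphic and has an inverse, so the order computed in a fixed chart does not change.
  This frees \<open>section_ord\<close> from the trivialisation picked by
  \<open>triv_at\<close>.\<close>

lemma section_ord_triv:
  assumes s: "meromorphic_section S L s" "nonzero_section S L s" and p: "p \<in> points S"
    and t: "(U, \<phi>) \<in> trivs L" "p \<in> U" and c: "chart_at S p = (C, \<kappa>)"
  shows "section_ord S L s p = zorder (\<lambda>z. \<phi> (inv_into C \<kappa> z) (s (inv_into C \<kappa> z))) (\<kappa> p)"
proof -
  obtain U' \<phi>' where t'0: "triv_at L p = (U', \<phi>')" by fastforce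
  note t' = triv_at_in[OF p t'0]
  note c' = chart_at_in[OF p c]
  let ?x = "inv_into C \<kappa>"
  let ?F = "\<lambda>z. \<phi>' (?x z) (s (?x z))" and ?G = "\<lambda>z. \<phi> (?x z) (frame L \<phi>' (?x z))"
  have op: "open (\<kappa> ` (C \<inter> U' \<inter> U))" and inA: "\<kappa> p \<in> \<kappa> ` (C \<inter> U' \<inter> U)"
    using chart_image_open[OF c'(1) openin_Int[OF trivD(1)[OF t'(1)] trivD(1)[OF t(1)]]] t t' c'
    by (auto simp: Int_assoc)
  have an: "?G analytic_on {\<kappa> p}"
    using transition_holo[OF t'(1) t(1) c'(1)] op inA analytic_at by blast
  have ne: "?G (\<kappa> p) \<noteq> 0"
    using transition_inverse[OF t' t] c' by (auto simp: chart_inv)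
  have mero: "?F meromorphic_on {\<kappa> p}"
    using section_mero_at[OF s(1) t'(1) c' t'(2)] .
  have nz: "\<exists>\<^sub>F z in at (\<kappa> p). ?F z \<noteq> 0"
    using section_nonzero_near_chart[OF s t' c'] by (simp add: eventually_frequently)
  have "\<forall>\<^sub>F z in nhds (\<kappa> p). \<phi> (?x z) (s (?x z)) = ?G z * ?F z"
  proof -
    have "\<forall>\<^sub>F z in nhds (\<kappa> p). z \<in> \<kappa> ` (C \<inter> U' \<inter> U)"
      using op inA eventually_nhds by blast
    then show ?thesis
    proof eventually_elim
      case (elim z)
      then obtain x where x: "x \<in> C" "x \<in> U'" "x \<in> U" "z = \<kappa> x" by blast
      then have "s x \<in> fibre L x" using section_in[OF s(1)] trivD(2)[OF t(1)] by blast
      then show ?case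
        using transition[OF t'(1) x(2) t(1) x(3)] x(1,4) chart_inv[OF c'(1)] by simp
    qed
  qed
  then have "\<forall>\<^sub>F z in at (\<kappa> p). \<phi> (?x z) (s (?x z)) = ?G z * ?F z"
    by (simp add: eventually_nhds_conv_at)
  then have "zorder (\<lambda>z. \<phi> (?x z) (s (?x z))) (\<kappa> p) = zorder (\<lambda>z. ?G z * ?F z) (\<kappa> p)"
    by (rule zorder_cong) simp
  also have "\<dots> = zorder ?F (\<kappa> p)"
    by (rule zorder_nonvanishing_mult[OF mero nz an ne])
  finally show ?thesis
    by (simp add: section_ord_def t'0 ord_at_def c)
qed

text \<open>Order zero excludes a pole, so nice meromorphy makes the local expression analytic at
  the point, with its true value there; an analytic germ of order zero has nonzero value. At
  Weierstrass points this makes the values of \<open>u\<close> a basis of \<open>V\<close>.\<close>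

lemma section_nonzero_if_ord_0:
  assumes s: "meromorphic_section S L s" "nonzero_section S L s" and p: "p \<in> points S"
    and 0: "section_ord S L s p = 0"
  shows "s p \<noteq> fscale L p 0 (s p)"
proof -
  obtain U \<phi> where t: "(U, \<phi>) \<in> trivs L" "p \<in> U" using triv_ex[OF p] .
  obtain C \<kappa> where c0: "chart_at S p = (C, \<kappa>)" by fastforce
  note c = chart_at_in[OF p c0]
  let ?F = "\<lambda>z. \<phi> (inv_into C \<kappa> z) (s (inv_into C \<kappa> z))"
  have z0: "zorder ?F (\<kappa> p) = 0" using section_ord_triv[OF s p t c0] 0 by simp
  have nz: "\<forall>\<^sub>F z in at (\<kappa> p). ?F z \<noteq> 0"
    using section_nonzero_near_chart[OF s t c] .
  have nice: "?F nicely_meromorphic_on \<kappa> ` (C \<inter> U)" and inA: "\<kappa> p \<in> \<kappa> ` (C \<inter> U)"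
    using section_mero[OF s(1) t(1) c(1)] c t by auto
  have mero: "?F meromorphic_on {\<kappa> p}" using section_mero_at[OF s(1) t(1) c t(2)] .
  have np: "\<not> is_pole ?F (\<kappa> p)"
    using z0 isolated_pole_imp_neg_zorder mero meromorphic_at_iff by fastforce
  have "?F analytic_on {\<kappa> p}"
    by (rule nicely_meromorphic_on_imp_analytic_at[OF nice inA np])
  moreover have "\<exists>\<^sub>F z in at (\<kappa> p). ?F z \<noteq> 0"
    using nz by (simp add: eventually_frequently)
  ultimately have "?F (\<kappa> p) \<noteq> 0"
    using zorder_eq_0_iff z0 by blast
  then show ?thesis
    using section_zero_iff[OF s(1) t] c by (simp add: chart_inv)
qed

end

section \<open>The dual bundle and the inverse of a section\<close>

context holo_line_bundle
begin

lemma dual_fibre_iff: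
  "f \<in> fibre (dual_bundle L) x \<longleftrightarrow>
     (\<forall>e\<in>fibre L x. \<forall>e'\<in>fibre L x. f (fadd L x e e') = f e + f e') \<and>
     (\<forall>c. \<forall>e\<in>fibre L x. f (fscale L x c e) = c * f e) \<and>
     (\<forall>e. e \<notin> fibre L x \<longrightarrow> f e = 0)"
  by (simp add: dual_bundle_def)

lemma dual_eval:
  assumes "(U, \<phi>) \<in> trivs L" "x \<in> U" "f \<in> fibre (dual_bundle L) x" "e \<in> fibre L x"
  shows "f e = \<phi> x e * f (frame L \<phi> x)"
proof -
  have "f (fscale L x (\<phi> x e) (frame L \<phi> x)) = \<phi> x e * f (frame L \<phi> x)"
    using assms(3) frame_in[OF assms(1,2)] by (simp add: dual_fibre_iff)
  then show ?thesis using expand_frame[OF assms(1,2,4)] by simp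
qed

lemma dual_eqI:
  assumes "(U, \<phi>) \<in> trivs L" "x \<in> U" "f \<in> fibre (dual_bundle L) x" "f' \<in> fibre (dual_bundle L) x"
    and "f (frame L \<phi> x) = f' (frame L \<phi> x)"
  shows "f = f'"
proof
  fix e show "f e = f' e"
  proof (cases "e \<in> fibre L x")
    case True
    then show ?thesis
      using dual_eval[OF assms(1,2,3)] dual_eval[OF assms(1,2,4)] assms(5) by simp
  next
    case False
    then show ?thesis using assms(3,4) by (simp add: dual_fibre_iff)
  qed
qed

lemma dual_coord:
  assumes "(U, \<phi>) \<in> trivs L" "x \<in> U"
  shows "(\<lambda>e. if e \<in> fibre L x then c * \<phi> x e else 0) \<in> fibre (dual_bundle L) x"
  using fadd_in[OF assms] triv_add[OF assms] fscale_in[OF assms] triv_scale[OF assms]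
  by (simp add: dual_fibre_iff algebra_simps)

definition dual_triv :: "('a \<Rightarrow> 'e \<Rightarrow> complex) \<Rightarrow> 'a \<Rightarrow> ('e \<Rightarrow> complex) \<Rightarrow> complex" where
  "dual_triv \<phi> = (\<lambda>x f. f (frame L \<phi> x))"

lemma trivs_dual: "trivs (dual_bundle L) = (\<lambda>(U, \<phi>). (U, dual_triv \<phi>)) ` trivs L"
  by (simp add: dual_bundle_def dual_triv_def)

lemma dual_triv_in: "(U, \<phi>) \<in> trivs L \<Longrightarrow> (U, dual_triv \<phi>) \<in> trivs (dual_bundle L)"
  unfolding trivs_dual by force

lemma dual_triv_bij:
  assumes "(U, \<phi>) \<in> trivs L" "x \<in> U"
  shows "bij_betw (dual_triv \<phi> x) (fibre (dual_bundle L) x) UNIV"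
proof -
  have "inj_on (dual_triv \<phi> x) (fibre (dual_bundle L) x)"
    by (rule inj_onI) (auto simp: dual_triv_def intro: dual_eqI[OF assms])
  moreover have "c \<in> dual_triv \<phi> x ` fibre (dual_bundle L) x" for c
    using dual_coord[OF assms, of c] frame[OF assms]
    by (intro image_eqI[of _ _ "\<lambda>e. if e \<in> fibre L x then c * \<phi> x e else 0"])
       (auto simp: dual_triv_def)
  ultimately show ?thesis by (auto simp: bij_betw_def)
qed

lemma dual_frame:
  assumes "(U, \<phi>) \<in> trivs L" "x \<in> U"
  shows "frame (dual_bundle L) (dual_triv \<phi>) x \<in> fibre (dual_bundle L) x"
    and "frame (dual_bundle L) (dual_triv \<phi>) x (frame L \<phi> x) = 1"
proof -
  have 1: "1 \<in> dual_triv \<phi> x ` fibre (dual_bundle L) x"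
    using dual_triv_bij[OF assms] by (auto simp: bij_betw_def)
  show "frame (dual_bundle L) (dual_triv \<phi>) x \<in> fibre (dual_bundle L) x"
    unfolding frame_def[of "dual_bundle L"] using 1 by (rule inv_into_into)
  show "frame (dual_bundle L) (dual_triv \<phi>) x (frame L \<phi> x) = 1"
    using f_inv_into_f[OF 1] unfolding frame_def[of "dual_bundle L"] by (simp add: dual_triv_def)
qed

text \<open>The transition function of the dual from \<open>\<phi>\<close> to \<open>\<phi>'\<close>
  is the one of \<open>L\<close> from \<open>\<phi>'\<close> to \<open>\<phi>\<close>, so its
  holomorphy is that of \<open>L\<close> with the roles exchanged.\<close>

lemma dual: "holo_line_bundle S (dual_bundle L)"
proof
  let ?D = "dual_bundle L"
  have un: "(\<Union>(U, \<psi>)\<in>trivs ?D. U) = points S"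
    using conjunct1[OF holo_line_bundle[unfolded holomorphic_line_bundle_def]]
    unfolding trivs_dual by (simp add: case_prod_unfold)
  have fib: "openin (topo S) U \<and>
        (\<forall>x\<in>U. bij_betw (\<psi> x) (fibre ?D x) UNIV \<and>
           (\<forall>e\<in>fibre ?D x. \<forall>e'\<in>fibre ?D x.
              fadd ?D x e e' \<in> fibre ?D x \<and> \<psi> x (fadd ?D x e e') = \<psi> x e + \<psi> x e') \<and>
           (\<forall>c. \<forall>e\<in>fibre ?D x.
              fscale ?D x c e \<in> fibre ?D x \<and> \<psi> x (fscale ?D x c e) = c * \<psi> x e))"
    if "(U, \<psi>) \<in> trivs ?D" for U \<psi>
  proof -
    from that obtain \<phi> where t: "(U, \<phi>) \<in> trivs L" "\<psi> = dual_triv \<phi>"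
      unfolding trivs_dual by auto
    have add: "fadd ?D x f f' = (\<lambda>e. f e + f' e)" and sc: "fscale ?D x c f = (\<lambda>e. c * f e)" for x f f' c
      by (simp_all add: dual_bundle_def)
    show ?thesis
      using trivD(1)[OF t(1)] dual_triv_bij[OF t(1)]
      by (auto simp: t(2) add sc dual_fibre_iff dual_triv_def algebra_simps)
  qed
  have holo: "(\<lambda>z. let x = inv_into C \<kappa> z in \<psi>' x (frame ?D \<psi> x)) holomorphic_on \<kappa> ` (C \<inter> U \<inter> U')"
    if "(U, \<psi>) \<in> trivs ?D" "(U', \<psi>') \<in> trivs ?D" "(C, \<kappa>) \<in> charts S" for U \<psi> U' \<psi>' C \<kappa>
  proof -
    from that obtain \<phi> where t: "(U, \<phi>) \<in> trivs L" "\<psi> = dual_triv \<phi>"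
      unfolding trivs_dual by auto
    from that obtain \<phi>' where t': "(U', \<phi>') \<in> trivs L" "\<psi>' = dual_triv \<phi>'"
      unfolding trivs_dual by auto
    have "(\<lambda>z. \<phi> (inv_into C \<kappa> z) (frame L \<phi>' (inv_into C \<kappa> z))) holomorphic_on \<kappa> ` (C \<inter> U \<inter> U')"
      using transition_holo[OF t'(1) t(1) that(3)] by (simp add: Int_ac)
    moreover have "\<phi> (inv_into C \<kappa> z) (frame L \<phi>' (inv_into C \<kappa> z)) =
        (let x = inv_into C \<kappa> z in \<psi>' x (frame ?D \<psi> x))" if z: "z \<in> \<kappa> ` (C \<inter> U \<inter> U')" for z
    proof -
      from z obtain x where x: "x \<in> C" "x \<in> U" "x \<in> U'" "z = \<kappa> x" by blast
      have "frame ?D \<psi> x (frame L \<phi>' x) = \<phi> x (frame L \<phi>' x)"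
        using dual_eval[OF t(1) x(2) dual_frame(1)[OF t(1) x(2)] frame_in[OF t'(1) x(3)]]
          dual_frame(2)[OF t(1) x(2)] by (simp add: t(2))
      then show ?thesis
        using x chart_inv[OF \<open>(C, \<kappa>) \<in> charts S\<close>] by (simp add: Let_def t'(2) dual_triv_def)
    qed
    ultimately show ?thesis by (rule holomorphic_transform)
  qed
  show "holomorphic_line_bundle S ?D"
    unfolding holomorphic_line_bundle_def using un fib holo by (intro conjI ballI) auto
qed

text \<open>\<open>has_degree\<close> speaks about sections of \<open>L\<close>, while
  \<open>u\<close> is a section of the dual; \<open>1/u\<close> links the two. Its coordinate in any
  trivialisation is the inverse of \<open>u\<close> at the frame vector: replacing the one chosen by
  \<open>triv_at\<close> brings in a transition factor twice, and the two cancel.\<close>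

lemma inverse_section:
  assumes u: "meromorphic_section S (dual_bundle L) u" "nonzero_section S (dual_bundle L) u"
  obtains s where "meromorphic_section S L s" "nonzero_section S L s"
    "\<And>p. p \<in> points S \<Longrightarrow> section_ord S L s p = - section_ord S (dual_bundle L) u p"
proof -
  interpret D: holo_line_bundle S "dual_bundle L" by (rule dual)
  define s where
    "s = (\<lambda>x. case triv_at L x of (U, \<phi>) \<Rightarrow> fscale L x (inverse (u x (frame L \<phi> x))) (frame L \<phi> x))"
  have uin: "u x \<in> fibre (dual_bundle L) x" if "x \<in> points S" for x
    using D.section_in[OF u(1) that] .
  have sin: "s x \<in> fibre L x" and loc: "\<phi>' x (s x) = inverse (u x (frame L \<phi>' x))"
    if t': "(U', \<phi>') \<in> trivs L" "x \<in> U'" for x U' \<phi>'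
  proof -
    have x: "x \<in> points S" using trivD(2)[OF t'(1)] t'(2) by blast
    obtain U \<phi> where t0: "triv_at L x = (U, \<phi>)" by fastforce
    note t = triv_at_in[OF x t0]
    show "s x \<in> fibre L x"
      using fscale_in[OF t frame_in[OF t]] by (simp add: s_def t0)
    have "u x (frame L \<phi> x) = \<phi>' x (frame L \<phi> x) * u x (frame L \<phi>' x)"
      using dual_eval[OF t' uin[OF x] frame_in[OF t]] .
    moreover have "\<phi>' x (frame L \<phi> x) \<noteq> 0"
      using transition_inverse[OF t t'] by auto
    moreover have "\<phi>' x (s x) = inverse (u x (frame L \<phi> x)) * \<phi>' x (frame L \<phi> x)"
      using triv_scale[OF t' frame_in[OF t]] by (simp add: s_def t0)
    ultimately show "\<phi>' x (s x) = inverse (u x (frame L \<phi>' x))"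
      by (cases "u x (frame L \<phi>' x) = 0") (simp_all add: field_simps)
  qed
  \<comment> \<open>Nice meromorphy constrains the value at every single point, so it passes to
    another function only if the two agree at all points of the open set.\<close>
  have nice_cong: "f nicely_meromorphic_on A" if "g nicely_meromorphic_on A" "open A"
      "\<And>z. z \<in> A \<Longrightarrow> f z = g z" for f g A
  proof -
    have ev: "\<forall>\<^sub>F w in at z. f w = g w" if z: "z \<in> A" for z
    proof -
      have "\<forall>\<^sub>F w in at z. w \<in> A" by (rule eventually_at_in_open'[OF \<open>open A\<close> z])
      then show ?thesis by eventually_elim (use \<open>\<And>z. z \<in> A \<Longrightarrow> f z = g z\<close> in auto)
    qed
    have "f meromorphic_on A"
      using \<open>g nicely_meromorphic_on A\<close> meromorphic_on_cong[of A f g A] ev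
      by (simp add: nicely_meromorphic_on_def)
    moreover have "is_pole f z \<and> f z = 0 \<or> f \<midarrow>z\<rightarrow> f z" if z: "z \<in> A" for z
    proof -
      have "is_pole g z \<and> g z = 0 \<or> g \<midarrow>z\<rightarrow> g z"
        using \<open>g nicely_meromorphic_on A\<close> z by (simp add: nicely_meromorphic_on_def)
      moreover have "is_pole f z \<longleftrightarrow> is_pole g z" by (rule is_pole_cong[OF ev[OF z] refl])
      moreover have "(f \<midarrow>z\<rightarrow> g z) \<longleftrightarrow> (g \<midarrow>z\<rightarrow> g z)" by (rule tendsto_cong[OF ev[OF z]])
      ultimately show ?thesis using that \<open>\<And>z. z \<in> A \<Longrightarrow> f z = g z\<close> by simp
    qed
    ultimately show ?thesis by (simp add: nicely_meromorphic_on_def)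
  qed
  have sm: "meromorphic_section S L s"
    unfolding meromorphic_section_def
  proof (intro conjI ballI, goal_cases)
    case (1 x)
    then show ?case using triv_ex sin by metis
  next
    case (2 tr)
    obtain U \<phi> where tr: "tr = (U, \<phi>)" by fastforce
    then have t: "(U, \<phi>) \<in> trivs L" using 2 by auto
    have "(\<lambda>z. \<phi> (inv_into C \<kappa> z) (s (inv_into C \<kappa> z))) nicely_meromorphic_on \<kappa> ` (C \<inter> U)"
      if c: "(C, \<kappa>) \<in> charts S" for C \<kappa>
    proof -
    have "(\<lambda>z. u (inv_into C \<kappa> z) (frame L \<phi> (inv_into C \<kappa> z))) nicely_meromorphic_on \<kappa> ` (C \<inter> U)"
      using D.section_mero[OF u(1) dual_triv_in[OF t] c] by (simp add: dual_triv_def)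
    \<comment> \<open>The convention \<open>inverse 0 = 0\<close> fits nice meromorphy at both kinds
      of exceptional points: at a zero of \<open>u\<close> it is the required value at a pole, and
      at a pole of \<open>u\<close>, where \<open>u\<close> takes the value 0, it is the limit of
      the inverse.\<close>
    then have "(\<lambda>z. inverse (u (inv_into C \<kappa> z) (frame L \<phi> (inv_into C \<kappa> z)))) nicely_meromorphic_on \<kappa> ` (C \<inter> U)"
      by (rule nicely_meromorphic_on_inverse)
    then show ?thesis
      by (rule nice_cong[OF _ chart_image_open[OF c trivD(1)[OF t]]])
         (use loc[OF t] chart_inv[OF c] in auto)
    qed
    then show ?case by (auto simp: tr Let_def)
  qed
  have sn: "nonzero_section S L s"
  proof -
    obtain x where x: "x \<in> points S" "u x \<noteq> fscale (dual_bundle L) x 0 (u x)"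
      using u(2) unfolding nonzero_section_def by blast
    obtain U \<phi> where t: "(U, \<phi>) \<in> trivs L" "x \<in> U" using triv_ex[OF x(1)] .
    have "u x (frame L \<phi> x) \<noteq> 0"
      using D.section_zero_iff[OF u(1) dual_triv_in[OF t(1)] t(2)] x(2) by (simp add: dual_triv_def)
    then have "\<phi> x (s x) \<noteq> 0" using loc[OF t] by simp
    then show ?thesis
      using section_zero_iff[OF sm t] x(1) unfolding nonzero_section_def by blast
  qed
  have "section_ord S L s p = - section_ord S (dual_bundle L) u p" if p: "p \<in> points S" for p
  proof -
    obtain U \<phi> where t: "(U, \<phi>) \<in> trivs L" "p \<in> U" using triv_ex[OF p] .
    obtain C \<kappa> where c0: "chart_at S p = (C, \<kappa>)" by fastforce
    note c = chart_at_in[OF p c0]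
    let ?F = "\<lambda>z. u (inv_into C \<kappa> z) (frame L \<phi> (inv_into C \<kappa> z))"
    have mero: "?F meromorphic_on {\<kappa> p}"
      using D.section_mero_at[OF u(1) dual_triv_in[OF t(1)] c t(2)] by (simp add: dual_triv_def)
    have "\<forall>\<^sub>F z in at (\<kappa> p). ?F z \<noteq> 0"
      using D.section_nonzero_near_chart[OF u dual_triv_in[OF t(1)] t(2) c] by (simp add: dual_triv_def)
    then have nz: "\<exists>\<^sub>F z in at (\<kappa> p). ?F z \<noteq> 0"
      by (simp add: eventually_frequently)
    have "\<forall>\<^sub>F z in at (\<kappa> p). z \<in> \<kappa> ` (C \<inter> U)"
      using chart_image_open[OF c(1) trivD(1)[OF t(1)]] c t by (intro eventually_at_in_open') auto
    then have ev: "\<forall>\<^sub>F z in at (\<kappa> p). \<phi> (inv_into C \<kappa> z) (s (inv_into C \<kappa> z)) = inverse (?F z)"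
      by eventually_elim (use loc[OF t(1)] chart_inv[OF c(1)] in auto)
    have "section_ord S L s p = zorder (\<lambda>z. \<phi> (inv_into C \<kappa> z) (s (inv_into C \<kappa> z))) (\<kappa> p)"
      by (rule section_ord_triv[OF sm sn p t c0])
    also have "\<dots> = zorder (\<lambda>z. inverse (?F z)) (\<kappa> p)"
      by (rule zorder_cong[OF ev refl])
    also have "\<dots> = - zorder ?F (\<kappa> p)"
      using mero nz by (intro zorder_inverse) (simp_all add: meromorphic_at_iff)
    also have "zorder ?F (\<kappa> p) = section_ord S (dual_bundle L) u p"
      using D.section_ord_triv[OF u p dual_triv_in[OF t(1)] t(2) c0] by (simp add: dual_triv_def)
    finally show ?thesis .
  qed
  with sm sn that show ?thesis by blast
qed

lemma dual_section_degree:
  assumes u: "meromorphic_section S (dual_bundle L) u" "nonzero_section S (dual_bundle L) u"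
    and d: "has_degree S L d"
  shows "(\<Sum>p | p \<in> points S \<and> section_ord S (dual_bundle L) u p \<noteq> 0.
            section_ord S (dual_bundle L) u p) = - d"
proof -
  obtain s where s: "meromorphic_section S L s" "nonzero_section S L s"
    "\<And>p. p \<in> points S \<Longrightarrow> section_ord S L s p = - section_ord S (dual_bundle L) u p"
    using inverse_section[OF u] by metis
  have "(\<Sum>p | p \<in> points S \<and> section_ord S L s p \<noteq> 0. section_ord S L s p) = d"
    using d s(1,2) unfolding has_degree_def by blast
  moreover have "{p \<in> points S. section_ord S L s p \<noteq> 0} =
      {p \<in> points S. section_ord S (dual_bundle L) u p \<noteq> 0}"
    using s(3) by auto
  ultimately have "(\<Sum>p | p \<in> points S \<and> section_ord S (dual_bundle L) u p \<noteq> 0. section_ord S L s p) = d"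
    by simp
  also have "(\<Sum>p | p \<in> points S \<and> section_ord S (dual_bundle L) u p \<noteq> 0. section_ord S L s p) =
      (\<Sum>p | p \<in> points S \<and> section_ord S (dual_bundle L) u p \<noteq> 0. - section_ord S (dual_bundle L) u p)"
    by (intro sum.cong) (use s(3) in auto)
  finally show ?thesis by (simp add: sum_negf)
qed

end

section \<open>Real structures and orders at conjugate points\<close>

locale real_line_bundle = holo_line_bundle S L for S :: "'a surface" and L :: "('a, 'e) line_bundle" +
  fixes \<tau> :: "'a \<Rightarrow> 'a" and \<sigma> :: "'a \<Rightarrow> 'e \<Rightarrow> 'e"
  assumes antiholo: "antiholomorphic_map S S \<tau>"
    and invol: "\<And>p. p \<in> points S \<Longrightarrow> \<tau> (\<tau> p) = p"
    and real_struct: "real_structure S \<tau> L \<sigma>"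
begin

lemma \<tau>_in: "p \<in> points S \<Longrightarrow> \<tau> p \<in> points S"
  using antiholo unfolding antiholomorphic_map_def continuous_map_def by blast

lemma \<sigma>_facts:
  assumes "x \<in> points S" "e \<in> fibre L x"
  shows \<sigma>_in: "\<sigma> x e \<in> fibre L (\<tau> x)" and \<sigma>_invol: "\<sigma> (\<tau> x) (\<sigma> x e) = e"
    and \<sigma>_scale: "\<sigma> x (fscale L x c e) = fscale L (\<tau> x) (cnj c) (\<sigma> x e)"
  using conjunct1[OF real_struct[unfolded real_structure_def]] assms by blast+

lemma \<sigma>_holo:
  assumes "(U, \<phi>) \<in> trivs L" "(U', \<phi>') \<in> trivs L" "(C, \<kappa>) \<in> charts S"
  shows "(\<lambda>z. cnj (\<phi>' (\<tau> (inv_into C \<kappa> z)) (\<sigma> (inv_into C \<kappa> z) (frame L \<phi> (inv_into C \<kappa> z)))))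
    holomorphic_on \<kappa> ` {x \<in> C \<inter> U. \<tau> x \<in> U'}"
proof -
  note * = conjunct2[OF real_struct[unfolded real_structure_def]]
  show ?thesis
    using bspec[OF bspec[OF bspec[OF * assms(1), simplified] assms(2), simplified] assms(3)]
    by (simp add: Let_def)
qed

lemma \<tau>_holo:
  assumes "(C, \<kappa>) \<in> charts S" "(C', \<kappa>') \<in> charts S"
  shows "(\<lambda>z. cnj (\<kappa>' (\<tau> (inv_into C \<kappa> z)))) holomorphic_on \<kappa> ` {x \<in> C. \<tau> x \<in> C'}"
proof -
  note * = conjunct2[OF antiholo[unfolded antiholomorphic_map_def]]
  show ?thesis using bspec[OF bspec[OF * assms(1), simplified] assms(2)] by simp
qed

text \<open>In trivialisations and charts at \<open>p\<close> and \<open>\<tau> p\<close>,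
  invariance of \<open>u\<close> becomes \<open>F' z = G z * cnj (F (cnj (\<Psi> z)))\<close>, where
  \<open>\<Psi>\<close> is the conjugate of \<open>\<tau>\<close> in the charts and \<open>G\<close>
  the conjugate of the coefficient of \<open>\<sigma>\<close>. The order can then be pulled back
  through \<open>\<tau>\<close>.\<close>

lemma section_ord_conj:
  assumes u: "meromorphic_section S (dual_bundle L) u" "nonzero_section S (dual_bundle L) u"
    and u_real: "\<And>p. p \<in> points S \<Longrightarrow> u (\<tau> p) = dual_real_structure \<tau> L \<sigma> p (u p)"
    and p: "p \<in> points S"
  shows "section_ord S (dual_bundle L) u (\<tau> p) = section_ord S (dual_bundle L) u p"
proof -
  interpret D: holo_line_bundle S "dual_bundle L" by (rule dual)
  have p': "\<tau> p \<in> points S" by (rule \<tau>_in[OF p])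
  obtain U \<phi> where t: "(U, \<phi>) \<in> trivs L" "p \<in> U" using triv_ex[OF p] .
  obtain U' \<phi>' where t': "(U', \<phi>') \<in> trivs L" "\<tau> p \<in> U'" using triv_ex[OF p'] .
  obtain C \<kappa> where c0: "chart_at S p = (C, \<kappa>)" by fastforce
  obtain C' \<kappa>' where c0': "chart_at S (\<tau> p) = (C', \<kappa>')" by fastforce
  note c = chart_at_in[OF p c0] and c' = chart_at_in[OF p' c0']
  let ?y = "inv_into C' \<kappa>'"
  define F where "F = (\<lambda>z. u (inv_into C \<kappa> z) (frame L \<phi> (inv_into C \<kappa> z)))"
  define F' where "F' = (\<lambda>z. u (?y z) (frame L \<phi>' (?y z)))"
  define \<Psi> where "\<Psi> = (\<lambda>z. cnj (\<kappa> (\<tau> (?y z))))"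
  define G where "G = (\<lambda>z. cnj (\<phi> (\<tau> (?y z)) (\<sigma> (?y z) (frame L \<phi>' (?y z)))))"
  define X where "X = {x \<in> C' \<inter> U'. \<tau> x \<in> C \<inter> U}"
  have mero: "F meromorphic_on {\<kappa> p}"
    using D.section_mero_at[OF u(1) dual_triv_in[OF t(1)] c t(2)] by (simp add: dual_triv_def F_def)
  have "\<forall>\<^sub>F z in at (\<kappa> p). F z \<noteq> 0"
    using D.section_nonzero_near_chart[OF u dual_triv_in[OF t(1)] t(2) c]
    by (simp add: dual_triv_def F_def)
  then have nz: "\<exists>\<^sub>F z in at (\<kappa> p). F z \<noteq> 0"
    by (simp add: eventually_frequently)
  have "openin (topo S) {x \<in> points S. \<tau> x \<in> C \<inter> U}"
    using antiholo chartD(1)[OF c(1)] trivD(1)[OF t(1)]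
    unfolding antiholomorphic_map_def by (blast intro: openin_continuous_map_preimage openin_Int)
  then have "openin (topo S) (U' \<inter> {x \<in> points S. \<tau> x \<in> C \<inter> U})"
    using trivD(1)[OF t'(1)] by blast
  from chart_image_open[OF c'(1) this]
  have opA: "open (\<kappa>' ` X)"
    by (rule back_subst[of "open"]) (use chartD(4)[OF c'(1)] in \<open>auto simp: X_def\<close>)
  have inA: "\<kappa>' (\<tau> p) \<in> \<kappa>' ` X"
    using c c' t t' invol[OF p] by (auto simp: X_def)
  have \<Psi>h: "\<Psi> holomorphic_on \<kappa>' ` X"
    unfolding \<Psi>_def by (rule holomorphic_on_subset[OF \<tau>_holo[OF c'(1) c(1)]]) (auto simp: X_def)
  have Gh: "G holomorphic_on \<kappa>' ` X"
    unfolding G_def by (rule holomorphic_on_subset[OF \<sigma>_holo[OF t'(1) t(1) c'(1)]]) (auto simp: X_def)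
  \<comment> \<open>An involution is injective, and an injective holomorphic function has no
    critical points; this supplies the nonzero derivative.\<close>
  have inj: "inj_on \<Psi> (\<kappa>' ` X)"
  proof (rule inj_onI)
    fix z w assume "z \<in> \<kappa>' ` X" "w \<in> \<kappa>' ` X" and eq: "\<Psi> z = \<Psi> w"
    then obtain x y where xy: "x \<in> X" "y \<in> X" "z = \<kappa>' x" "w = \<kappa>' y" by blast
    then have "\<kappa> (\<tau> x) = \<kappa> (\<tau> y)"
      using eq chart_inv[OF c'(1)] by (auto simp: \<Psi>_def X_def)
    then have "\<tau> x = \<tau> y"
      using chart_inj[OF c(1)] xy by (auto simp: X_def inj_on_def)
    moreover have "x \<in> points S" "y \<in> points S"
      using xy chartD(4)[OF c'(1)] by (auto simp: X_def)
    ultimately show "z = w" using invol xy by metis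
  qed
  have \<Psi>d: "deriv \<Psi> (\<kappa>' (\<tau> p)) \<noteq> 0"
    by (rule holomorphic_injective_imp_regular[OF \<Psi>h opA inj inA])
  have \<Psi>p: "\<Psi> (\<kappa>' (\<tau> p)) = cnj (\<kappa> p)"
    using chart_inv[OF c'] invol[OF p] by (simp add: \<Psi>_def)
  \<comment> \<open>If \<open>\<sigma>\<close> sent the frame vector to zero, a second application
    would return zero instead of the frame vector.\<close>
  have G0: "G (\<kappa>' (\<tau> p)) \<noteq> 0"
  proof
    assume "G (\<kappa>' (\<tau> p)) = 0"
    let ?e = "frame L \<phi>' (\<tau> p)"
    have ein: "?e \<in> fibre L (\<tau> p)" using frame_in[OF t'] .
    have sin: "\<sigma> (\<tau> p) ?e \<in> fibre L p" using \<sigma>_in[OF p' ein] invol[OF p] by simp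
    have "\<phi> p (\<sigma> (\<tau> p) ?e) = 0"
      using \<open>G (\<kappa>' (\<tau> p)) = 0\<close> chart_inv[OF c'] invol[OF p] by (simp add: G_def)
    then have "\<sigma> (\<tau> p) ?e = fscale L p 0 (\<sigma> (\<tau> p) ?e)"
      using triv_inj[OF t sin fscale_in[OF t sin]] triv_scale[OF t sin] by simp
    then have "\<sigma> p (\<sigma> (\<tau> p) ?e) = fscale L (\<tau> p) 0 (\<sigma> p (\<sigma> (\<tau> p) ?e))"
      using \<sigma>_scale[OF p sin, of 0] by simp
    moreover have "\<sigma> p (\<sigma> (\<tau> p) ?e) = ?e" using \<sigma>_invol[OF p' ein] invol[OF p] by simp
    ultimately have "?e = fscale L (\<tau> p) 0 ?e" by simp
    then have "\<phi>' (\<tau> p) ?e = 0" using triv_scale[OF t' ein, of 0] by simp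
    then show False using triv_frame[OF t'] by simp
  qed
  have eq: "F' z = G z * cnj (F (cnj (\<Psi> z)))" if "z \<in> \<kappa>' ` X" for z
  proof -
    from that obtain y where y: "y \<in> X" "z = \<kappa>' y" by blast
    then have yz: "?y z = y" and yp: "y \<in> points S" and yU: "y \<in> U'"
      and xC: "\<tau> y \<in> C" and xU: "\<tau> y \<in> U"
      using chart_inv[OF c'(1)] chartD(4)[OF c'(1)] by (auto simp: X_def)
    let ?e = "frame L \<phi>' y"
    have xp: "\<tau> y \<in> points S" by (rule \<tau>_in[OF yp])
    have ein: "?e \<in> fibre L y" using frame_in[OF t'(1) yU] .
    have "u y ?e = dual_real_structure \<tau> L \<sigma> (\<tau> y) (u (\<tau> y)) ?e"
      using u_real[OF xp] invol[OF yp] by simp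
    also have "\<dots> = cnj (u (\<tau> y) (\<sigma> y ?e))"
      using ein invol[OF yp] by (simp add: dual_real_structure_def)
    also have "u (\<tau> y) (\<sigma> y ?e) = \<phi> (\<tau> y) (\<sigma> y ?e) * u (\<tau> y) (frame L \<phi> (\<tau> y))"
      by (rule dual_eval[OF t(1) xU D.section_in[OF u(1) xp] \<sigma>_in[OF yp ein]])
    finally show ?thesis
      using chart_inv[OF c(1) xC] by (simp add: F'_def F_def G_def \<Psi>_def yz)
  qed
  have "zorder F' (\<kappa>' (\<tau> p)) = zorder F (\<kappa> p)"
    by (rule zorder_antiholomorphic_pullback[OF mero nz opA inA \<Psi>h \<Psi>p \<Psi>d Gh G0 eq])
  moreover have "section_ord S (dual_bundle L) u (\<tau> p) = zorder F' (\<kappa>' (\<tau> p))"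
    using D.section_ord_triv[OF u p' dual_triv_in[OF t'(1)] t'(2) c0']
    by (simp add: dual_triv_def F'_def)
  moreover have "section_ord S (dual_bundle L) u p = zorder F (\<kappa> p)"
    using D.section_ord_triv[OF u p dual_triv_in[OF t(1)] t(2) c0]
    by (simp add: dual_triv_def F_def)
  ultimately show ?thesis by simp
qed

end

section \<open>Fibres and real points of a real hyperelliptic curve\<close>

abbreviation "chart_affine \<equiv> (range Some, the)"
abbreviation "chart_inverse \<equiv> (UNIV - {Some 0}, \<lambda>q. case q of None \<Rightarrow> 0 | Some z \<Rightarrow> inverse z)"

lemma CP1_simps: "topo CP1 = Alexandroff_compactification euclidean"
  "charts CP1 = {chart_affine, chart_inverse}" "points CP1 = UNIV"
  by (auto simp: CP1_def UNIV_option_conv)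

lemma CP1_chart_cases:
  assumes "(D, \<mu>) \<in> charts CP1"
  obtains (affine) "D = range Some" "\<mu> = the"
    | (inverse) "D = UNIV - {Some 0}" "\<mu> = (\<lambda>q. case q of None \<Rightarrow> 0 | Some z \<Rightarrow> inverse z)"
  using assms by (auto simp: CP1_simps)

text \<open>Only neighbourhoods of infinity need an argument, that is, \<open>V\<close> containing 0
  in the chart \<open>1/z\<close>. The finite points left out, among them 0, are bounded because
  \<open>1/z\<close> is small for large \<open>z\<close>; so they form a compact set, as the
  one-point compactification demands.\<close>

lemma CP1_chart_vimage_open:
  assumes "(D, \<mu>) \<in> charts CP1" "open V"
  shows "openin (topo CP1) {q \<in> D. \<mu> q \<in> V}"
  using assms(1)
proof (cases rule: CP1_chart_cases)
  case affine
  then have "{q \<in> D. \<mu> q \<in> V} = Some ` V" by auto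
  then show ?thesis using assms(2) by (simp add: CP1_simps)
next
  case inverse
  have op: "open {z. z \<noteq> 0 \<and> inverse z \<in> V}"
  proof -
    have "open ((-{0}) \<inter> inverse -` V)"
      using assms(2) by (intro continuous_open_preimage continuous_intros) auto
    then show ?thesis by (rule back_subst[of "open"]) auto
  qed
  show ?thesis
  proof (cases "0 \<in> V")
    case False
    then have "{q \<in> D. \<mu> q \<in> V} = Some ` {z. z \<noteq> 0 \<and> inverse z \<in> V}"
      by (auto simp: inverse split: option.splits)
    then show ?thesis using op by (simp add: CP1_simps)
  next
    case True
    then obtain r where r: "r > 0" "ball 0 r \<subseteq> V" using assms(2) openE by blast
    let ?K = "- {z. z \<noteq> 0 \<and> inverse z \<in> V}"
    have "z \<in> cball 0 (inverse r)" if "z \<in> ?K" for z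
    proof (rule ccontr)
      assume "z \<notin> cball 0 (inverse r)"
      then have "norm z > inverse r" by simp
      moreover from this r have "norm z > 0" by (meson inverse_positive_iff_positive less_trans)
      ultimately have "norm (inverse z) < r"
        using r less_imp_inverse_less[of "inverse r" "norm z"] by (simp add: norm_inverse)
      then have "inverse z \<in> V" using r by auto
      with that \<open>norm z > 0\<close> show False by auto
    qed
    then have "bounded ?K" by (meson bounded_cball bounded_subset subsetI)
    then have "compact ?K" using op by (simp add: compact_eq_bounded_closed closed_def)
    moreover have "{q \<in> D. \<mu> q \<in> V} = insert None (Some ` (topspace euclidean - ?K))"
    proof (rule Set.set_eqI)
      show "q \<in> {q \<in> D. \<mu> q \<in> V} \<longleftrightarrow> q \<in> insert None (Some ` (topspace euclidean - ?K))" for q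
        using True by (cases q) (auto simp: inverse)
    qed
    moreover have "closed ?K" using \<open>compact ?K\<close> by (rule compact_imp_closed)
    ultimately show ?thesis
      unfolding CP1_simps openin_Alexandroff_compactification
      by (intro disjI2 exI[of _ ?K] conjI) (simp_all add: closed_closedin[symmetric])
  qed
qed

lemma CP1_chart_open: "(D, \<mu>) \<in> charts CP1 \<Longrightarrow> openin (topo CP1) D"
  using CP1_chart_vimage_open[of D \<mu> UNIV] by simp

lemma CP1_chart_inj: "(D, \<mu>) \<in> charts CP1 \<Longrightarrow> inj_on \<mu> D"
  by (erule CP1_chart_cases) (auto simp: inj_on_def split: option.splits)

lemma CP1_chart_at: "chart_at CP1 q \<in> charts CP1" "q \<in> fst (chart_at CP1 q)"
proof -
  have "\<exists>c. c \<in> charts CP1 \<and> q \<in> fst c"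
    by (cases q) (auto simp: CP1_simps)
  then have "chart_at CP1 q \<in> charts CP1 \<and> q \<in> fst (chart_at CP1 q)"
    unfolding chart_at_def by (rule someI_ex)
  then show "chart_at CP1 q \<in> charts CP1" "q \<in> fst (chart_at CP1 q)" by auto
qed

section \<open>Fibres of the double cover and the action of the involution on them\<close>

locale real_hyp_curve =
  fixes S :: "'a surface" and \<pi> :: "'a \<Rightarrow> complex option" and \<tau> :: "'a \<Rightarrow> 'a" and g :: nat
  assumes curve: "real_hyperelliptic_curve S \<pi> \<tau> g"
begin

sublocale rsurface S
  using curve unfolding real_hyperelliptic_curve_def hyperelliptic_curve_def compact_riemann_surface_def
  by unfold_locales blast

lemma antiholo: "antiholomorphic_map S S \<tau>"
  and invol: "p \<in> points S \<Longrightarrow> \<tau> (\<tau> p) = p"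
  and \<pi>_conj: "p \<in> points S \<Longrightarrow> \<pi> (\<tau> p) = map_option cnj (\<pi> p)"
  and cover: "ramified_cover S CP1 \<pi> 2"
  and compact: "compact_space (topo S)"
  using curve unfolding real_hyperelliptic_curve_def hyperelliptic_curve_def compact_riemann_surface_def
  by blast+

lemma \<tau>_cont: "continuous_map (topo S) (topo S) \<tau>"
  using antiholo unfolding antiholomorphic_map_def by blast

lemma \<pi>_cont: "continuous_map (topo S) (topo CP1) \<pi>"
  using cover unfolding ramified_cover_def holomorphic_map_def by blast

lemma \<tau>_in: "p \<in> points S \<Longrightarrow> \<tau> p \<in> points S"
  using \<tau>_cont unfolding continuous_map_def by blast

definition fib :: "complex option \<Rightarrow> 'a set" where
  "fib q = {p \<in> points S. \<pi> p = q}"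

abbreviation ram :: "'a \<Rightarrow> int" where
  "ram \<equiv> ramification_index S CP1 \<pi>"

lemma fib_finite: "finite (fib q)" and fib_sum: "(\<Sum>p\<in>fib q. ram p) = 2"
proof -
  have "\<forall>q\<in>points CP1. finite {p \<in> points S. \<pi> p = q} \<and>
        (\<Sum>p | p \<in> points S \<and> \<pi> p = q. ram p) = int 2"
    using cover unfolding ramified_cover_def by blast
  from bspec[OF this, of q] show "finite (fib q)" "(\<Sum>p\<in>fib q. ram p) = 2"
    by (simp_all add: CP1_simps(3) fib_def)
qed

text \<open>Were the projection constant near \<open>p\<close>, a neighbourhood of \<open>p\<close>
  would lie in one fibre; but fibres are finite and open sets are not.\<close>

lemma local_coordinate:
  assumes c: "(C, \<kappa>) \<in> charts S" "p \<in> C" and d: "(D, \<mu>) \<in> charts CP1" "\<pi> p \<in> D"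
  defines "f \<equiv> \<lambda>z. \<mu> (\<pi> (inv_into C \<kappa> z))" and "A \<equiv> \<kappa> ` {x \<in> C. \<pi> x \<in> D}"
  shows "open A" "\<kappa> p \<in> A" "f holomorphic_on A" "f (\<kappa> p) = \<mu> (\<pi> p)"
    "\<exists>\<^sub>F z in at (\<kappa> p). f z \<noteq> f (\<kappa> p)"
proof -
  have opD: "openin (topo S) {x \<in> points S. \<pi> x \<in> D}"
    by (rule openin_continuous_map_preimage[OF \<pi>_cont CP1_chart_open[OF d(1)]])
  from chart_image_open[OF c(1) this] show "open A"
    by (rule back_subst[of "open"]) (use chartD(4)[OF c(1)] in \<open>auto simp: A_def\<close>)
  show "\<kappa> p \<in> A" using c d by (auto simp: A_def)
  show fp: "f (\<kappa> p) = \<mu> (\<pi> p)" using c by (simp add: f_def chart_inv)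
  have "\<forall>(C, \<kappa>)\<in>charts S. \<forall>(D, \<mu>)\<in>charts CP1.
        (\<lambda>z. \<mu> (\<pi> (inv_into C \<kappa> z))) holomorphic_on \<kappa> ` {x \<in> C. \<pi> x \<in> D}"
    using cover unfolding ramified_cover_def holomorphic_map_def by blast
  from bspec[OF bspec[OF this c(1), simplified] d(1)] show "f holomorphic_on A"
    by (simp add: f_def A_def)
  show "\<exists>\<^sub>F z in at (\<kappa> p). f z \<noteq> f (\<kappa> p)"
  proof (rule ccontr)
    assume "\<not> ?thesis"
    then have ev: "\<forall>\<^sub>F z in at (\<kappa> p). \<mu> (\<pi> (inv_into C \<kappa> z)) = \<mu> (\<pi> p)"
      unfolding fp by (simp add: frequently_def f_def)
    have pS: "p \<in> points S" using c chartD(4) by blast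
    from ev have "\<forall>\<^sub>F x in nhdsin (topo S) p. x \<noteq> p \<longrightarrow> \<mu> (\<pi> x) = \<mu> (\<pi> p)"
      using eventually_at_chart[OF c, of "\<lambda>x. \<mu> (\<pi> x) = \<mu> (\<pi> p)"] by simp
    moreover have "\<forall>\<^sub>F x in nhdsin (topo S) p. x \<in> {x \<in> points S. \<pi> x \<in> D}"
      unfolding eventually_nhdsin using opD pS d(2) by blast
    ultimately have "\<forall>\<^sub>F x in nhdsin (topo S) p. x \<in> fib (\<pi> p)"
    proof eventually_elim
      case (elim x)
      then show ?case
        using CP1_chart_inj[OF d(1)] d(2) pS by (auto simp: fib_def inj_on_def)
    qed
    then obtain U where "openin (topo S) U" "p \<in> U" "U \<subseteq> fib (\<pi> p)"
      unfolding eventually_nhdsin using pS by blast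
    then show False using infinite_nhd fib_finite finite_subset by blast
  qed
qed

lemma ram_chart:
  assumes "chart_at S p = (C, \<kappa>)" "chart_at CP1 (\<pi> p) = (D, \<mu>)"
  shows "ram p = zorder (\<lambda>z. \<mu> (\<pi> (inv_into C \<kappa> z)) - \<mu> (\<pi> p)) (\<kappa> p)"
  using assms by (simp add: ramification_index_def ord_at_def)

lemma ram_pos:
  assumes "p \<in> points S"
  shows "ram p \<ge> 1"
proof -
  obtain C \<kappa> where c0: "chart_at S p = (C, \<kappa>)" by fastforce
  obtain D \<mu> where d0: "chart_at CP1 (\<pi> p) = (D, \<mu>)" by fastforce
  note c = chart_at_in[OF assms c0]
  have d: "(D, \<mu>) \<in> charts CP1" "\<pi> p \<in> D" using CP1_chart_at[of "\<pi> p"] d0 by auto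
  note lc = local_coordinate[OF c d]
  show ?thesis
    using zorder_pos_if_nonconst[OF lc(3,1,2,5)] ram_chart[OF c0 d0] unfolding lc(4) by simp
qed

text \<open>The chart of the sphere picked at \<open>\<pi> p\<close> may be \<open>1/z\<close>. Then
  \<open>1/f - 1/t = - (f - t) / (f t)\<close>, and the factor \<open>- 1 / (f t)\<close> is
  analytic and nonzero at the point, so the affine coordinate gives the same order.\<close>

lemma ram_affine:
  assumes p: "p \<in> points S" and t: "\<pi> p = Some t" and c0: "chart_at S p = (C, \<kappa>)"
  shows "ram p = zorder (\<lambda>z. the (\<pi> (inv_into C \<kappa> z)) - t) (\<kappa> p)"
proof -
  obtain D \<mu> where d0: "chart_at CP1 (\<pi> p) = (D, \<mu>)" by fastforce
  note c = chart_at_in[OF p c0]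
  have d: "(D, \<mu>) \<in> charts CP1" "\<pi> p \<in> D" using CP1_chart_at[of "\<pi> p"] d0 by auto
  from d(1) show ?thesis
  proof (cases rule: CP1_chart_cases)
    case affine
    then show ?thesis using ram_chart[OF c0 d0] t by simp
  next
    case inverse
    have t0: "t \<noteq> 0" using d(2) t inverse by auto
    let ?f = "\<lambda>z. the (\<pi> (inv_into C \<kappa> z))" and ?A = "\<kappa> ` {x \<in> C. \<pi> x \<in> range Some}"
    have aff: "chart_affine \<in> charts CP1" "\<pi> p \<in> range Some" using t by (auto simp: CP1_simps)
    note lc = local_coordinate[OF c aff]
    have fp: "?f (\<kappa> p) = t" using lc(4) t by simp
    have an: "?f analytic_on {\<kappa> p}" using lc(1-3) analytic_at by blast
    then have anF: "(\<lambda>z. ?f z - t) analytic_on {\<kappa> p}" by (intro analytic_intros)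
    have anG: "(\<lambda>z. - inverse (?f z) * inverse t) analytic_on {\<kappa> p}"
      using an fp t0 by (intro analytic_intros) auto
    have "\<forall>\<^sub>F z in nhds (\<kappa> p). z \<in> ?A" using lc(1,2) eventually_nhds by blast
    moreover have "\<forall>\<^sub>F z in nhds (\<kappa> p). ?f z \<noteq> 0"
    proof -
      have "isCont ?f (\<kappa> p)" using an analytic_at_imp_isCont by blast
      then have "(?f \<longlongrightarrow> ?f (\<kappa> p)) (nhds (\<kappa> p))"
        unfolding isCont_def using tendsto_at_iff_tendsto_nhds[of ?f "\<kappa> p"] by blast
      then have "(?f \<longlongrightarrow> t) (nhds (\<kappa> p))" unfolding fp .
      then show ?thesis using t0 by (rule tendsto_imp_eventually_ne)
    qed
    ultimately have "\<forall>\<^sub>F z in nhds (\<kappa> p). \<mu> (\<pi> (inv_into C \<kappa> z)) - \<mu> (\<pi> p) =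
        (- inverse (?f z) * inverse t) * (?f z - t)"
    proof eventually_elim
      case (elim z)
      then obtain w where "\<pi> (inv_into C \<kappa> z) = Some w" using chart_inv[OF c(1)] by auto
      then show ?case using elim t0 by (simp add: inverse t field_simps)
    qed
    then have ev: "\<forall>\<^sub>F z in at (\<kappa> p). \<mu> (\<pi> (inv_into C \<kappa> z)) - \<mu> (\<pi> p) =
        (- inverse (?f z) * inverse t) * (?f z - t)"
      by (simp add: eventually_nhds_conv_at)
    have "ram p = zorder (\<lambda>z. (- inverse (?f z) * inverse t) * (?f z - t)) (\<kappa> p)"
      unfolding ram_chart[OF c0 d0] by (rule zorder_cong[OF ev refl])
    also have "\<dots> = zorder (\<lambda>z. ?f z - t) (\<kappa> p)"
    proof (rule zorder_nonvanishing_mult)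
      show "(\<lambda>z. ?f z - t) meromorphic_on {\<kappa> p}" using anF by (rule analytic_on_imp_meromorphic_on)
      show "\<exists>\<^sub>F z in at (\<kappa> p). ?f z - t \<noteq> 0" using lc(5) unfolding fp by simp
    qed (use anG fp t0 in auto)
    finally show ?thesis .
  qed
qed

text \<open>Ramification indices are at least one and add up to two over each fibre, so an index two
  leaves no room for a second point.\<close>

lemma fib_weierstrass:
  assumes "p \<in> weierstrass S \<pi>"
  shows "fib (\<pi> p) = {p}"
proof -
  have p: "p \<in> fib (\<pi> p)" "ram p = 2" using assms by (auto simp: weierstrass_def fib_def)
  have "(\<Sum>x\<in>fib (\<pi> p) - {p}. ram x) = 0"
    using fib_sum[of "\<pi> p"] sum.remove[OF fib_finite p(1), of ram] p(2) by simp
  moreover have "(\<Sum>x\<in>fib (\<pi> p) - {p}. 1) \<le> (\<Sum>x\<in>fib (\<pi> p) - {p}. ram x)"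
    by (rule sum_mono) (use ram_pos in \<open>auto simp: fib_def\<close>)
  ultimately have "card (fib (\<pi> p) - {p}) = 0" by simp
  then have "fib (\<pi> p) - {p} = {}" using fib_finite by (simp add: card_eq_0_iff)
  with p(1) show ?thesis by blast
qed

lemma weierstrass_inj: "inj_on \<pi> (weierstrass S \<pi>)"
  using fib_weierstrass by (metis inj_onI the_elem_eq)

lemma fib_unbranched:
  assumes "q \<notin> branch_points S \<pi>"
  shows "card (fib q) = 2" and "\<And>p. p \<in> fib q \<Longrightarrow> ram p = 1"
proof -
  show 1: "ram p = 1" if p: "p \<in> fib q" for p
  proof -
    have "ram p \<noteq> 2" using assms p by (auto simp: branch_points_def weierstrass_def fib_def)
    moreover have "ram p \<ge> 1" using ram_pos p by (auto simp: fib_def)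
    moreover have "(\<Sum>x\<in>fib q - {p}. ram x) \<ge> 0"
      by (rule sum_nonneg) (use ram_pos in \<open>force simp: fib_def\<close>)
    ultimately show ?thesis
      using fib_sum[of q] sum.remove[OF fib_finite p, of ram] by linarith
  qed
  show "card (fib q) = 2" using fib_sum[of q] 1 by simp
qed

text \<open>Counting the points of a fibre detects branching without ramification indices. As
  \<open>\<tau>\<close> maps fibres bijectively to conjugate fibres, conjugation invariance of the
  branch points follows at once.\<close>

lemma branch_iff_card: "q \<in> branch_points S \<pi> \<longleftrightarrow> card (fib q) = 1"
  using fib_unbranched(1)[of q] fib_weierstrass by (force simp: branch_points_def)

lemma \<tau>_fib: "bij_betw \<tau> (fib q) (fib (map_option cnj q))"
proof (rule bij_betw_byWitness[where f' = \<tau>])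
  have "map_option cnj (map_option cnj q) = q" for q by (cases q) auto
  then show "\<tau> ` fib (map_option cnj q) \<subseteq> fib q"
    using \<tau>_in \<pi>_conj by (auto simp: fib_def)
qed (use \<tau>_in \<pi>_conj invol in \<open>auto simp: fib_def\<close>)

lemma branch_conj: "map_option cnj q \<in> branch_points S \<pi> \<longleftrightarrow> q \<in> branch_points S \<pi>"
  unfolding branch_iff_card using bij_betw_same_card[OF \<tau>_fib[of q]] by simp

lemma weierstrass_iff: "p \<in> weierstrass S \<pi> \<longleftrightarrow> p \<in> points S \<and> \<pi> p \<in> branch_points S \<pi>"
proof
  assume p: "p \<in> points S \<and> \<pi> p \<in> branch_points S \<pi>"
  then obtain q where q: "q \<in> weierstrass S \<pi>" "\<pi> q = \<pi> p"
    unfolding branch_points_def by force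
  then have "p \<in> {q}" using fib_weierstrass[OF q(1)] p by (auto simp: fib_def)
  with q show "p \<in> weierstrass S \<pi>" by simp
qed (auto simp: branch_points_def weierstrass_def)

lemma \<tau>_weierstrass: "p \<in> weierstrass S \<pi> \<Longrightarrow> \<tau> p \<in> weierstrass S \<pi>"
  unfolding weierstrass_iff using \<tau>_in \<pi>_conj branch_conj by simp

text \<open>Over a real unbranched value the two points of the fibre are permuted by
  \<open>\<tau>\<close>, so they are both fixed or exchanged, and any one of them decides.\<close>

lemma fixed_iff:
  assumes "q \<notin> branch_points S \<pi>" "map_option cnj q = q" "p \<in> fib q"
  shows "q \<in> \<pi> ` real_points S \<tau> \<longleftrightarrow> \<tau> p = p"
proof
  assume "q \<in> \<pi> ` real_points S \<tau>"
  then obtain p' where p': "p' \<in> fib q" "\<tau> p' = p'" by (auto simp: real_points_def fib_def)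
  have "\<tau> p \<in> fib q" using bij_betwE[OF \<tau>_fib[of q]] assms by auto
  show "\<tau> p = p"
  proof (rule ccontr)
    assume "\<tau> p \<noteq> p"
    moreover have "p \<noteq> p'" using \<open>\<tau> p \<noteq> p\<close> p'(2) by auto
    moreover have "\<tau> p \<noteq> p'"
      using \<open>p \<noteq> p'\<close> p' invol assms(3) by (metis (no_types, lifting) fib_def mem_Collect_eq)
    moreover have "{p, \<tau> p, p'} \<subseteq> fib q" using assms(3) p'(1) \<open>\<tau> p \<in> fib q\<close> by simp
    then have "card {p, \<tau> p, p'} \<le> 2"
      using card_mono[OF fib_finite] fib_unbranched(1)[OF assms(1)] by metis
    ultimately show False by simp
  qed
next
  assume "\<tau> p = p"
  then show "q \<in> \<pi> ` real_points S \<tau>" using assms(3) by (auto simp: real_points_def fib_def)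
qed

text \<open>The fixed set of a continuous self-map of a Hausdorff space is closed, here also
  compact, and so is its image in the Hausdorff sphere.\<close>

lemma real_image_closed: "closedin (topo CP1) (\<pi> ` real_points S \<tau>)"
proof -
  have H: "Hausdorff_space (topo S)" using rsurface unfolding riemann_surface_def by blast
  have "real_points S \<tau> = {p \<in> points S. \<tau> p = id p}" by (auto simp: real_points_def)
  then have "closedin (topo S) (real_points S \<tau>)"
    using closedin_continuous_maps_eq[OF H \<tau>_cont continuous_map_id] by simp
  then have "compactin (topo S) (real_points S \<tau>)"
    using closedin_compact_space[OF compact] by blast
  then have "compactin (topo CP1) (\<pi> ` real_points S \<tau>)"
    using image_compactin \<pi>_cont by blast
  moreover have "Hausdorff_space (topo CP1)"
    by (simp add: CP1_simps Hausdorff_space_Alexandroff_compactification locally_compact_space_euclidean)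
  ultimately show ?thesis using compactin_imp_closedin by blast
qed

text \<open>The projection is injective near the unramified fixed point \<open>p\<close>. If
  \<open>x\<close> is close to \<open>p\<close> over a conjugation-invariant value, then
  \<open>\<tau> x\<close> is close to \<open>p\<close> as well and has the same image, hence equals
  \<open>x\<close>. The set \<open>X\<close> is chosen to contain only \<open>x\<close> for which
  both points lie in the region of injectivity.\<close>

lemma real_image_open_at_unbranched:
  assumes p: "p \<in> real_points S \<tau>" and unb: "\<pi> p \<notin> branch_points S \<pi>"
  obtains N where "openin (topo CP1) N" "\<pi> p \<in> N"
    "\<And>q. q \<in> N \<Longrightarrow> map_option cnj q = q \<Longrightarrow> q \<in> \<pi> ` real_points S \<tau>"
proof -
  have pS: "p \<in> points S" and \<tau>p: "\<tau> p = p" using p by (auto simp: real_points_def)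
  obtain C \<kappa> where c0: "chart_at S p = (C, \<kappa>)" by fastforce
  obtain D \<mu> where d0: "chart_at CP1 (\<pi> p) = (D, \<mu>)" by fastforce
  note c = chart_at_in[OF pS c0]
  have d: "(D, \<mu>) \<in> charts CP1" "\<pi> p \<in> D" using CP1_chart_at[of "\<pi> p"] d0 by auto
  note lc = local_coordinate[OF c d]
  let ?f = "\<lambda>z. \<mu> (\<pi> (inv_into C \<kappa> z))" and ?A = "\<kappa> ` {x \<in> C. \<pi> x \<in> D}"
  have "ram p = 1" using fib_unbranched(2)[OF unb] pS by (simp add: fib_def)
  then have "zorder (\<lambda>z. ?f z - ?f (\<kappa> p)) (\<kappa> p) = 1"
    using ram_chart[OF c0 d0] unfolding lc(4) by simp
  from zorder_1_locally_injective[OF lc(3,1,2) this lc(5)]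
  obtain \<rho> where \<rho>: "\<rho> > 0" "ball (\<kappa> p) \<rho> \<subseteq> ?A" "inj_on ?f (ball (\<kappa> p) \<rho>)" .
  define Y where "Y = {x \<in> C. \<kappa> x \<in> ball (\<kappa> p) \<rho>}"
  define X where "X = Y \<inter> {x \<in> points S. \<tau> x \<in> Y}"
  have opY: "openin (topo S) Y"
    unfolding Y_def by (rule chart_vimage_open[OF c(1) open_ball])
  have opX: "openin (topo S) X"
    unfolding X_def using opY openin_continuous_map_preimage[OF \<tau>_cont opY] by blast
  have pX: "p \<in> X" using c \<rho>(1) pS \<tau>p by (simp add: X_def Y_def)
  have XC: "X \<subseteq> C" by (auto simp: X_def Y_def)
  have sub: "\<kappa> ` (C \<inter> X) \<subseteq> ball (\<kappa> p) \<rho>" by (auto simp: X_def Y_def)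
  have "open (?f ` (\<kappa> ` (C \<inter> X)))"
  proof (rule open_mapping_thm3)
    show "?f holomorphic_on \<kappa> ` (C \<inter> X)"
      using lc(3) sub \<rho>(2) by (meson holomorphic_on_subset subset_trans)
    show "open (\<kappa> ` (C \<inter> X))" by (rule chart_image_open[OF c(1) opX])
    show "inj_on ?f (\<kappa> ` (C \<inter> X))" using \<rho>(3) sub inj_on_subset by blast
  qed
  then have "openin (topo CP1) {q \<in> D. \<mu> q \<in> ?f ` (\<kappa> ` (C \<inter> X))}"
    by (rule CP1_chart_vimage_open[OF d(1)])
  moreover have "\<pi> p \<in> {q \<in> D. \<mu> q \<in> ?f ` (\<kappa> ` (C \<inter> X))}"
    using d(2) pX c lc(4) by (auto intro!: image_eqI[of _ ?f "\<kappa> p"])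
  moreover have "q \<in> \<pi> ` real_points S \<tau>"
    if q: "q \<in> {q \<in> D. \<mu> q \<in> ?f ` (\<kappa> ` (C \<inter> X))}" and qr: "map_option cnj q = q" for q
  proof -
    from q obtain x where x: "x \<in> X" "x \<in> C" "\<mu> q = \<mu> (\<pi> x)" "q \<in> D"
      using chart_inv[OF c(1)] by auto
    have \<tau>x: "\<tau> x \<in> C" and bx: "\<kappa> x \<in> ball (\<kappa> p) \<rho>" "\<kappa> (\<tau> x) \<in> ball (\<kappa> p) \<rho>"
      and xS: "x \<in> points S"
      using x(1) by (auto simp: X_def Y_def)
    have "\<pi> x \<in> D"
    proof -
      have "\<kappa> x \<in> ?A" using bx(1) \<rho>(2) by blast
      then show ?thesis using chart_inj[OF c(1)] x(2) by (auto simp: inj_on_def)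
    qed
    then have qx: "q = \<pi> x" using CP1_chart_inj[OF d(1)] x(3,4) by (auto simp: inj_on_def)
    have "\<pi> (\<tau> x) = \<pi> x" using \<pi>_conj[OF xS] qr qx by simp
    then have "?f (\<kappa> (\<tau> x)) = ?f (\<kappa> x)" using chart_inv[OF c(1)] \<tau>x x(2) by simp
    then have "\<kappa> (\<tau> x) = \<kappa> x" using \<rho>(3) bx unfolding inj_on_def by blast
    then have "\<tau> x = x" using chart_inj[OF c(1)] \<tau>x x(2) unfolding inj_on_def by blast
    then show ?thesis using qx xS by (auto simp: real_points_def)
  qed
  ultimately show ?thesis using that by blast
qed

end

section \<open>Which real values have real points above them\<close>

context real_hyp_curve
begin

text \<open>Near a branch point \<open>r\<close> one has \<open>t - r = h\<^sup>2\<close> for a local coordinate \<open>h\<close>, and \<open>\<tau>\<close> acts as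
  \<open>h \<mapsto> \<plusminus> cnj h\<close>; so the points over one side of \<open>r\<close> are fixed and those over the other are not.\<close>

lemma switch_at_branch:
  assumes p: "p \<in> weierstrass S \<pi>" and t: "\<pi> p = Some (of_real r)"
  obtains \<eta> e where "\<eta> > 0"
    "\<And>y. y \<noteq> 0 \<Longrightarrow> \<bar>y\<bar> < \<eta> \<Longrightarrow> \<exists>x\<in>fib (Some (of_real (r + y))). \<tau> x = x \<longleftrightarrow> (e \<longleftrightarrow> y > 0)"
proof -
  have pS: "p \<in> points S" and ram2: "ram p = 2" using p by (auto simp: weierstrass_def)
  have \<tau>p: "\<tau> p = p"
  proof -
    have "\<tau> p \<in> fib (\<pi> p)" using \<tau>_in[OF pS] \<pi>_conj[OF pS] t by (simp add: fib_def)
    then show ?thesis using fib_weierstrass[OF p] by simp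
  qed
  obtain C \<kappa> where c0: "chart_at S p = (C, \<kappa>)" by fastforce
  note c = chart_at_in[OF pS c0]
  have aff: "chart_affine \<in> charts CP1" "\<pi> p \<in> range Some" using t by (auto simp: CP1_simps)
  note lc = local_coordinate[OF c aff]
  let ?f = "\<lambda>z. the (\<pi> (inv_into C \<kappa> z))" and ?A = "\<kappa> ` {x \<in> C. \<pi> x \<in> range Some}"
  have fp: "?f (\<kappa> p) = of_real r" using lc(4) t by simp
  have zo: "zorder (\<lambda>z. ?f z - ?f (\<kappa> p)) (\<kappa> p) = 2"
    using ram_affine[OF pS t c0] ram2 unfolding fp by simp
  obtain \<rho> h where \<rho>: "\<rho> > 0" "ball (\<kappa> p) \<rho> \<subseteq> ?A" and h: "h holomorphic_on ball (\<kappa> p) \<rho>"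
    "inj_on h (ball (\<kappa> p) \<rho>)" "h (\<kappa> p) = 0"
    and fh: "\<And>z. z \<in> ball (\<kappa> p) \<rho> \<Longrightarrow> ?f z - ?f (\<kappa> p) = (h z)\<^sup>2"
    by (rule zorder_2_square[OF lc(3,1,2) zo lc(5)]) (rule that)
  define Y where "Y = {x \<in> C. \<kappa> x \<in> ball (\<kappa> p) \<rho>}"
  define X where "X = Y \<inter> {x \<in> points S. \<tau> x \<in> Y}"
  have opY: "openin (topo S) Y"
    unfolding Y_def by (rule chart_vimage_open[OF c(1) open_ball])
  have opX: "openin (topo S) X"
    unfolding X_def using opY openin_continuous_map_preimage[OF \<tau>_cont opY] by blast
  have pX: "p \<in> X" using c \<rho>(1) pS \<tau>p by (simp add: X_def Y_def)
  obtain \<rho>' where \<rho>': "\<rho>' > 0" "ball (\<kappa> p) \<rho>' \<subseteq> \<kappa> ` (C \<inter> X)"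
    using chart_image_open[OF c(1) opX] pX c(2) openE by blast
  define T where "T = (\<lambda>z. \<kappa> (\<tau> (inv_into C \<kappa> z)))"
  \<comment> \<open>\<open>k\<close> is the conjugate of the coordinate \<open>h\<close> after
    applying \<open>\<tau>\<close>. From \<open>\<pi> (\<tau> x) = cnj (\<pi> x)\<close> and
    \<open>h\<^sup>2 = \<pi> - r\<close> one gets \<open>k\<^sup>2 = h\<^sup>2\<close>, so
    \<open>k\<close> and \<open>h\<close> differ by a sign at every point.\<close>
  define k where "k = (\<lambda>z. cnj (h (T z)))"
  have X: "x \<in> C" "x \<in> points S" "\<tau> x \<in> C" "\<kappa> x \<in> ball (\<kappa> p) \<rho>" "\<kappa> (\<tau> x) \<in> ball (\<kappa> p) \<rho>"
    if "x \<in> X" for x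
    using that by (auto simp: X_def Y_def)
  have sub: "ball (\<kappa> p) \<rho>' \<subseteq> ball (\<kappa> p) \<rho>" using \<rho>'(2) X(4) by blast
  have Some_f: "\<pi> x = Some (?f (\<kappa> x))" if "x \<in> X" for x
  proof -
    have "\<kappa> x \<in> ?A" using X(4)[OF that] \<rho>(2) by blast
    then have "\<pi> x \<in> range Some" using chart_inj[OF c(1)] X(1)[OF that] by (auto simp: inj_on_def)
    then show ?thesis using X(1)[OF that] chart_inv[OF c(1)] by auto
  qed
  have Tcont: "continuous_on (ball (\<kappa> p) \<rho>') T"
  proof -
    have "(\<lambda>z. cnj (T z)) holomorphic_on ball (\<kappa> p) \<rho>'"
    proof (rule holomorphic_on_subset)
      show "(\<lambda>z. cnj (T z)) holomorphic_on \<kappa> ` {x \<in> C. \<tau> x \<in> C}"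
        using bspec[OF bspec[OF conjunct2[OF antiholo[unfolded antiholomorphic_map_def]] c(1), simplified] c(1)]
        by (simp add: T_def)
      show "ball (\<kappa> p) \<rho>' \<subseteq> \<kappa> ` {x \<in> C. \<tau> x \<in> C}" using \<rho>'(2) X(3) by blast
    qed
    then have "continuous_on (ball (\<kappa> p) \<rho>') (\<lambda>z. cnj (cnj (T z)))"
      by (intro continuous_intros holomorphic_on_imp_continuous_on)
    then show ?thesis by simp
  qed
  have Tim: "T z \<in> ball (\<kappa> p) \<rho>" if "z \<in> ball (\<kappa> p) \<rho>'" for z
    using that \<rho>'(2) X(5) chart_inv[OF c(1)] by (auto simp: T_def)
  have hcont: "continuous_on (ball (\<kappa> p) \<rho>) h" using h(1) by (rule holomorphic_on_imp_continuous_on)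
  have kcont: "continuous_on (ball (\<kappa> p) \<rho>') k"
    unfolding k_def
    by (intro continuous_on_cnj continuous_on_compose2[OF hcont Tcont]) (use Tim in auto)
  have k2: "(k z)\<^sup>2 = (h z)\<^sup>2" if z: "z \<in> ball (\<kappa> p) \<rho>'" for z
  proof -
    obtain x where x: "x \<in> X" "z = \<kappa> x" using z \<rho>'(2) by blast
    have Tz: "T z = \<kappa> (\<tau> x)" using x X(1) chart_inv[OF c(1)] by (simp add: T_def)
    have "(h (T z))\<^sup>2 = the (\<pi> (\<tau> x)) - of_real r"
      using fh[OF Tim[OF z]] X(3)[OF x(1)] chart_inv[OF c(1)] unfolding fp Tz by simp
    also have "\<dots> = cnj (?f z - of_real r)"
      using \<pi>_conj[OF X(2)[OF x(1)]] Some_f[OF x(1)] x(2) by simp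
    finally have "(k z)\<^sup>2 = ?f z - of_real r"
      unfolding k_def by (metis complex_cnj_cnj complex_cnj_power)
    then show ?thesis using fh[of z] z sub fp by auto
  qed
  have hnz: "h z \<noteq> 0" if "z \<in> ball (\<kappa> p) \<rho>' - {\<kappa> p}" for z
    using that sub h(2,3) \<rho>(1) by (metis DiffD1 DiffD2 centre_in_ball inj_onD insertI1 subsetD)
  \<comment> \<open>The sign cannot jump: the quotient is continuous with values 1 and -1 on a
    punctured disc, which is connected.\<close>
  have "(\<lambda>z. k z / h z) constant_on (ball (\<kappa> p) \<rho>' - {\<kappa> p})"
  proof (rule continuous_finite_range_constant)
    show "connected (ball (\<kappa> p) \<rho>' - {\<kappa> p})"
      by (rule connected_punctured_ball) simp
    show "continuous_on (ball (\<kappa> p) \<rho>' - {\<kappa> p}) (\<lambda>z. k z / h z)"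
      using kcont hcont hnz sub by (auto intro!: continuous_on_divide elim: continuous_on_subset)
    have "k z / h z \<in> {1, -1}" if z: "z \<in> ball (\<kappa> p) \<rho>' - {\<kappa> p}" for z
    proof -
      have "k z = h z \<or> k z = - h z" using k2[of z] z power2_eq_iff by blast
      then show ?thesis using hnz[OF z] by auto
    qed
    then have "(\<lambda>z. k z / h z) ` (ball (\<kappa> p) \<rho>' - {\<kappa> p}) \<subseteq> {1, -1}" by blast
    then show "finite ((\<lambda>z. k z / h z) ` (ball (\<kappa> p) \<rho>' - {\<kappa> p}))"
      using finite_subset by blast
  qed
  then obtain \<epsilon> where \<epsilon>: "\<And>z. z \<in> ball (\<kappa> p) \<rho>' - {\<kappa> p} \<Longrightarrow> k z / h z = \<epsilon>"
    unfolding constant_on_def by blast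
  have "open (h ` ball (\<kappa> p) \<rho>')"
    using h sub by (intro open_mapping_thm3) (auto elim: holomorphic_on_subset inj_on_subset)
  moreover have "0 \<in> h ` ball (\<kappa> p) \<rho>'" using h(3) \<rho>'(1) by force
  ultimately obtain \<delta> where \<delta>: "\<delta> > 0" "ball 0 \<delta> \<subseteq> h ` ball (\<kappa> p) \<rho>'" using openE by blast
  have main: "\<exists>x\<in>fib (Some (of_real (r + y))). \<tau> x = x \<longleftrightarrow> (\<epsilon> = 1 \<longleftrightarrow> y > 0)"
    if y: "y \<noteq> 0" "\<bar>y\<bar> < \<delta>\<^sup>2" for y
  proof -
    \<comment> \<open>The point over \<open>r + y\<close> to be tested has coordinate
      \<open>h = w\<close> with \<open>w\<^sup>2 = y\<close>. This \<open>w\<close> is real for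
      \<open>y > 0\<close> and imaginary for \<open>y < 0\<close>, so conjugation fixes it on one
      side of \<open>r\<close> and negates it on the other. The bound
      \<open>\<bar>y\<bar> < \<delta>\<^sup>2\<close> keeps \<open>w\<close> in the image of
      \<open>h\<close>.\<close>
    define w where "w = csqrt (of_real y)"
    have w2: "w\<^sup>2 = of_real y" by (simp add: w_def)
    have w0: "w \<noteq> 0" using y by (simp add: w_def)
    have "(cmod w)\<^sup>2 = \<bar>y\<bar>" using w2 by (metis norm_of_real norm_power)
    then have "cmod w < \<delta>" using y(2) \<delta>(1) by (metis less_imp_le power_less_imp_less_base)
    then obtain z where z: "z \<in> ball (\<kappa> p) \<rho>'" "h z = w" using \<delta>(2) by (force simp: subset_iff)
    then have z': "z \<in> ball (\<kappa> p) \<rho>' - {\<kappa> p}" using w0 h(3) by auto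
    obtain x where x: "x \<in> X" "z = \<kappa> x" using z(1) \<rho>'(2) by blast
    have Tz: "T z = \<kappa> (\<tau> x)" using x X(1) chart_inv[OF c(1)] by (simp add: T_def)
    have "?f z = of_real (r + y)" using fh[of z] z sub fp w2 by (auto simp: algebra_simps)
    then have "\<pi> x = Some (of_real (r + y))" using Some_f[OF x(1)] x(2) by simp
    then have xf: "x \<in> fib (Some (of_real (r + y)))" using X(2)[OF x(1)] by (simp add: fib_def)
    have "k z = \<epsilon> * w" using \<epsilon>[OF z'] z(2) w0 by (auto simp: field_simps)
    then have hT: "h (T z) = cnj \<epsilon> * cnj w" unfolding k_def by (metis complex_cnj_cnj complex_cnj_mult)
    have \<epsilon>2: "\<epsilon> = 1 \<or> \<epsilon> = -1"
    proof -
      have "k z = h z \<or> k z = - h z" using k2[OF z(1)] power2_eq_iff by blast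
      then show ?thesis using \<epsilon>[OF z'] hnz[OF z'] by auto
    qed
    have cw: "cnj w = (if y > 0 then w else - w)"
    proof (cases "y > 0")
      case True
      then have "w = of_real (sqrt y)" by (simp add: w_def)
      then show ?thesis using True by simp
    next
      case False
      then have "w = \<i> * of_real (sqrt (- y))"
        unfolding w_def by (simp add: complex_eq_iff real_sqrt_divide)
      then show ?thesis using False by simp
    qed
    have "\<tau> x = x \<longleftrightarrow> T z = z"
      using Tz x chart_inj[OF c(1)] X(1,3)[OF x(1)] by (auto simp: inj_on_def)
    also have "\<dots> \<longleftrightarrow> h (T z) = h z"
      by (rule inj_on_eq_iff[OF h(2) Tim[OF z(1)] subsetD[OF sub z(1)], symmetric])
    also have "\<dots> \<longleftrightarrow> (\<epsilon> = 1 \<longleftrightarrow> y > 0)"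
      using \<epsilon>2 w0 unfolding hT z(2) cw by auto
    finally show ?thesis using xf by blast
  qed
  show ?thesis
  proof (rule that[of "\<delta>\<^sup>2" "\<epsilon> = 1"])
    show "\<delta>\<^sup>2 > 0" using \<delta>(1) by simp
  qed (rule main)
qed

definition real_over :: "real \<Rightarrow> bool" where
  "real_over t \<longleftrightarrow> Some (of_real t) \<in> \<pi> ` real_points S \<tau>"

text \<open>Both alternatives are open conditions on a real value: having a real point above it
  because the projection is unramified there, having none because the image of the real points is
  closed.\<close>

lemma real_over_locally_const:
  assumes "Some (of_real t) \<notin> branch_points S \<pi>"
  shows "\<forall>\<^sub>F t' in nhds t. real_over t' \<longleftrightarrow> real_over t"
proof -
  have cont: "continuous_map euclidean (topo CP1) (\<lambda>t::real. Some (complex_of_real t))"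
  proof -
    have "continuous_map euclidean (topo CP1) (Some \<circ> complex_of_real)"
      unfolding CP1_simps
      by (intro continuous_map_compose[OF _ continuous_map_Some])
         (simp add: continuous_on_of_real_id)
    then show ?thesis by (simp add: o_def)
  qed
  have ev: "\<forall>\<^sub>F t' in nhds t. Some (of_real t') \<in> N"
    if "openin (topo CP1) N" "Some (of_real t) \<in> N" for N
  proof -
    have "open {t. Some (complex_of_real t) \<in> N}"
      using openin_continuous_map_preimage[OF cont that(1)] by simp
    then show ?thesis using that(2) unfolding eventually_nhds by blast
  qed
  show ?thesis
  proof (cases "real_over t")
    case True
    then obtain p where p: "p \<in> real_points S \<tau>" "\<pi> p = Some (of_real t)"
      unfolding real_over_def by force
    with assms have "\<pi> p \<notin> branch_points S \<pi>" by simp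
    from real_image_open_at_unbranched[OF p(1) this]
    obtain N where N: "openin (topo CP1) N" "\<pi> p \<in> N"
      "\<And>q. q \<in> N \<Longrightarrow> map_option cnj q = q \<Longrightarrow> q \<in> \<pi> ` real_points S \<tau>" by blast
    have "\<forall>\<^sub>F t' in nhds t. Some (of_real t') \<in> N" using ev N(1,2) p(2) by simp
    then show ?thesis
      by eventually_elim (use True N(3) in \<open>simp add: real_over_def\<close>)
  next
    case False
    have "openin (topo CP1) (points CP1 - \<pi> ` real_points S \<tau>)"
      by (rule openin_diff[OF openin_topspace real_image_closed])
    then have "\<forall>\<^sub>F t' in nhds t. Some (of_real t') \<in> points CP1 - \<pi> ` real_points S \<tau>"
      by (rule ev) (use False in \<open>simp add: real_over_def CP1_simps(3)\<close>)
    then show ?thesis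
      by eventually_elim (use False in \<open>simp add: real_over_def\<close>)
  qed
qed

text \<open>Infinity is unbranched and lies under a real point, so all real values near infinity do
  as well. This fixes the starting value of the alternation, to the left of all branch
  points.\<close>

lemma real_over_at_bot:
  assumes "None \<notin> branch_points S \<pi>" "None \<in> \<pi> ` real_points S \<tau>"
  shows "\<forall>\<^sub>F t in at_bot. real_over t"
proof -
  obtain p where p: "p \<in> real_points S \<tau>" "\<pi> p = None" using assms(2) by force
  with assms have "\<pi> p \<notin> branch_points S \<pi>" by simp
  from real_image_open_at_unbranched[OF p(1) this]
  obtain N where N: "openin (topo CP1) N" "None \<in> N"
    "\<And>q. q \<in> N \<Longrightarrow> map_option cnj q = q \<Longrightarrow> q \<in> \<pi> ` real_points S \<tau>" using p(2) by metis
  from N(1,2) obtain K :: "complex set" where K: "compact K" "N = insert None (Some ` (- K))"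
    unfolding CP1_simps openin_Alexandroff_compactification by (auto simp: Compl_eq_Diff_UNIV)
  obtain B where B: "\<And>z. z \<in> K \<Longrightarrow> norm z \<le> B"
    using compact_imp_bounded[OF K(1)] bounded_iff by blast
  show ?thesis
    unfolding eventually_at_bot_dense
  proof (intro exI[of _ "- \<bar>B\<bar>"] allI impI)
    fix t :: real assume "t < - \<bar>B\<bar>"
    then have "complex_of_real t \<notin> K" using B[of "of_real t"] by auto
    then have "Some (complex_of_real t) \<in> N" using K(2) by blast
    then show "real_over t" using N(3) by (simp add: real_over_def)
  qed
qed

lemma real_over_switch:
  assumes "Some (of_real r) \<in> branch_points S \<pi>"
  obtains \<eta> e where "\<eta> > 0"
    "\<And>y. y \<noteq> 0 \<Longrightarrow> \<bar>y\<bar> < \<eta> \<Longrightarrow> Some (of_real (r + y)) \<notin> branch_points S \<pi> \<Longrightarrow>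
       real_over (r + y) \<longleftrightarrow> (e \<longleftrightarrow> y > 0)"
proof -
  obtain p where p: "p \<in> weierstrass S \<pi>" "\<pi> p = Some (of_real r)"
    using assms unfolding branch_points_def by force
  from switch_at_branch[OF p] obtain \<eta> e where \<eta>: "\<eta> > 0"
    "\<And>y. y \<noteq> 0 \<Longrightarrow> \<bar>y\<bar> < \<eta> \<Longrightarrow> \<exists>x\<in>fib (Some (of_real (r + y))). \<tau> x = x \<longleftrightarrow> (e \<longleftrightarrow> y > 0)"
    by metis
  show ?thesis
  proof (rule that[OF \<eta>(1)])
    fix y assume y: "y \<noteq> 0" "\<bar>y\<bar> < \<eta>" "Some (of_real (r + y)) \<notin> branch_points S \<pi>"
    obtain x where x: "x \<in> fib (Some (of_real (r + y)))" "\<tau> x = x \<longleftrightarrow> (e \<longleftrightarrow> y > 0)"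
      using \<eta>(2)[OF y(1,2)] by blast
    show "real_over (r + y) \<longleftrightarrow> (e \<longleftrightarrow> y > 0)"
      using fixed_iff[OF y(3) _ x(1)] x(2) unfolding real_over_def by simp
  qed
qed

end

text \<open>\<open>F\<close> is constant on each component of the complement of the points
  \<open>r 1\<close>, ..., \<open>r K\<close>, since components are connected and \<open>F\<close>
  is locally constant there, and it flips at each point. The component \<open>I k\<close> has
  exactly \<open>k\<close> of the points to its left; the disjunctions with \<open>k = 0\<close> and
  \<open>k = K\<close> cover the unbounded components.\<close>

lemma alternating_intervals:
  fixes r :: "nat \<Rightarrow> real" and F :: "real \<Rightarrow> bool"
  assumes mono: "strict_mono_on {1..K} r"
    and const: "\<And>t. t \<notin> r ` {1..K} \<Longrightarrow> \<forall>\<^sub>F t' in nhds t. F t' \<longleftrightarrow> F t"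
    and switch: "\<And>t. t \<in> r ` {1..K} \<Longrightarrow>
      \<exists>\<eta>>0. \<exists>e. \<forall>y. y \<noteq> 0 \<longrightarrow> \<bar>y\<bar> < \<eta> \<longrightarrow> t + y \<notin> r ` {1..K} \<longrightarrow> (F (t + y) \<longleftrightarrow> (e \<longleftrightarrow> y > 0))"
    and bot: "\<forall>\<^sub>F t in at_bot. F t"
    and k: "k \<le> K" "k = 0 \<or> r k < t" "k = K \<or> t < r (Suc k)"
  shows "F t \<longleftrightarrow> even k"
proof -
  define I where "I k = {t. (k = 0 \<or> r k < t) \<and> (k = K \<or> t < r (Suc k))}" for k
  have less: "r i < r j \<longleftrightarrow> i < j" if "i \<in> {1..K}" "j \<in> {1..K}" for i j
    using strict_mono_on_less[OF mono that] .
  have notin: "t \<notin> r ` {1..K}" if "k \<le> K" "t \<in> I k" for k t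
  proof
    assume "t \<in> r ` {1..K}"
    then obtain j where j: "j \<in> {1..K}" "t = r j" by blast
    have "k < j" if "k \<noteq> 0" using less[of k j] j \<open>t \<in> I k\<close> \<open>k \<le> K\<close> that by (auto simp: I_def)
    then have "k < j" using j by (cases "k = 0") auto
    then have "r j < r (Suc k)" using j \<open>t \<in> I k\<close> by (auto simp: I_def)
    then have "j < Suc k" using less[of j "Suc k"] j \<open>k < j\<close> by auto
    with \<open>k < j\<close> show False by simp
  qed
  have same: "F t \<longleftrightarrow> F t'" if k: "k \<le> K" and t: "t \<in> I k" "t' \<in> I k" for k t t'
  proof -
    have "connected (I k)"
      unfolding is_interval_connected_1[symmetric] is_interval_1 I_def by auto
    then show ?thesis
    proof (rule connected_local_const[OF _ t])
      show "\<forall>a\<in>I k. \<forall>\<^sub>F b in at a within I k. F a = F b"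
      proof
        fix a assume "a \<in> I k"
        then have "\<forall>\<^sub>F b in nhds a. F b \<longleftrightarrow> F a" using const notin k by blast
        then have "\<forall>\<^sub>F b in at a within I k. F b \<longleftrightarrow> F a"
          unfolding eventually_at_filter by (rule eventually_mono) simp
        then show "\<forall>\<^sub>F b in at a within I k. F a = F b"
          by eventually_elim simp
      qed
    qed
  qed
  have "\<forall>t\<in>I k. F t \<longleftrightarrow> even k" if "k \<le> K" for k
    using that
  proof (induction k)
    case 0
    have "\<forall>\<^sub>F t in at_bot. t < r 1"
      unfolding eventually_at_bot_dense by blast
    with bot have "\<forall>\<^sub>F t in at_bot. F t \<and> t \<in> I 0"
      by eventually_elim (auto simp: I_def)
    then obtain t0 where t0: "F t0" "t0 \<in> I 0"
      using eventually_happens'[OF trivial_limit_at_bot_linorder] by blast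
    have "F t" if "t \<in> I 0" for t
      using same[OF "0.prems" that t0(2)] t0(1) by blast
    then show ?case by simp
  next
    case (Suc k)
    let ?b = "r (Suc k)"
    have b: "?b \<in> r ` {1..K}" using Suc.prems by auto
    from switch[OF b] obtain \<eta> where \<eta>1: "\<eta> > 0 \<and> (\<exists>e. \<forall>y. y \<noteq> 0 \<longrightarrow> \<bar>y\<bar> < \<eta> \<longrightarrow>
        ?b + y \<notin> r ` {1..K} \<longrightarrow> (F (?b + y) \<longleftrightarrow> (e \<longleftrightarrow> y > 0)))" ..
    from conjunct2[OF this] obtain e where \<eta>2: "\<forall>y. y \<noteq> 0 \<longrightarrow> \<bar>y\<bar> < \<eta> \<longrightarrow>
        ?b + y \<notin> r ` {1..K} \<longrightarrow> (F (?b + y) \<longleftrightarrow> (e \<longleftrightarrow> y > 0))" ..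
    note \<eta> = conjunct1[OF \<eta>1] \<eta>2[rule_format]
    \<comment> \<open>\<open>lo\<close> and \<open>hi\<close> are the neighbouring points of
      \<open>r\<close>, or arbitrary bounds where the adjacent component is unbounded. They make
      \<open>y\<close> small enough for \<open>?b - y\<close> and \<open>?b + y\<close> to stay in
      the components next to \<open>?b\<close>.\<close>
    define lo where "lo = (if k = 0 then ?b - 1 else r k)"
    define hi where "hi = (if Suc k = K then ?b + 1 else r (Suc (Suc k)))"
    have lo: "lo < ?b" using less[of k "Suc k"] Suc.prems by (auto simp: lo_def)
    have hi: "?b < hi" using less[of "Suc k" "Suc (Suc k)"] Suc.prems by (auto simp: hi_def)
    define y where "y = Min {\<eta>, ?b - lo, hi - ?b} / 2"
    have y: "y > 0" "y < \<eta>" "y < ?b - lo" "y < hi - ?b"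
      using \<eta>(1) lo hi by (auto simp: y_def min_def)
    have I1: "?b + (- y) \<in> I k" using y by (auto simp: I_def lo_def split: if_splits)
    have I2: "?b + y \<in> I (Suc k)" using y by (auto simp: I_def hi_def split: if_splits)
    have "F (?b + (- y)) \<longleftrightarrow> even k" using Suc I1 by auto
    moreover have "F (?b + (- y)) \<longleftrightarrow> \<not> e"
      using \<eta>(2)[of "- y"] y notin[OF _ I1] Suc.prems by auto
    moreover have "F (?b + y) \<longleftrightarrow> e"
      using \<eta>(2)[of y] y notin[OF _ I2] Suc.prems by auto
    ultimately have "F (?b + y) \<longleftrightarrow> even (Suc k)" by auto
    then show ?case using same[OF Suc.prems I2] by blast
  qed
  then show ?thesis using k by (auto simp: I_def)
qed

section \<open>Signs and parities\<close>

lemma prod_pos_iff_even_card_neg: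
  fixes f :: "'b \<Rightarrow> real"
  assumes "finite A" "\<And>a. a \<in> A \<Longrightarrow> f a \<noteq> 0"
  shows "prod f A > 0 \<longleftrightarrow> even (card {a \<in> A. f a < 0})"
  using assms
proof (induction A rule: finite_induct)
  case (insert x A)
  have nz: "prod f A \<noteq> 0" using insert by simp
  have IH: "prod f A > 0 \<longleftrightarrow> even (card {a \<in> A. f a < 0})" using insert by simp
  have x: "f x \<noteq> 0" using insert.prems by simp
  have fin: "finite {a \<in> A. f a < 0}" "x \<notin> {a \<in> A. f a < 0}" using insert.hyps by auto
  show ?case
  proof (cases "f x < 0")
    case True
    then have "{a \<in> insert x A. f a < 0} = insert x {a \<in> A. f a < 0}" by auto
    then have "even (card {a \<in> insert x A. f a < 0}) \<longleftrightarrow> \<not> prod f A > 0"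
      using IH fin by simp
    moreover have "prod f (insert x A) = f x * prod f A" using insert.hyps by simp
    then have "prod f (insert x A) > 0 \<longleftrightarrow> prod f A < 0"
      using True by (simp add: zero_less_mult_iff)
    then have "prod f (insert x A) > 0 \<longleftrightarrow> \<not> prod f A > 0" using nz by linarith
    ultimately show ?thesis by blast
  next
    case False
    then have "{a \<in> insert x A. f a < 0} = {a \<in> A. f a < 0}" by auto
    moreover have "prod f (insert x A) = f x * prod f A" using insert.hyps by simp
    then have "prod f (insert x A) > 0 \<longleftrightarrow> prod f A > 0"
      using False x by (simp add: zero_less_mult_iff)
    ultimately show ?thesis using IH by simp
  qed
qed simp

lemma split_conj_closed:
  fixes A :: "complex set"
  assumes "\<And>\<alpha>. \<alpha> \<in> A \<Longrightarrow> cnj \<alpha> \<in> A"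
  shows "A = {\<alpha> \<in> A. Im \<alpha> = 0} \<union> ({\<alpha> \<in> A. Im \<alpha> > 0} \<union> cnj ` {\<alpha> \<in> A. Im \<alpha> > 0})"
    and "{\<alpha> \<in> A. Im \<alpha> = 0} \<inter> ({\<alpha> \<in> A. Im \<alpha> > 0} \<union> cnj ` {\<alpha> \<in> A. Im \<alpha> > 0}) = {}"
    and "{\<alpha> \<in> A. Im \<alpha> > 0} \<inter> cnj ` {\<alpha> \<in> A. Im \<alpha> > 0} = {}"
proof -
  have Im: "Im \<alpha> < 0" if "\<alpha> \<in> cnj ` {\<alpha> \<in> A. Im \<alpha> > 0}" for \<alpha>
    using that by (elim imageE) simp
  show "{\<alpha> \<in> A. Im \<alpha> = 0} \<inter> ({\<alpha> \<in> A. Im \<alpha> > 0} \<union> cnj ` {\<alpha> \<in> A. Im \<alpha> > 0}) = {}"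
    by (fastforce dest: Im)
  show "{\<alpha> \<in> A. Im \<alpha> > 0} \<inter> cnj ` {\<alpha> \<in> A. Im \<alpha> > 0} = {}"
    by (fastforce dest: Im)
  show "A = {\<alpha> \<in> A. Im \<alpha> = 0} \<union> ({\<alpha> \<in> A. Im \<alpha> > 0} \<union> cnj ` {\<alpha> \<in> A. Im \<alpha> > 0})"
  proof (intro Set.set_eqI iffI)
    fix \<alpha> assume \<alpha>: "\<alpha> \<in> A"
    show "\<alpha> \<in> {\<alpha> \<in> A. Im \<alpha> = 0} \<union> ({\<alpha> \<in> A. Im \<alpha> > 0} \<union> cnj ` {\<alpha> \<in> A. Im \<alpha> > 0})"
    proof (cases "Im \<alpha> < 0")
      case True
      then have "cnj \<alpha> \<in> {\<alpha> \<in> A. Im \<alpha> > 0}" using assms[OF \<alpha>] by simp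
      then have "cnj (cnj \<alpha>) \<in> cnj ` {\<alpha> \<in> A. Im \<alpha> > 0}" by (rule imageI)
      then show ?thesis by simp
    qed (use \<alpha> in auto)
  qed (use assms in auto)
qed

text \<open>The product over the upper half plane times that over the lower one is a squared
  modulus, and equivariance makes \<open>f\<close> real at real arguments, so the sign is the parity
  of the number of negative real factors. It serves both the divisor and the branch points.\<close>

lemma prod_conj_equivariant:
  fixes f :: "complex \<Rightarrow> complex"
  assumes fin: "finite A" and A: "\<And>\<alpha>. \<alpha> \<in> A \<Longrightarrow> cnj \<alpha> \<in> A"
    and f: "\<And>\<alpha>. \<alpha> \<in> A \<Longrightarrow> f (cnj \<alpha>) = cnj (f \<alpha>)" "\<And>\<alpha>. \<alpha> \<in> A \<Longrightarrow> f \<alpha> \<noteq> 0"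
  obtains s where "prod f A = of_real s" "s \<noteq> 0"
    "s > 0 \<longleftrightarrow> even (card {x. of_real x \<in> A \<and> Re (f (of_real x)) < 0})"
proof -
  define R where "R = {\<alpha> \<in> A. Im \<alpha> = 0}"
  define U where "U = {\<alpha> \<in> A. Im \<alpha> > 0}"
  have real: "cnj \<alpha> = \<alpha>" if "\<alpha> \<in> R" for \<alpha> using that by (simp add: R_def complex_eq_iff)
  have fR: "f \<alpha> = of_real (Re (f \<alpha>))" if "\<alpha> \<in> R" for \<alpha>
  proof -
    have "cnj (f \<alpha>) = f \<alpha>" using f(1)[of \<alpha>] that real[OF that] by (simp add: R_def)
    then show ?thesis by (simp add: complex_eq_iff)
  qed
  have finRU: "finite R" "finite U" using fin by (auto simp: R_def U_def)
  have "prod f A = prod f R * (prod f U * prod f (cnj ` U))"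
  proof -
    have "A = R \<union> (U \<union> cnj ` U)"
      unfolding R_def U_def by (rule split_conj_closed(1)) (rule A)
    then have "prod f A = prod f (R \<union> (U \<union> cnj ` U))"
      by (rule arg_cong)
    also have "\<dots> = prod f R * prod f (U \<union> cnj ` U)"
      using finRU split_conj_closed(2)[of A] A
      by (intro prod.union_disjoint) (simp_all add: R_def U_def)
    also have "prod f (U \<union> cnj ` U) = prod f U * prod f (cnj ` U)"
      using finRU split_conj_closed(3)[of A] A
      by (intro prod.union_disjoint) (simp_all add: U_def)
    finally show ?thesis .
  qed
  also have "prod f (cnj ` U) = (\<Prod>\<alpha>\<in>U. f (cnj \<alpha>))"
    by (subst prod.reindex) (auto simp: inj_on_def)
  also have "\<dots> = cnj (prod f U)"
    unfolding cnj_prod by (rule prod.cong) (use f(1) in \<open>auto simp: U_def\<close>)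
  also have "prod f U * cnj (prod f U) = of_real ((cmod (prod f U))\<^sup>2)"
    by (rule complex_norm_square[symmetric])
  also have "prod f R = of_real (\<Prod>\<alpha>\<in>R. Re (f \<alpha>))"
    using fR by simp
  finally have eq: "prod f A = of_real ((\<Prod>\<alpha>\<in>R. Re (f \<alpha>)) * (cmod (prod f U))\<^sup>2)"
    by simp
  have Rnz: "Re (f \<alpha>) \<noteq> 0" if "\<alpha> \<in> R" for \<alpha>
    using fR[OF that] f(2)[of \<alpha>] that by (auto simp: R_def)
  have "prod f U \<noteq> 0" using f(2) finRU by (auto simp: U_def)
  then have pos: "(cmod (prod f U))\<^sup>2 > 0" by simp
  have "{\<alpha> \<in> R. Re (f \<alpha>) < 0} = of_real ` {x. of_real x \<in> A \<and> Re (f (of_real x)) < 0}"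
    (is "?X = ?Y")
  proof (intro equalityI subsetI)
    fix \<alpha> assume \<alpha>: "\<alpha> \<in> ?X"
    then have "\<alpha> = of_real (Re \<alpha>)" by (simp add: R_def complex_eq_iff)
    then show "\<alpha> \<in> ?Y" using \<alpha> by (intro image_eqI[of _ _ "Re \<alpha>"]) (auto simp: R_def)
  qed (auto simp: R_def)
  then have "card {\<alpha> \<in> R. Re (f \<alpha>) < 0} = card {x. of_real x \<in> A \<and> Re (f (of_real x)) < 0}"
    by (simp add: card_image inj_on_def)
  then have "(\<Prod>\<alpha>\<in>R. Re (f \<alpha>)) * (cmod (prod f U))\<^sup>2 > 0 \<longleftrightarrow>
      even (card {x. of_real x \<in> A \<and> Re (f (of_real x)) < 0})"
    using prod_pos_iff_even_card_neg[of R "\<lambda>\<alpha>. Re (f \<alpha>)"] finRU Rnz pos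
    by (simp add: zero_less_mult_iff)
  moreover have "(\<Prod>\<alpha>\<in>R. Re (f \<alpha>)) * (cmod (prod f U))\<^sup>2 \<noteq> 0"
    using Rnz finRU pos by auto
  ultimately show ?thesis using eq that by blast
qed

lemma power_int_neg_iff:
  fixes y :: real
  assumes "y \<noteq> 0"
  shows "y powi k < 0 \<longleftrightarrow> y < 0 \<and> odd k"
proof (cases "y > 0")
  case True
  then show ?thesis by (auto dest: zero_less_power_int[of y k])
next
  case False
  then have y: "- y > 0" using assms by simp
  have "y powi k = (if even k then (- y) powi k else - ((- y) powi k))"
    using power_int_minus_left[of "- y" k] by simp
  moreover have "(- y) powi k > 0" by (rule zero_less_power_int[OF y])
  ultimately show ?thesis using y by (cases "even k") simp_all
qed

text \<open>The parity count sees the geometry only through these facts: \<open>m\<close> will be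
  the push-forward of the divisor of \<open>u\<close>, and \<open>gap_even\<close> records that
  \<open>\<tau>\<close> exchanges the two points over each value in a gap.\<close>

locale divisor_signs =
  fixes m :: "complex \<Rightarrow> int" and n :: nat and r :: "nat \<Rightarrow> real"
  assumes fin: "finite {\<alpha>. m \<alpha> \<noteq> 0}"
    and m_cnj: "\<And>\<alpha>. m (cnj \<alpha>) = m \<alpha>"
    and mono: "strict_mono_on {1..2 * n} r"
    and gap_even: "\<And>k x. k \<in> {1..n} \<Longrightarrow> r (2 * k - 1) < x \<Longrightarrow> x < r (2 * k) \<Longrightarrow> even (m (of_real x))"
    and m_branch: "\<And>k. k \<in> {1..2 * n} \<Longrightarrow> m (of_real (r k)) = 0"
begin

lemma r_less: "i \<in> {1..2 * n} \<Longrightarrow> j \<in> {1..2 * n} \<Longrightarrow> r i < r j \<longleftrightarrow> i < j"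
  by (rule strict_mono_on_less[OF mono])

lemma r_le: "i \<in> {1..2 * n} \<Longrightarrow> j \<in> {1..2 * n} \<Longrightarrow> r i \<le> r j \<longleftrightarrow> i \<le> j"
  using r_less[of j i] by auto

text \<open>For \<open>n > 0\<close> this enumerates \<open>real_intervals\<close> from left to
  right, with the two rays at indices 0 and \<open>n\<close>, so that disjointness and position can
  be read off the index.\<close>

definition interval :: "nat \<Rightarrow> real set" where
  "interval k = (if k = 0 then {..r 1} else if k = n then {r (2 * n)..} else {r (2 * k)..r (2 * k + 1)})"

lemma real_intervals_eq: "n > 0 \<Longrightarrow> real_intervals n r = interval ` {0..n}"
proof -
  assume n: "n > 0"
  have "{0..n} = {0, n} \<union> {1..<n}" by auto
  then have "interval ` {0..n} = {interval 0, interval n} \<union> interval ` {1..<n}"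
    by (simp only: image_Un image_insert image_empty)
  also have "interval ` {1..<n} = (\<lambda>k. {r (2 * k)..r (2 * k + 1)}) ` {1..<n}"
    by (rule image_cong) (auto simp: interval_def)
  also have "\<dots> = {{r (2 * k)..r (2 * k + 1)} |k. 1 \<le> k \<and> k < n}" by auto
  finally show ?thesis using n by (simp add: real_intervals_def interval_def)
qed

lemma interval_bounds:
  assumes "k \<le> n" "x \<in> interval k"
  shows "k > 0 \<Longrightarrow> r (2 * k) \<le> x" "k < n \<Longrightarrow> x \<le> r (2 * k + 1)"
  using assms by (auto simp: interval_def split: if_splits)

lemma interval_disjoint:
  assumes "k \<le> n" "l \<le> n" "x \<in> interval k" "x \<in> interval l"
  shows "k = l"
proof -
  have "\<not> k < l" if "k \<le> n" "l \<le> n" "x \<in> interval k" "x \<in> interval l" for k l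
  proof
    assume "k < l"
    then have "x \<le> r (2 * k + 1)" "r (2 * l) \<le> x"
      using interval_bounds(2)[OF that(1,3)] interval_bounds(1)[OF that(2,4)] that by auto
    moreover have "r (2 * k + 1) < r (2 * l)"
      using r_less[of "2 * k + 1" "2 * l"] \<open>k < l\<close> that(2) by auto
    ultimately show False by simp
  qed
  from this[of k l] this[of l k] assms show ?thesis by force
qed

text \<open>For \<open>x\<close> beyond \<open>r 1\<close> take the last \<open>r j\<close> not
  exceeding \<open>x\<close>: an even \<open>j\<close> puts \<open>x\<close> into the interval that
  begins at \<open>r j\<close>, an odd one into the gap behind it.\<close>

lemma interval_or_gap:
  assumes "n > 0"
  obtains k where "k \<le> n" "x \<in> interval k" | k where "k \<in> {1..n}" "r (2 * k - 1) < x" "x < r (2 * k)"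
proof (cases "x \<le> r 1")
  case True
  then show ?thesis using that(1)[of 0] by (simp add: interval_def)
next
  case False
  define J where "J = {j \<in> {1..2 * n}. r j \<le> x}"
  define j where "j = Max J"
  have J: "finite J" "J \<noteq> {}" using False assms by (auto simp: J_def intro!: exI[of _ 1])
  have jJ: "j \<in> J" unfolding j_def by (rule Max_in[OF J])
  have next_gt: "x < r (Suc j)" if "j < 2 * n"
  proof (rule ccontr)
    assume "\<not> ?thesis"
    then have "Suc j \<in> J" using that by (auto simp: J_def)
    then have "Suc j \<le> j" using J(1) by (auto simp: j_def)
    then show False by simp
  qed
  show ?thesis
  proof (cases "even j")
    case True
    then obtain k where k: "j = 2 * k" by blast
    have kn: "k > 0" "k \<le> n" "r (2 * k) \<le> x" using jJ k by (auto simp: J_def)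
    have "x \<le> r (2 * k + 1)" if "k \<noteq> n" using next_gt k that kn(2) by simp
    then have "x \<in> interval k" using kn by (auto simp: interval_def)
    then show ?thesis using that(1) kn(2) by blast
  next
    case False
    then obtain k0 where k0: "j = 2 * k0 + 1" using oddE by blast
    define k where "k = Suc k0"
    have k: "j = 2 * k - 1" "k \<in> {1..n}" using jJ k0 by (auto simp: J_def k_def)
    have "x < r (2 * k)" using next_gt k0 k by (auto simp: k_def)
    moreover have "r (2 * k - 1) \<le> x" using jJ k by (simp add: J_def)
    \<comment> \<open>Gaps are open, so the left end of a gap counts as the right end of the
      preceding interval.\<close>
    moreover have "x \<in> interval (k - 1)" if eq: "x = r (2 * k - 1)"
    proof (cases "k0 = 0")
      case True
      then show ?thesis using eq by (simp add: interval_def k_def)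
    next
      case False
      then have "r (2 * k0) \<le> r (2 * k0 + 1)" using r_le[of "2 * k0" "2 * k0 + 1"] k(2) by (auto simp: k_def)
      then show ?thesis using eq False k(2) by (auto simp: interval_def k_def)
    qed
    ultimately show ?thesis using that(1)[of "k - 1"] that(2)[of k] k(2) by fastforce
  qed
qed

text \<open>The sum inside \<open>odd_interval\<close>, named so that it can be split
  additively.\<close>

definition mass :: "real set \<Rightarrow> int" where
  "mass X = (\<Sum>\<alpha> | m \<alpha> \<noteq> 0 \<and> \<alpha> \<in> complex_of_real ` X. m \<alpha>)"

lemma mass_union:
  assumes "X \<inter> Y = {}"
  shows "mass (X \<union> Y) = mass X + mass Y"
proof -
  have "{\<alpha>. m \<alpha> \<noteq> 0 \<and> \<alpha> \<in> complex_of_real ` (X \<union> Y)} =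
      {\<alpha>. m \<alpha> \<noteq> 0 \<and> \<alpha> \<in> complex_of_real ` X} \<union> {\<alpha>. m \<alpha> \<noteq> 0 \<and> \<alpha> \<in> complex_of_real ` Y}" by auto
  then show ?thesis
    unfolding mass_def using fin assms by (auto intro!: sum.union_disjoint)
qed

lemma mass_even:
  assumes "\<And>x. x \<in> X \<Longrightarrow> even (m (of_real x))"
  shows "even (mass X)"
  unfolding mass_def by (rule dvd_sum) (use assms in auto)

lemma mass_UN:
  assumes "finite J" "\<And>I I'. I \<in> J \<Longrightarrow> I' \<in> J \<Longrightarrow> I \<noteq> I' \<Longrightarrow> I \<inter> I' = {}"
  shows "mass (\<Union>J) = sum mass J"
  using assms
proof (induction J rule: finite_induct)
  case (insert I J)
  have "mass (I \<union> \<Union>J) = mass I + mass (\<Union>J)"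
    by (rule mass_union) (use insert in blast)
  then show ?case using insert by simp
qed (simp add: mass_def)

text \<open>No interval straddles the end of the half line: those with index below \<open>i\<close>
  end at or before \<open>r (2 * i - 1)\<close>, the others begin strictly beyond it. So the half
  line consists of whole intervals and of points in gaps, and the latter have even
  multiplicity.\<close>

lemma mass_right_parity:
  assumes i: "i \<in> {1..n}"
  shows "even (mass {r (2 * i - 1)<..}) \<longleftrightarrow> even (odd_count m n r i)"
proof -
  define J where "J = {I \<in> real_intervals n r. I \<subseteq> {r (2 * i - 1)<..}}"
  have n: "n > 0" using i by auto
  have J_eq: "J \<subseteq> interval ` {0..n}" by (auto simp: J_def real_intervals_eq[OF n])
  then have finJ: "finite J" using finite_subset by blast
  have disj: "I \<inter> I' = {}" if I: "I \<in> J" "I' \<in> J" "I \<noteq> I'" for I I'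
  proof -
    have "I \<in> interval ` {0..n}" "I' \<in> interval ` {0..n}" using I(1,2) J_eq by blast+
    then obtain k l where "k \<le> n" "I = interval k" "l \<le> n" "I' = interval l" by auto
    then show ?thesis using interval_disjoint[of k l] I(3) by blast
  qed
  have "{r (2 * i - 1)<..} = \<Union>J \<union> ({r (2 * i - 1)<..} - \<Union>J)" by (auto simp: J_def)
  then have "mass {r (2 * i - 1)<..} = mass (\<Union>J) + mass ({r (2 * i - 1)<..} - \<Union>J)"
    using mass_union[of "\<Union>J" "{r (2 * i - 1)<..} - \<Union>J"] by auto
  moreover have "even (mass ({r (2 * i - 1)<..} - \<Union>J))"
  proof (rule mass_even)
    fix x assume x: "x \<in> {r (2 * i - 1)<..} - \<Union>J"
    from n show "even (m (of_real x))"
    proof (cases rule: interval_or_gap[of x])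
      case (1 k)
      have "i \<le> k"
      proof (rule ccontr)
        assume "\<not> i \<le> k"
        then have "x \<le> r (2 * k + 1)" using interval_bounds(2)[OF 1] i by simp
        also have "\<dots> \<le> r (2 * i - 1)"
        proof -
          have "2 * k + 1 \<in> {1..2 * n}" "2 * i - 1 \<in> {1..2 * n}" "2 * k + 1 \<le> 2 * i - 1"
            using i \<open>\<not> i \<le> k\<close> unfolding atLeastAtMost_iff by linarith+
          then show ?thesis using r_le by blast
        qed
        finally show False using x by simp
      qed
      moreover have "r (2 * i - 1) < r (2 * k)"
      proof -
        have "2 * i - 1 \<in> {1..2 * n}" "2 * k \<in> {1..2 * n}" "2 * i - 1 < 2 * k"
          using i \<open>i \<le> k\<close> 1(1) unfolding atLeastAtMost_iff by linarith+
        then show ?thesis using r_less by blast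
      qed
      ultimately have "interval k \<subseteq> {r (2 * i - 1)<..}"
        using interval_bounds(1)[OF 1(1)] i by fastforce
      then have "interval k \<in> J" using 1(1) by (auto simp: J_def real_intervals_eq[OF n])
      with x 1(2) show ?thesis by blast
    next
      case (2 k)
      then show ?thesis using gap_even by blast
    qed
  qed
  moreover have "mass (\<Union>J) = sum mass J" by (rule mass_UN[OF finJ disj])
  moreover have "even (sum mass J) \<longleftrightarrow> even (odd_count m n r i)"
  proof -
    have "{I \<in> J. odd (mass I)} =
        {I \<in> real_intervals n r. odd_interval m I \<and> I \<subseteq> {r (2 * i - 1)<..}}"
      by (auto simp: J_def mass_def odd_interval_def)
    then show ?thesis using even_sum_iff[OF finJ, of mass] by (simp add: odd_count_def)
  qed
  ultimately show ?thesis by simp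
qed

text \<open>Between \<open>r (2 * i - 1)\<close> and \<open>r (2 * i)\<close> there is only a gap,
  and the divisor avoids \<open>r (2 * i)\<close>. Hence the count taken at the odd index also
  governs the even one.\<close>

lemma mass_right_parity':
  assumes i: "i \<in> {1..n}"
  shows "even (mass {r (2 * i)<..}) \<longleftrightarrow> even (odd_count m n r i)"
proof -
  have "2 * i - 1 \<in> {1..2 * n}" "2 * i \<in> {1..2 * n}" "2 * i - 1 < 2 * i"
    using i unfolding atLeastAtMost_iff by linarith+
  then have "r (2 * i - 1) < r (2 * i)" using r_less by blast
  then have "{r (2 * i - 1)<..} = {r (2 * i - 1)<..r (2 * i)} \<union> {r (2 * i)<..}" by auto
  then have "mass {r (2 * i - 1)<..} = mass ({r (2 * i - 1)<..r (2 * i)} \<union> {r (2 * i)<..})"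
    by (rule arg_cong)
  also have "\<dots> = mass {r (2 * i - 1)<..r (2 * i)} + mass {r (2 * i)<..}"
    by (rule mass_union) auto
  finally have "mass {r (2 * i - 1)<..} = mass {r (2 * i - 1)<..r (2 * i)} + mass {r (2 * i)<..}" .
  moreover have "even (mass {r (2 * i - 1)<..r (2 * i)})"
  proof (rule mass_even)
    fix x assume "x \<in> {r (2 * i - 1)<..r (2 * i)}"
    then show "even (m (of_real x))"
      using gap_even[OF i, of x] m_branch[of "2 * i"] i by (cases "x = r (2 * i)") auto
  qed
  ultimately show ?thesis using mass_right_parity[OF i] by simp
qed

text \<open>Nonreal points pair off with equal multiplicities, so the real part of the divisor
  inherits the odd total. Taking away the even first interval leaves an odd amount beyond
  \<open>r 1\<close>.\<close>

lemma odd_count_first: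
  assumes n: "n > 0" and total: "odd (\<Sum>\<alpha> | m \<alpha> \<noteq> 0. m \<alpha>)" and first: "\<not> odd_interval m {..r 1}"
  shows "odd (odd_count m n r 1)"
proof -
  define A where "A = {\<alpha>. m \<alpha> \<noteq> 0}"
  define U where "U = {\<alpha> \<in> A. Im \<alpha> > 0}"
  have finA: "finite A" using fin by (simp add: A_def)
  have R: "{\<alpha> \<in> A. Im \<alpha> = 0} = {\<alpha>. m \<alpha> \<noteq> 0 \<and> \<alpha> \<in> complex_of_real ` UNIV}"
    by (auto simp: A_def complex_is_Real_iff[symmetric] Reals_def)
  have "A = {\<alpha> \<in> A. Im \<alpha> = 0} \<union> (U \<union> cnj ` U)"
    unfolding U_def by (rule split_conj_closed(1)) (simp add: A_def m_cnj)
  then have "sum m A = sum m ({\<alpha> \<in> A. Im \<alpha> = 0} \<union> (U \<union> cnj ` U))"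
    by (rule arg_cong)
  also have "\<dots> = sum m {\<alpha> \<in> A. Im \<alpha> = 0} + sum m (U \<union> cnj ` U)"
    using finA split_conj_closed(2)[of A] m_cnj
    by (intro sum.union_disjoint) (simp_all add: U_def A_def)
  also have "sum m (U \<union> cnj ` U) = sum m U + sum m (cnj ` U)"
    using finA split_conj_closed(3)[of A] m_cnj
    by (intro sum.union_disjoint) (simp_all add: U_def A_def)
  also have "sum m (cnj ` U) = sum m U"
    by (subst sum.reindex) (auto simp: inj_on_def m_cnj)
  also have "sum m {\<alpha> \<in> A. Im \<alpha> = 0} = mass UNIV" by (simp only: R mass_def)
  finally have "odd (mass UNIV)" using total by (simp add: A_def)
  moreover have "mass ({..r 1} \<union> {r 1<..}) = mass {..r 1} + mass {r 1<..}"
    by (rule mass_union) auto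
  moreover have "{..r 1} \<union> {r 1<..} = UNIV" by auto
  moreover have "even (mass {..r 1})" using first by (simp add: odd_interval_def mass_def)
  ultimately have "odd (mass {r 1<..})" by simp
  then show ?thesis using mass_right_parity[of 1] n by simp
qed

text \<open>A real factor is negative exactly if its point lies to the right of \<open>t\<close>
  with odd multiplicity, and the number of odd summands has the parity of the sum.\<close>

lemma divisor_prod_sign:
  assumes "m (of_real t) = 0"
  obtains s where "(\<Prod>\<alpha> | m \<alpha> \<noteq> 0. (of_real t - \<alpha>) powi m \<alpha>) = of_real s" "s \<noteq> 0"
    "s > 0 \<longleftrightarrow> even (mass {t<..})"
proof -
  let ?f = "\<lambda>\<alpha>. (of_real t - \<alpha>) powi m \<alpha>"
  let ?X = "{x. of_real x \<in> {\<alpha>. m \<alpha> \<noteq> 0} \<and> Re (?f (of_real x)) < 0}"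
  have "\<exists>s. prod ?f {\<alpha>. m \<alpha> \<noteq> 0} = of_real s \<and> s \<noteq> 0 \<and> (s > 0 \<longleftrightarrow> even (card ?X))"
    by (rule prod_conj_equivariant[of "{\<alpha>. m \<alpha> \<noteq> 0}" ?f]) (use fin assms in \<open>auto simp: m_cnj\<close>)
  then obtain s where s: "prod ?f {\<alpha>. m \<alpha> \<noteq> 0} = of_real s" "s \<noteq> 0" "s > 0 \<longleftrightarrow> even (card ?X)"
    by blast
  have Re_f: "Re (?f (of_real x)) = (t - x) powi m (of_real x)" for x
  proof -
    have "?f (of_real x) = of_real ((t - x) powi m (of_real x))" by simp
    then show ?thesis by (simp only: Re_complex_of_real)
  qed
  have Xeq: "?X = {x. m (of_real x) \<noteq> 0 \<and> t < x \<and> odd (m (of_real x))}"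
  proof (rule Collect_cong)
    fix x
    show "of_real x \<in> {\<alpha>. m \<alpha> \<noteq> 0} \<and> Re (?f (of_real x)) < 0 \<longleftrightarrow>
        m (of_real x) \<noteq> 0 \<and> t < x \<and> odd (m (of_real x))"
    proof (cases "t = x")
      case False
      then show ?thesis unfolding Re_f by (simp add: power_int_neg_iff)
    qed (use assms in auto)
  qed
  have "complex_of_real ` ?X =
      {\<alpha> \<in> {\<alpha>. m \<alpha> \<noteq> 0 \<and> \<alpha> \<in> complex_of_real ` {t<..}}. odd (m \<alpha>)}"
    unfolding Xeq by auto
  moreover have "card (complex_of_real ` ?X) = card ?X" by (rule card_image) (simp add: inj_on_def)
  moreover have "even (mass {t<..}) \<longleftrightarrow>
      even (card {\<alpha> \<in> {\<alpha>. m \<alpha> \<noteq> 0 \<and> \<alpha> \<in> complex_of_real ` {t<..}}. odd (m \<alpha>)})"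
    unfolding mass_def by (rule even_sum_iff) (use fin in simp)
  ultimately have "even (card ?X) \<longleftrightarrow> even (mass {t<..})" by simp
  with s that show ?thesis by blast
qed

end

section \<open>Normal form of a diagonal pencil\<close>

text \<open>Independence and span in \<open>vfun\<close> refer to a set of vectors, with
  coefficients attached to vectors rather than to indices. Passing between the two needs injectivity
  of \<open>B\<close>, which the trivial kernel yields when tested on the difference of two unit
  coefficient families.\<close>

lemma vfun_basis_of_coordinates:
  fixes B :: "nat \<Rightarrow> 'a \<Rightarrow> 'e \<Rightarrow> complex"
  assumes fin: "finite K"
    and zero: "\<And>c. (\<Sum>k\<in>K. vscale (c k) (B k)) = 0 \<Longrightarrow> \<forall>k\<in>K. c k = 0"
    and V: "V = range (\<lambda>c. \<Sum>k\<in>K. vscale (c k) (B k))"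
  shows "inj_on B K" "vfun.independent (B ` K)" "vfun.span (B ` K) = V"
proof -
  show inj: "inj_on B K"
  proof (rule inj_onI, rule ccontr)
    fix i j assume ij: "i \<in> K" "j \<in> K" "B i = B j" "i \<noteq> j"
    define c :: "nat \<Rightarrow> complex" where "c = (\<lambda>k. (if k = i then 1 else 0) - (if k = j then 1 else 0))"
    have "vscale (c k) (B k) = (if k = i then B k else 0) - (if k = j then B k else 0)" for k
      unfolding c_def vfun.scale_left_diff_distrib by simp
    then have "(\<Sum>k\<in>K. vscale (c k) (B k)) = B i - B j"
      using fin ij(1,2) by (simp add: sum_subtractf)
    then have "c i = 0" using zero[of c] ij(1,3) by simp
    then show False using ij(4) by (simp add: c_def)
  qed
  have "(\<Sum>v\<in>B ` K. vscale (f v) v) = (\<Sum>k\<in>K. vscale (f (B k)) (B k))" for f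
    by (subst sum.reindex[OF inj]) (simp add: o_def)
  note reindex = this
  show "vfun.independent (B ` K)"
  proof
    assume "vfun.dependent (B ` K)"
    then obtain f where f: "\<exists>v\<in>B ` K. f v \<noteq> 0" "(\<Sum>v\<in>B ` K. vscale (f v) v) = 0"
      using vfun.dependent_finite[of "B ` K"] fin by auto
    then show False using zero[of "\<lambda>k. f (B k)"] reindex[of f] by auto
  qed
  have "vfun.span (B ` K) = range (\<lambda>f. \<Sum>v\<in>B ` K. vscale (f v) v)"
    using vfun.span_finite[of "B ` K"] fin by simp
  also have "\<dots> = V"
  proof (intro equalityI subsetI)
    fix v assume "v \<in> V"
    then obtain c where "v = (\<Sum>k\<in>K. vscale (c k) (B k))" unfolding V by blast
    also have "\<dots> = (\<Sum>k\<in>K. vscale (c (the_inv_into K B (B k))) (B k))"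
      by (rule sum.cong) (simp_all add: the_inv_into_f_f[OF inj])
    also have "\<dots> = (\<Sum>v\<in>B ` K. vscale (c (the_inv_into K B v)) v)"
      using reindex[of "\<lambda>v. c (the_inv_into K B v)"] by simp
    finally show "v \<in> range (\<lambda>f. \<Sum>v\<in>B ` K. vscale (f v) v)"
      by (intro image_eqI[of _ _ "\<lambda>v. c (the_inv_into K B v)"]) simp_all
  qed (auto simp: V reindex)
  finally show "vfun.span (B ` K) = V" .
qed

lemma sum_split_three:
  fixes f :: "nat \<Rightarrow> 'b :: comm_monoid_add"
  shows "(\<Sum>k=1..N + 2 * s. f k) = (\<Sum>k=1..N. f k) + (\<Sum>j=1..s. f (N + j)) + (\<Sum>j=1..s. f (N + s + j))"
proof -
  have shift: "(\<Sum>k=M+1..M+s. f k) = (\<Sum>j=1..s. f (M + j))" for M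
    using sum.shift_bounds_cl_nat_ivl[of f 1 M s] by (simp add: add.commute)
  have "(\<Sum>k=1..N + 2 * s. f k) = (\<Sum>k=1..N+s. f k) + (\<Sum>k=N+s+1..N+s+s. f k)"
    using sum.ub_add_nat[of 1 "N+s" f s] by (simp add: mult_2 add.assoc)
  also have "(\<Sum>k=1..N+s. f k) = (\<Sum>k=1..N. f k) + (\<Sum>k=N+1..N+s. f k)"
    using sum.ub_add_nat[of 1 N f s] by simp
  finally show ?thesis unfolding shift .
qed

lemma sum_pairs:
  fixes f :: "nat \<Rightarrow> 'b :: comm_monoid_add"
  shows "(\<Sum>k=1..2 * n. f k) = (\<Sum>i=1..n. f (2 * i - 1) + f (2 * i))"
  by (induction n) (simp_all add: ac_simps)

locale frame_on =
  fixes W :: "'a set" and u :: "'a \<Rightarrow> 'e \<Rightarrow> complex"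
  assumes finW: "finite W" and u_nz: "\<And>p. p \<in> W \<Longrightarrow> u p \<noteq> (\<lambda>e. 0)"
begin

definition comb :: "('a \<Rightarrow> complex) \<Rightarrow> 'a \<Rightarrow> 'e \<Rightarrow> complex" where
  "comb f = (\<lambda>p. if p \<in> W then (\<lambda>e. f p * u p e) else (\<lambda>e. 0))"

lemma comb_eq_iff: "comb f = comb f' \<longleftrightarrow> (\<forall>p\<in>W. f p = f' p)"
proof
  assume eq: "comb f = comb f'"
  show "\<forall>p\<in>W. f p = f' p"
  proof
    fix p assume p: "p \<in> W"
    then obtain e where "u p e \<noteq> 0" using u_nz by fastforce
    moreover have "comb f p e = comb f' p e" using eq by simp
    ultimately show "f p = f' p" using p by (simp add: comb_def)
  qed
qed (auto simp: comb_def)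

lemma comb_add: "comb f + comb f' = comb (\<lambda>p. f p + f' p)"
  by (auto simp: comb_def fun_eq_iff algebra_simps)

lemma comb_scale: "vscale c (comb f) = comb (\<lambda>p. c * f p)"
  by (auto simp: comb_def vscale_def fun_eq_iff)

lemma comb_0: "comb (\<lambda>p. 0) = 0"
  by (auto simp: comb_def fun_eq_iff)

lemma comb_sum: "(\<Sum>k\<in>K. comb (f k)) = comb (\<lambda>p. \<Sum>k\<in>K. f k p)"
  by (induction K rule: infinite_finite_induct) (simp_all add: comb_0 comb_add)

text \<open>The definite description in \<open>diagonal_form\<close> denotes because
  \<open>u w\<close> is not the zero functional, so a multiple of it determines its factor.\<close>

lemma diagonal_form_comb: "diagonal_form W u d (comb f) = (\<Sum>w\<in>W. d w * (f w)\<^sup>2)"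
  unfolding diagonal_form_def
proof (rule sum.cong[OF refl])
  fix w assume w: "w \<in> W"
  have "(THE c. comb f w = (\<lambda>e. c * u w e)) = f w"
  proof (rule the_equality)
    show "comb f w = (\<lambda>e. f w * u w e)" using w by (simp add: comb_def)
    fix c assume c: "comb f w = (\<lambda>e. c * u w e)"
    obtain e where "u w e \<noteq> 0" using u_nz[OF w] by fastforce
    moreover have "f w * u w e = c * u w e" using fun_cong[OF c, of e] w by (simp add: comb_def)
    ultimately show "c = f w" by simp
  qed
  then show "d w * (THE c. comb f w = (\<lambda>e. c * u w e))\<^sup>2 = d w * (f w)\<^sup>2" by simp
qed

text \<open>A conjugate pair of basis vectors \<open>v, v'\<close> on which the form takes the values \<open>c\<close> and
  \<open>cnj c\<close> is replaced by the real vectors \<open>\<mu> v + cnj \<mu> v'\<close> and \<open>- \<i> \<mu> v + \<i> cnj \<mu> v'\<close>, where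
  \<open>\<mu>\<^sup>2 c = 1/2\<close>.\<close>

lemma normal_form:
  fixes P :: "nat \<Rightarrow> 'a" and \<nu> :: "'a \<Rightarrow> 'a" and q t :: "'a \<Rightarrow> complex" and Q r a b :: "nat \<Rightarrow> real"
    and \<epsilon> :: "nat \<Rightarrow> complex"
  assumes P: "bij_betw P {1..2 * n + 2 * s} W"
    and cj: "\<And>f. cj (comb f) = comb (\<lambda>p. cnj (f (\<nu> p)))"
    and \<nu>_real: "\<And>k. k \<in> {1..2 * n} \<Longrightarrow> \<nu> (P k) = P k"
    and \<nu>_pair: "\<And>j. j \<in> {1..s} \<Longrightarrow> \<nu> (P (2 * n + j)) = P (2 * n + s + j)"
      "\<And>j. j \<in> {1..s} \<Longrightarrow> \<nu> (P (2 * n + s + j)) = P (2 * n + j)"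
    and q_real: "\<And>k. k \<in> {1..2 * n} \<Longrightarrow> q (P k) = of_real (Q k)" "\<And>k. k \<in> {1..2 * n} \<Longrightarrow> Q k \<noteq> 0"
    and q_pair: "\<And>j. j \<in> {1..s} \<Longrightarrow> q (P (2 * n + j)) \<noteq> 0"
      "\<And>j. j \<in> {1..s} \<Longrightarrow> q (P (2 * n + s + j)) = cnj (q (P (2 * n + j)))"
    and sign: "\<And>i. i \<in> {1..n} \<Longrightarrow> of_real (sgn (Q (2 * i - 1))) = \<epsilon> i"
      "\<And>i. i \<in> {1..n} \<Longrightarrow> of_real (sgn (Q (2 * i))) = - \<epsilon> i"
    and t_real: "\<And>k. k \<in> {1..2 * n} \<Longrightarrow> t (P k) = of_real (r k)"
    and t_pair: "\<And>j. j \<in> {1..s} \<Longrightarrow> t (P (2 * n + j)) = Complex (a j) (b j)"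
      "\<And>j. j \<in> {1..s} \<Longrightarrow> t (P (2 * n + s + j)) = cnj (Complex (a j) (b j))"
  shows "\<exists>B. inj_on B {1..2 * n + 2 * s} \<and>
           vfun.independent (B ` {1..2 * n + 2 * s}) \<and>
           vfun.span (B ` {1..2 * n + 2 * s}) = range comb \<and>
           (\<forall>k\<in>{1..2 * n + 2 * s}. cj (B k) = B k) \<and>
           (\<forall>(x :: nat \<Rightarrow> complex) (z :: nat \<Rightarrow> complex) (w :: nat \<Rightarrow> complex).
              let v = (\<Sum>i=1..2 * n. vscale (x i) (B i)) +
                      (\<Sum>j=1..s. vscale (z j) (B (2 * n + j))) +
                      (\<Sum>j=1..s. vscale (w j) (B (2 * n + s + j)))
              in diagonal_form W u q v =
                   (\<Sum>i=1..n. \<epsilon> i * ((x (2 * i - 1))\<^sup>2 - (x (2 * i))\<^sup>2)) +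
                   (\<Sum>j=1..s. (z j)\<^sup>2 - (w j)\<^sup>2) \<and>
                 diagonal_form W u (\<lambda>p. t p * q p) v =
                   (\<Sum>i=1..n. \<epsilon> i * (of_real (r (2 * i - 1)) * (x (2 * i - 1))\<^sup>2
                                      - of_real (r (2 * i)) * (x (2 * i))\<^sup>2)) +
                   (\<Sum>j=1..s. of_real (a j) * (z j)\<^sup>2 - of_real (a j) * (w j)\<^sup>2
                               + 2 * of_real (b j) * z j * w j))"
proof -
  let ?K = "{1..2 * n + 2 * s}"
  \<comment> \<open>The factor must be real for the basis vector to be fixed by the involution, so
    it normalises \<open>Q k\<close> only up to sign.\<close>
  define lam where "lam k = complex_of_real (1 / sqrt \<bar>Q k\<bar>)" for k
  \<comment> \<open>The value 1/2 makes the pair contribute \<open>((z - \<i> w)\<^sup>2 + (z + \<i>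
    w)\<^sup>2) / 2 = z\<^sup>2 - w\<^sup>2\<close>; weighting the two squares by
    \<open>a + \<i> b\<close> and \<open>a - \<i> b\<close> produces the cross term
    \<open>2 b z w\<close>. Either square root would do.\<close>
  define \<mu> where "\<mu> j = csqrt (1 / (2 * q (P (2 * n + j))))" for j
  \<comment> \<open>Coordinates of the new basis in the old one. The index blocks belong to the real
    points, to the \<open>z j\<close> and to the \<open>w j\<close>; a shift by \<open>s\<close>
    leads from a point in the upper half plane to its conjugate.\<close>
  define \<beta> where "\<beta> k p =
    (if k \<le> 2 * n then (if p = P k then lam k else 0)
     else if k \<le> 2 * n + s then
       (if p = P k then \<mu> (k - 2 * n) else if p = P (k + s) then cnj (\<mu> (k - 2 * n)) else 0)
     else (if p = P (k - s) then - \<i> * \<mu> (k - 2 * n - s)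
           else if p = P k then \<i> * cnj (\<mu> (k - 2 * n - s)) else 0))" for k p
  define B where "B k = comb (\<beta> k)" for k
  have Peq: "P i = P j \<longleftrightarrow> i = j" if "i \<in> ?K" "j \<in> ?K" for i j
    by (rule inj_on_eq_iff[OF bij_betw_imp_inj_on[OF P] that])
  have lam2: "of_real (Q k) * (lam k)\<^sup>2 = of_real (sgn (Q k))" and lam0: "lam k \<noteq> 0"
    if "k \<in> {1..2 * n}" for k
  proof -
    have "Q k * (1 / sqrt \<bar>Q k\<bar>)\<^sup>2 = sgn (Q k)"
      using q_real(2)[OF that] by (simp add: power_divide sgn_real_def)
    then have "complex_of_real (Q k * (1 / sqrt \<bar>Q k\<bar>)\<^sup>2) = of_real (sgn (Q k))" by simp
    then show "of_real (Q k) * (lam k)\<^sup>2 = of_real (sgn (Q k))"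
      by (simp add: lam_def)
    show "lam k \<noteq> 0" using q_real(2)[OF that] by (simp add: lam_def)
  qed
  have \<mu>2: "q (P (2 * n + j)) * (\<mu> j)\<^sup>2 = 1 / 2" and \<mu>0: "\<mu> j \<noteq> 0" if "j \<in> {1..s}" for j
    using q_pair(1)[OF that] by (simp_all add: \<mu>_def)
  have \<beta>r: "\<beta> i (P m) = (if m = i then lam i else 0)" if "i \<in> {1..2 * n}" "m \<in> ?K" for i m
    using that Peq[of m i] by (auto simp: \<beta>_def)
  have \<beta>z: "\<beta> (2 * n + j) (P m) = (if m = 2 * n + j then \<mu> j else if m = 2 * n + s + j then cnj (\<mu> j) else 0)"
    if "j \<in> {1..s}" "m \<in> ?K" for j m
    using that Peq[of m "2 * n + j"] Peq[of m "2 * n + j + s"] by (auto simp: \<beta>_def ac_simps)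
  have \<beta>w: "\<beta> (2 * n + s + j) (P m) =
      (if m = 2 * n + j then - \<i> * \<mu> j else if m = 2 * n + s + j then \<i> * cnj (\<mu> j) else 0)"
    if "j \<in> {1..s}" "m \<in> ?K" for j m
    using that Peq[of m "2 * n + j"] Peq[of m "2 * n + s + j"] by (auto simp: \<beta>_def)
  define F where "F x z w p = (\<Sum>i=1..2 * n. x i * \<beta> i p) + (\<Sum>j=1..s. z j * \<beta> (2 * n + j) p) +
      (\<Sum>j=1..s. w j * \<beta> (2 * n + s + j) p)" for x z w p
  have v_eq: "(\<Sum>i=1..2 * n. vscale (x i) (B i)) + (\<Sum>j=1..s. vscale (z j) (B (2 * n + j))) +
      (\<Sum>j=1..s. vscale (w j) (B (2 * n + s + j))) = comb (F x z w)" for x z w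
    by (simp add: B_def comb_scale comb_sum comb_add F_def[abs_def])
  have F_real: "F x z w (P m) = lam m * x m" if m: "m \<in> {1..2 * n}" for x z w m
  proof -
    have mK: "m \<in> ?K" using m by auto
    have "(\<Sum>i=1..2 * n. x i * \<beta> i (P m)) = (\<Sum>i=1..2 * n. if i = m then x i * lam i else 0)"
      by (rule sum.cong) (use \<beta>r mK in auto)
    also have "\<dots> = lam m * x m" using m by simp
    finally have 1: "(\<Sum>i=1..2 * n. x i * \<beta> i (P m)) = lam m * x m" .
    have 2: "(\<Sum>j=1..s. z j * \<beta> (2 * n + j) (P m)) = 0"
      by (rule sum.neutral) (use \<beta>z mK m in auto)
    have 3: "(\<Sum>j=1..s. w j * \<beta> (2 * n + s + j) (P m)) = 0"
      by (rule sum.neutral) (use \<beta>w mK m in auto)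
    show ?thesis unfolding F_def 1 2 3 by simp
  qed
  have F_up: "F x z w (P (2 * n + l)) = \<mu> l * (z l - \<i> * w l)" if l: "l \<in> {1..s}" for x z w l
  proof -
    have mK: "2 * n + l \<in> ?K" using l by auto
    have 1: "(\<Sum>i=1..2 * n. x i * \<beta> i (P (2 * n + l))) = 0"
      by (rule sum.neutral) (use \<beta>r mK l in auto)
    have "(\<Sum>j=1..s. z j * \<beta> (2 * n + j) (P (2 * n + l))) = (\<Sum>j=1..s. if j = l then z j * \<mu> j else 0)"
      by (rule sum.cong) (use \<beta>z mK l in auto)
    also have "\<dots> = z l * \<mu> l" using l by simp
    finally have 2: "(\<Sum>j=1..s. z j * \<beta> (2 * n + j) (P (2 * n + l))) = z l * \<mu> l" .
    have "(\<Sum>j=1..s. w j * \<beta> (2 * n + s + j) (P (2 * n + l))) =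
        (\<Sum>j=1..s. if j = l then w j * (- \<i> * \<mu> j) else 0)"
      by (rule sum.cong) (use \<beta>w mK l in auto)
    also have "\<dots> = w l * (- \<i> * \<mu> l)" using l by simp
    finally have 3: "(\<Sum>j=1..s. w j * \<beta> (2 * n + s + j) (P (2 * n + l))) = w l * (- \<i> * \<mu> l)" .
    show ?thesis unfolding F_def 1 2 3 by (simp add: algebra_simps)
  qed
  have F_down: "F x z w (P (2 * n + s + l)) = cnj (\<mu> l) * (z l + \<i> * w l)" if l: "l \<in> {1..s}" for x z w l
  proof -
    have mK: "2 * n + s + l \<in> ?K" using l by auto
    have 1: "(\<Sum>i=1..2 * n. x i * \<beta> i (P (2 * n + s + l))) = 0"
      by (rule sum.neutral) (use \<beta>r mK l in auto)
    have "(\<Sum>j=1..s. z j * \<beta> (2 * n + j) (P (2 * n + s + l))) =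
        (\<Sum>j=1..s. if j = l then z j * cnj (\<mu> j) else 0)"
      by (rule sum.cong) (use \<beta>z mK l in auto)
    also have "\<dots> = z l * cnj (\<mu> l)" using l by simp
    finally have 2: "(\<Sum>j=1..s. z j * \<beta> (2 * n + j) (P (2 * n + s + l))) = z l * cnj (\<mu> l)" .
    have "(\<Sum>j=1..s. w j * \<beta> (2 * n + s + j) (P (2 * n + s + l))) =
        (\<Sum>j=1..s. if j = l then w j * (\<i> * cnj (\<mu> j)) else 0)"
      by (rule sum.cong) (use \<beta>w mK l in auto)
    also have "\<dots> = w l * (\<i> * cnj (\<mu> l))" using l by simp
    finally have 3: "(\<Sum>j=1..s. w j * \<beta> (2 * n + s + j) (P (2 * n + s + l))) = w l * (\<i> * cnj (\<mu> l))" .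
    show ?thesis unfolding F_def 1 2 3 by (simp add: algebra_simps)
  qed
  have K_cases: "k \<in> {1..2 * n} \<or> (\<exists>j\<in>{1..s}. k = 2 * n + j) \<or> (\<exists>j\<in>{1..s}. k = 2 * n + s + j)"
    if k: "k \<in> ?K" for k
  proof -
    consider "k \<le> 2 * n" | "2 * n < k" "k \<le> 2 * n + s" | "2 * n + s < k" by linarith
    then show ?thesis
    proof cases
      case 2
      then have "k - 2 * n \<in> {1..s}" "k = 2 * n + (k - 2 * n)" by auto
      then show ?thesis by blast
    next
      case 3
      then have "k - (2 * n + s) \<in> {1..s}" "k = 2 * n + s + (k - (2 * n + s))" using k by auto
      then show ?thesis by blast
    qed (use k in auto)
  qed
  have W_cases: "(\<exists>k\<in>{1..2 * n}. p = P k) \<or> (\<exists>j\<in>{1..s}. p = P (2 * n + j)) \<or>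
      (\<exists>j\<in>{1..s}. p = P (2 * n + s + j))" if p: "p \<in> W" for p
  proof -
    obtain k where "k \<in> ?K" "p = P k" using P p by (auto simp: bij_betw_def)
    then show ?thesis using K_cases[of k] by blast
  qed
  have inK: "k \<in> {1..2 * n} \<Longrightarrow> P k \<in> W" "j \<in> {1..s} \<Longrightarrow> P (2 * n + j) \<in> W"
    "j \<in> {1..s} \<Longrightarrow> P (2 * n + s + j) \<in> W" for k j
    by (auto intro!: bij_betwE[OF P, rule_format])
  have sum_eq: "(\<Sum>k\<in>?K. vscale (c k) (B k)) =
      comb (F c (\<lambda>j. c (2 * n + j)) (\<lambda>j. c (2 * n + s + j)))" for c
    unfolding sum_split_three[of _ "2 * n" s] by (rule v_eq)
  have zero: "\<forall>k\<in>?K. c k = 0" if "(\<Sum>k\<in>?K. vscale (c k) (B k)) = 0" for c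
  proof -
    have "comb (F c (\<lambda>j. c (2 * n + j)) (\<lambda>j. c (2 * n + s + j))) = comb (\<lambda>p. 0)"
      using that unfolding sum_eq comb_0 .
    then have F0: "F c (\<lambda>j. c (2 * n + j)) (\<lambda>j. c (2 * n + s + j)) p = 0" if "p \<in> W" for p
      using that unfolding comb_eq_iff by blast
    have "c k = 0" if k: "k \<in> {1..2 * n}" for k
      using F0[OF inK(1)[OF k]] lam0[OF k] F_real[OF k] by simp
    moreover have "c (2 * n + j) = 0 \<and> c (2 * n + s + j) = 0" if j: "j \<in> {1..s}" for j
    proof -
      have 1: "c (2 * n + j) - \<i> * c (2 * n + s + j) = 0"
        using F0[OF inK(2)[OF j]] \<mu>0[OF j] F_up[OF j] by simp
      have 2: "c (2 * n + j) + \<i> * c (2 * n + s + j) = 0"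
        using F0[OF inK(3)[OF j]] \<mu>0[OF j] F_down[OF j] by simp
      have "2 * c (2 * n + j) = (c (2 * n + j) - \<i> * c (2 * n + s + j)) + (c (2 * n + j) + \<i> * c (2 * n + s + j))"
        by simp
      then have "c (2 * n + j) = 0" unfolding 1 2 by simp
      then show ?thesis using 2 by simp
    qed
    ultimately show ?thesis using K_cases by blast
  qed
  have range: "range comb = range (\<lambda>c. \<Sum>k\<in>?K. vscale (c k) (B k))"
  proof (intro equalityI subsetI)
    fix v assume "v \<in> range comb"
    then obtain f where v: "v = comb f" by blast
    \<comment> \<open>Surjectivity amounts to solving \<open>z - \<i> w = d1\<close> and
      \<open>z + \<i> w = d2\<close>, where \<open>d1\<close> and \<open>d2\<close> are the
      prescribed coordinates at the two points of the pair after removing the scaling.\<close>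
    define d1 where "d1 j = f (P (2 * n + j)) / \<mu> j" for j
    define d2 where "d2 j = f (P (2 * n + s + j)) / cnj (\<mu> j)" for j
    define x where "x k = f (P k) / lam k" for k
    define z where "z j = (d1 j + d2 j) / 2" for j
    define w where "w j = \<i> * (d1 j - d2 j) / 2" for j
    define c where "c k = (if k \<le> 2 * n then x k else if k \<le> 2 * n + s then z (k - 2 * n)
        else w (k - (2 * n + s)))" for k
    have zw: "z j - \<i> * w j = d1 j" "z j + \<i> * w j = d2 j" for j
      by (simp_all add: z_def w_def field_simps)
    have "F c (\<lambda>j. c (2 * n + j)) (\<lambda>j. c (2 * n + s + j)) p = f p" if p: "p \<in> W" for p
    proof -
      consider k where "k \<in> {1..2 * n}" "p = P k" | j where "j \<in> {1..s}" "p = P (2 * n + j)"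
        | j where "j \<in> {1..s}" "p = P (2 * n + s + j)" using W_cases[OF p] by blast
      then show ?thesis
      proof cases
        case 1
        then show ?thesis using F_real[OF 1(1)] lam0[OF 1(1)] by (simp add: c_def x_def)
      next
        case 2
        then have "c (2 * n + j) = z j" "c (2 * n + s + j) = w j" by (auto simp: c_def)
        then show ?thesis using F_up[OF 2(1)] \<mu>0[OF 2(1)] 2(2) zw(1)[of j] by (simp add: d1_def)
      next
        case 3
        then have "c (2 * n + j) = z j" "c (2 * n + s + j) = w j" by (auto simp: c_def)
        then show ?thesis using F_down[OF 3(1)] \<mu>0[OF 3(1)] 3(2) zw(2)[of j] by (simp add: d2_def)
      qed
    qed
    then have "comb f = comb (F c (\<lambda>j. c (2 * n + j)) (\<lambda>j. c (2 * n + s + j)))"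
      unfolding comb_eq_iff by simp
    then show "v \<in> range (\<lambda>c. \<Sum>k\<in>?K. vscale (c k) (B k))" unfolding v sum_eq by blast
  next
    fix v assume "v \<in> range (\<lambda>c. \<Sum>k\<in>?K. vscale (c k) (B k))"
    then show "v \<in> range comb" unfolding sum_eq by blast
  qed
  note basis = vfun_basis_of_coordinates[OF finite_atLeastAtMost zero range]
  have real: "cnj (\<beta> k (\<nu> p)) = \<beta> k p" if k: "k \<in> ?K" and p: "p \<in> W" for k p
  proof -
    have \<beta>_cases: "cnj (\<beta> k (P m')) = \<beta> k (P m)"
      if m: "m \<in> ?K" "m' \<in> ?K" and
        mm: "(m \<in> {1..2 * n} \<and> m' = m) \<or> (\<exists>l\<in>{1..s}. m = 2 * n + l \<and> m' = 2 * n + s + l) \<or>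
             (\<exists>l\<in>{1..s}. m = 2 * n + s + l \<and> m' = 2 * n + l)" for m m'
    proof -
      consider "k \<in> {1..2 * n}" | j where "j \<in> {1..s}" "k = 2 * n + j"
        | j where "j \<in> {1..s}" "k = 2 * n + s + j" using K_cases[OF k] by blast
      then show ?thesis
      proof cases
        case 1
        then show ?thesis using mm unfolding \<beta>r[OF 1 m(1)] \<beta>r[OF 1 m(2)] by (auto simp: lam_def)
      next
        case 2
        show ?thesis using mm 2 unfolding 2(2) \<beta>z[OF 2(1) m(1)] \<beta>z[OF 2(1) m(2)] by auto
      next
        case 3
        show ?thesis using mm 3 unfolding 3(2) \<beta>w[OF 3(1) m(1)] \<beta>w[OF 3(1) m(2)] by auto
      qed
    qed
    consider m where "m \<in> {1..2 * n}" "p = P m" | j where "j \<in> {1..s}" "p = P (2 * n + j)"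
      | j where "j \<in> {1..s}" "p = P (2 * n + s + j)" using W_cases[OF p] by blast
    then show ?thesis
    proof cases
      case 1
      then show ?thesis using \<beta>_cases[of m m] \<nu>_real by auto
    next
      case 2
      then show ?thesis using \<beta>_cases[of "2 * n + j" "2 * n + s + j"] \<nu>_pair by auto
    next
      case 3
      then show ?thesis using \<beta>_cases[of "2 * n + s + j" "2 * n + j"] \<nu>_pair by auto
    qed
  qed
  have diag: "diagonal_form W u d (comb f) = (\<Sum>i=1..n. d (P (2 * i - 1)) * (f (P (2 * i - 1)))\<^sup>2 +
        d (P (2 * i)) * (f (P (2 * i)))\<^sup>2) +
      (\<Sum>j=1..s. d (P (2 * n + j)) * (f (P (2 * n + j)))\<^sup>2 +
        d (P (2 * n + s + j)) * (f (P (2 * n + s + j)))\<^sup>2)" for d f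
  proof -
    have "diagonal_form W u d (comb f) = (\<Sum>k\<in>?K. d (P k) * (f (P k))\<^sup>2)"
      unfolding diagonal_form_comb by (rule sum.reindex_bij_betw[OF P, symmetric])
    then show ?thesis
      unfolding sum_split_three[of _ "2 * n" s] sum_pairs by (simp add: sum.distrib add.assoc)
  qed
  have real_term: "c * (of_real (Q k)) * (lam k * y)\<^sup>2 = of_real (sgn (Q k)) * (c * y\<^sup>2)"
    if "k \<in> {1..2 * n}" for k c y
    using lam2[OF that] by (simp add: power_mult_distrib algebra_simps)
  have pair_term: "c * q (P (2 * n + j)) * (\<mu> j * y)\<^sup>2 + cnj c * cnj (q (P (2 * n + j))) * (cnj (\<mu> j) * y')\<^sup>2
      = (c * y\<^sup>2 + cnj c * y'\<^sup>2) / 2" if "j \<in> {1..s}" for j c y y'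
  proof -
    have "cnj (q (P (2 * n + j))) * (cnj (\<mu> j))\<^sup>2 = cnj (q (P (2 * n + j)) * (\<mu> j)\<^sup>2)" by simp
    then have 2: "cnj (q (P (2 * n + j))) * (cnj (\<mu> j))\<^sup>2 = 1 / 2" unfolding \<mu>2[OF that] by simp
    have "c * q (P (2 * n + j)) * (\<mu> j * y)\<^sup>2 + cnj c * cnj (q (P (2 * n + j))) * (cnj (\<mu> j) * y')\<^sup>2 =
        c * (q (P (2 * n + j)) * (\<mu> j)\<^sup>2) * y\<^sup>2 + cnj c * (cnj (q (P (2 * n + j))) * (cnj (\<mu> j))\<^sup>2) * y'\<^sup>2"
      by (simp add: power_mult_distrib algebra_simps)
    then show ?thesis unfolding \<mu>2[OF that] 2 by (simp add: field_simps)
  qed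
  have idx: "2 * i - 1 \<in> {1..2 * n}" "2 * i \<in> {1..2 * n}" if "i \<in> {1..n}" for i
    using that unfolding atLeastAtMost_iff by linarith+
  \<comment> \<open>Both forms at once: the weight \<open>c\<close> is 1 for the first and the
    coordinate \<open>t\<close> for the second. At a conjugate pair only conjugate values of the
    weight are required.\<close>
  have form: "diagonal_form W u (\<lambda>p. c p * q p) (comb (F x z w)) =
      (\<Sum>i=1..n. \<epsilon> i * (c (P (2 * i - 1)) * (x (2 * i - 1))\<^sup>2 - c (P (2 * i)) * (x (2 * i))\<^sup>2)) +
      (\<Sum>j=1..s. (c (P (2 * n + j)) * (z j - \<i> * w j)\<^sup>2 + cnj (c (P (2 * n + j))) * (z j + \<i> * w j)\<^sup>2) / 2)"
    if c: "\<And>j. j \<in> {1..s} \<Longrightarrow> c (P (2 * n + s + j)) = cnj (c (P (2 * n + j)))" for c x z w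
    unfolding diag
  proof (intro arg_cong2[of _ _ _ _ "(+)"] sum.cong refl, goal_cases)
    case (1 i)
    show ?case
      unfolding F_real[OF idx(1)[OF 1]] F_real[OF idx(2)[OF 1]] q_real(1)[OF idx(1)[OF 1]]
        q_real(1)[OF idx(2)[OF 1]] real_term[OF idx(1)[OF 1]] real_term[OF idx(2)[OF 1]] sign[OF 1]
      by (simp add: algebra_simps)
  next
    case (2 j)
    show ?case
      unfolding F_up[OF 2] F_down[OF 2] q_pair(2)[OF 2] c[OF 2] by (rule pair_term[OF 2])
  qed
  have form0: "diagonal_form W u q (comb (F x z w)) =
                   (\<Sum>i=1..n. \<epsilon> i * ((x (2 * i - 1))\<^sup>2 - (x (2 * i))\<^sup>2)) +
                   (\<Sum>j=1..s. (z j)\<^sup>2 - (w j)\<^sup>2)" for x z w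
  proof -
    have pt: "((z j - \<i> * w j)\<^sup>2 + (z j + \<i> * w j)\<^sup>2) / 2 = (z j)\<^sup>2 - (w j)\<^sup>2" for j
      by (simp add: power2_eq_square field_simps)
    have "1 = cnj 1" by simp
    from form[of "\<lambda>p. 1" x z w, OF this] show ?thesis
      by (simp only: mult_1 complex_cnj_one pt)
  qed
  have form1: "diagonal_form W u (\<lambda>p. t p * q p) (comb (F x z w)) =
                   (\<Sum>i=1..n. \<epsilon> i * (of_real (r (2 * i - 1)) * (x (2 * i - 1))\<^sup>2
                                      - of_real (r (2 * i)) * (x (2 * i))\<^sup>2)) +
                   (\<Sum>j=1..s. of_real (a j) * (z j)\<^sup>2 - of_real (a j) * (w j)\<^sup>2
                               + 2 * of_real (b j) * z j * w j)" for x z w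
  proof -
    have pt: "(Complex (a j) (b j) * (z j - \<i> * w j)\<^sup>2 + cnj (Complex (a j) (b j)) * (z j + \<i> * w j)\<^sup>2) / 2 =
        of_real (a j) * (z j)\<^sup>2 - of_real (a j) * (w j)\<^sup>2 + 2 * of_real (b j) * z j * w j" for j
    proof -
      have C: "Complex (a j) (b j) = of_real (a j) + \<i> * of_real (b j)"
        "cnj (Complex (a j) (b j)) = of_real (a j) - \<i> * of_real (b j)"
        by (simp_all add: complex_eq_iff)
      show ?thesis
        unfolding C by (simp add: power2_eq_square field_simps)
    qed
    have "t (P (2 * n + s + j)) = cnj (t (P (2 * n + j)))" if "j \<in> {1..s}" for j
      using t_pair that by simp
    from form[of t, OF this] have "diagonal_form W u (\<lambda>p. t p * q p) (comb (F x z w)) =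
      (\<Sum>i=1..n. \<epsilon> i * (t (P (2 * i - 1)) * (x (2 * i - 1))\<^sup>2 - t (P (2 * i)) * (x (2 * i))\<^sup>2)) +
      (\<Sum>j=1..s. (t (P (2 * n + j)) * (z j - \<i> * w j)\<^sup>2 + cnj (t (P (2 * n + j))) * (z j + \<i> * w j)\<^sup>2) / 2)"
      by blast
    also have "\<dots> = (\<Sum>i=1..n. \<epsilon> i * (of_real (r (2 * i - 1)) * (x (2 * i - 1))\<^sup>2
                                      - of_real (r (2 * i)) * (x (2 * i))\<^sup>2)) +
                   (\<Sum>j=1..s. of_real (a j) * (z j)\<^sup>2 - of_real (a j) * (w j)\<^sup>2
                               + 2 * of_real (b j) * z j * w j)"
      by (intro arg_cong2[of _ _ _ _ "(+)"] sum.cong refl)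
         (simp_all only: t_real[OF idx(1)] t_real[OF idx(2)] t_pair(1) pt)
    finally show ?thesis .
  qed
  show ?thesis
  proof (intro exI[of _ B] conjI ballI allI)
    show "inj_on B ?K" by (rule basis(1))
    show "vfun.independent (B ` ?K)" by (rule basis(2))
    show "vfun.span (B ` ?K) = range comb" by (rule basis(3))
    show "cj (B k) = B k" if "k \<in> ?K" for k
      unfolding B_def cj comb_eq_iff using real[OF that] by blast
  qed (simp only: Let_def v_eq form0 form1 simp_thms)
qed

end

section \<open>The pencil of a real section\<close>

locale real_section = real_hyp_curve S \<pi> \<tau> g + real_line_bundle S \<xi> \<tau> \<sigma>
  for S :: "'a surface" and \<pi> :: "'a \<Rightarrow> complex option" and \<tau> :: "'a \<Rightarrow> 'a" and g :: nat
    and \<xi> :: "('a, 'e) line_bundle" and \<sigma> :: "'a \<Rightarrow> 'e \<Rightarrow> 'e" +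
  fixes u :: "'a \<Rightarrow> 'e \<Rightarrow> complex"
  assumes infinity_unbranched: "None \<notin> branch_points S \<pi>"
    and degree: "has_degree S \<xi> (2 * int g + 1)"
    and u_mero: "meromorphic_section S (dual_bundle \<xi>) u"
    and u_nonzero: "nonzero_section S (dual_bundle \<xi>) u"
    and u_real: "\<And>p. p \<in> points S \<Longrightarrow> u (\<tau> p) = dual_real_structure \<tau> \<xi> \<sigma> p (u p)"
    and u_regular: "\<And>p. p \<in> points S \<Longrightarrow> \<pi> p \<in> insert None (branch_points S \<pi>) \<Longrightarrow>
          section_ord S (dual_bundle \<xi>) u p = 0"
    and finite_branch: "finite (branch_points S \<pi>)"
begin

sublocale D: holo_line_bundle S "dual_bundle \<xi>"
  by (rule dual)

abbreviation ord_u :: "'a \<Rightarrow> int" where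
  "ord_u \<equiv> section_ord S (dual_bundle \<xi>) u"

section \<open>The push-forward of the divisor of the section\<close>

definition mult :: "complex \<Rightarrow> int" where
  "mult = pushforward_mult S \<pi> (dual_bundle \<xi>) u"

lemma mult_fib: "mult \<alpha> = (\<Sum>p\<in>fib (Some \<alpha>). ord_u p)"
  by (simp add: mult_def pushforward_mult_def fib_def)

lemma ord_u_\<tau>: "p \<in> points S \<Longrightarrow> ord_u (\<tau> p) = ord_u p"
  by (rule section_ord_conj[OF u_mero u_nonzero u_real])

text \<open>\<open>\<tau>\<close> carries the fibre over \<open>\<alpha>\<close> bijectively to the
  fibre over its conjugate and preserves the orders of the invariant section.\<close>

lemma mult_cnj: "mult (cnj \<alpha>) = mult \<alpha>"
proof -
  have "mult (cnj \<alpha>) = (\<Sum>p\<in>fib (Some \<alpha>). ord_u (\<tau> p))"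
    unfolding mult_fib using sum.reindex_bij_betw[OF \<tau>_fib[of "Some \<alpha>"], of ord_u] by simp
  also have "\<dots> = mult \<alpha>"
    unfolding mult_fib by (rule sum.cong) (auto simp: fib_def ord_u_\<tau>)
  finally show ?thesis .
qed

lemma mult_branch: "Some \<alpha> \<in> branch_points S \<pi> \<Longrightarrow> mult \<alpha> = 0"
  unfolding mult_fib by (rule sum.neutral) (auto simp: fib_def u_regular)

lemma mult_even:
  assumes "Some (of_real x) \<notin> branch_points S \<pi>" "\<not> real_over x"
  shows "even (mult (of_real x))"
proof -
  let ?q = "Some (complex_of_real x)"
  have card: "card (fib ?q) = 2" by (rule fib_unbranched(1)[OF assms(1)])
  then obtain p where p: "p \<in> fib ?q" by (metis card.empty equals0I zero_neq_numeral)
  have \<tau>p: "\<tau> p \<noteq> p" using fixed_iff[OF assms(1) _ p] assms(2) by (simp add: real_over_def)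
  have "\<tau> p \<in> fib ?q" using bij_betwE[OF \<tau>_fib[of ?q]] p by simp
  then have "{p, \<tau> p} \<subseteq> fib ?q" using p by simp
  then have "fib ?q = {p, \<tau> p}"
    using card_subset_eq[OF fib_finite, of "{p, \<tau> p}" ?q] card \<tau>p by auto
  then have "mult (of_real x) = ord_u p + ord_u (\<tau> p)" unfolding mult_fib using \<tau>p by simp
  also have "ord_u (\<tau> p) = ord_u p" using ord_u_\<tau> p by (simp add: fib_def)
  finally show ?thesis by simp
qed

text \<open>Finiteness comes from the degree: a sum over an infinite set is 0 by convention, whereas
  this one is odd.\<close>

lemma divisor_finite: "finite {p \<in> points S. ord_u p \<noteq> 0}"
  and divisor_sum: "(\<Sum>p | p \<in> points S \<and> ord_u p \<noteq> 0. ord_u p) = - (2 * int g + 1)"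
proof -
  show *: "(\<Sum>p | p \<in> points S \<and> ord_u p \<noteq> 0. ord_u p) = - (2 * int g + 1)"
    by (rule dual_section_degree[OF u_mero u_nonzero degree])
  show "finite {p \<in> points S. ord_u p \<noteq> 0}"
  proof (rule ccontr)
    assume "infinite {p \<in> points S. ord_u p \<noteq> 0}"
    then have "(\<Sum>p | p \<in> points S \<and> ord_u p \<noteq> 0. ord_u p) = 0" by (rule sum.infinite)
    then show False using * by simp
  qed
qed

lemma mult_support: "{\<alpha>. mult \<alpha> \<noteq> 0} \<subseteq> (\<lambda>p. the (\<pi> p)) ` {p \<in> points S. ord_u p \<noteq> 0}"
proof
  fix \<alpha> assume "\<alpha> \<in> {\<alpha>. mult \<alpha> \<noteq> 0}"
  then have "(\<Sum>p\<in>fib (Some \<alpha>). ord_u p) \<noteq> 0" by (simp add: mult_fib)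
  then obtain p where "p \<in> fib (Some \<alpha>)" "ord_u p \<noteq> 0" by (meson sum.neutral)
  then show "\<alpha> \<in> (\<lambda>p. the (\<pi> p)) ` {p \<in> points S. ord_u p \<noteq> 0}"
    by (intro image_eqI[of _ _ p]) (auto simp: fib_def)
qed

lemma mult_finite: "finite {\<alpha>. mult \<alpha> \<noteq> 0}"
  using mult_support divisor_finite finite_surj by blast

text \<open>No point of the divisor lies over infinity, so pushing forward to the affine line loses
  nothing of the degree \<open>- (2 * g + 1)\<close>.\<close>

lemma mult_sum_odd: "odd (\<Sum>\<alpha> | mult \<alpha> \<noteq> 0. mult \<alpha>)"
proof -
  let ?Z = "{p \<in> points S. ord_u p \<noteq> 0}" and ?t = "\<lambda>p. the (\<pi> p)"
  have Some: "\<pi> p = Some (?t p)" if "p \<in> ?Z" for p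
    using u_regular[of p] that by (cases "\<pi> p") auto
  have "(\<Sum>\<alpha> | mult \<alpha> \<noteq> 0. mult \<alpha>) = (\<Sum>\<alpha>\<in>?t ` ?Z. mult \<alpha>)"
    by (rule sum.mono_neutral_left) (use mult_support divisor_finite in auto)
  also have "\<dots> = (\<Sum>\<alpha>\<in>?t ` ?Z. \<Sum>p | p \<in> ?Z \<and> ?t p = \<alpha>. ord_u p)"
  proof (rule sum.cong[OF refl])
    fix \<alpha>
    show "mult \<alpha> = (\<Sum>p | p \<in> ?Z \<and> ?t p = \<alpha>. ord_u p)"
      unfolding mult_fib
      by (rule sum.mono_neutral_right[OF fib_finite]) (use Some in \<open>auto simp: fib_def\<close>)
  qed
  also have "\<dots> = (\<Sum>p\<in>?Z. ord_u p)"
    by (rule sum.image_gen[OF divisor_finite, symmetric])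
  finally show ?thesis using divisor_sum by simp
qed

section \<open>The basis of V and the values of the forms on it\<close>

abbreviation W :: "'a set" where
  "W \<equiv> weierstrass S \<pi>"

abbreviation aff :: "'a \<Rightarrow> complex" where
  "aff p \<equiv> the (\<pi> p)"

lemma W_finite: "finite W"
  using finite_branch weierstrass_inj unfolding branch_points_def by (rule finite_imageD)

lemma W_points: "p \<in> W \<Longrightarrow> p \<in> points S"
  by (simp add: weierstrass_def)

lemma W_Some: "p \<in> W \<Longrightarrow> \<pi> p = Some (aff p)"
  using infinity_unbranched by (cases "\<pi> p") (auto simp: branch_points_def image_iff)

lemma aff_bij: "bij_betw aff W {z. Some z \<in> branch_points S \<pi>}"
proof (rule bij_betw_imageI)
  show "inj_on aff W"
    using weierstrass_inj W_Some unfolding inj_on_def by metis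
  show "aff ` W = {z. Some z \<in> branch_points S \<pi>}"
  proof (intro equalityI subsetI)
    fix z assume "z \<in> {z. Some z \<in> branch_points S \<pi>}"
    then obtain p where "p \<in> W" "Some z = \<pi> p" unfolding branch_points_def by blast
    then show "z \<in> aff ` W" by (intro image_eqI[of _ _ p]) (simp_all flip: \<open>Some z = \<pi> p\<close>)
  next
    fix z assume "z \<in> aff ` W"
    then obtain p where "p \<in> W" "z = aff p" by blast
    then show "z \<in> {z. Some z \<in> branch_points S \<pi>}"
      using W_Some[of p] unfolding branch_points_def by (auto intro: image_eqI[of _ _ p])
  qed
qed

lemma aff_\<tau>: "p \<in> W \<Longrightarrow> aff (\<tau> p) = cnj (aff p)"
  using \<pi>_conj[OF W_points] W_Some by (metis option.map_sel option.distinct(1))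

lemma u_W_nonzero: "p \<in> W \<Longrightarrow> u p \<noteq> (\<lambda>e. 0)"
proof -
  assume p: "p \<in> W"
  have "ord_u p = 0" using u_regular p by (auto simp: weierstrass_iff)
  from D.section_nonzero_if_ord_0[OF u_mero u_nonzero W_points[OF p] this]
  show ?thesis by (auto simp: dual_bundle_def)
qed

text \<open>Replacing Weierstrass points by their coordinates puts both products over sets of
  complex numbers, where conjugation can act on the index.\<close>

lemma Q0_coeff_eq:
  "w \<in> W \<Longrightarrow> Q0_coeff S \<pi> \<xi> u w = (\<Prod>\<alpha> | mult \<alpha> \<noteq> 0. (aff w - \<alpha>) powi mult \<alpha>) *
     (\<Prod>z\<in>{z. Some z \<in> branch_points S \<pi>} - {aff w}. aff w - z)"
proof -
  assume w: "w \<in> W"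
  have "bij_betw aff (W - {w}) ({z. Some z \<in> branch_points S \<pi>} - {aff w})"
    using bij_betw_DiffI[OF aff_bij, of "{w}" "{aff w}"] w bij_betwE[OF aff_bij]
    by (simp add: bij_betw_def)
  from prod.reindex_bij_betw[OF this, of "\<lambda>z. aff w - z"] show ?thesis
    by (simp add: Q0_coeff_def Let_def mult_def)
qed

lemma Q0_coeff_nonzero:
  assumes w: "w \<in> W"
  shows "Q0_coeff S \<pi> \<xi> u w \<noteq> 0"
proof -
  have "Some (aff w) \<in> branch_points S \<pi>" using W_Some[OF w] w weierstrass_iff by metis
  then have "mult (aff w) = 0" by (rule mult_branch)
  then have "(\<Prod>\<alpha> | mult \<alpha> \<noteq> 0. (aff w - \<alpha>) powi mult \<alpha>) \<noteq> 0"
    using mult_finite by auto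
  moreover have "finite {z. Some z \<in> branch_points S \<pi>}"
    using bij_betw_finite[OF aff_bij] W_finite by blast
  then have "(\<Prod>z\<in>{z. Some z \<in> branch_points S \<pi>} - {aff w}. aff w - z) \<noteq> 0" by simp
  ultimately show ?thesis unfolding Q0_coeff_eq[OF w] by simp
qed

lemma Q0_coeff_\<tau>:
  assumes w: "w \<in> W"
  shows "Q0_coeff S \<pi> \<xi> u (\<tau> w) = cnj (Q0_coeff S \<pi> \<xi> u w)"
proof -
  let ?t = "aff w" and ?A = "{\<alpha>. mult \<alpha> \<noteq> 0}" and ?B = "{z. Some z \<in> branch_points S \<pi>}"
  have A: "bij_betw cnj ?A ?A"
    by (rule bij_betw_byWitness[where f' = cnj]) (auto simp: mult_cnj)
  have B: "bij_betw cnj (?B - {?t}) (?B - {cnj ?t})"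
  proof (rule bij_betw_byWitness[where f' = cnj])
    show "cnj ` (?B - {?t}) \<subseteq> ?B - {cnj ?t}" "cnj ` (?B - {cnj ?t}) \<subseteq> ?B - {?t}"
      using branch_conj[of "Some _"] by (auto dest: arg_cong[where f = cnj])
  qed auto
  have "(\<Prod>\<alpha>\<in>?A. (cnj ?t - \<alpha>) powi mult \<alpha>) = (\<Prod>\<alpha>\<in>?A. (cnj ?t - cnj \<alpha>) powi mult (cnj \<alpha>))"
    by (rule prod.reindex_bij_betw[OF A, symmetric])
  also have "\<dots> = cnj (\<Prod>\<alpha>\<in>?A. (?t - \<alpha>) powi mult \<alpha>)" by (simp add: mult_cnj)
  finally have 1: "(\<Prod>\<alpha>\<in>?A. (cnj ?t - \<alpha>) powi mult \<alpha>) = cnj (\<Prod>\<alpha>\<in>?A. (?t - \<alpha>) powi mult \<alpha>)" .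
  have "(\<Prod>z\<in>?B - {cnj ?t}. cnj ?t - z) = (\<Prod>z\<in>?B - {?t}. cnj ?t - cnj z)"
    by (rule prod.reindex_bij_betw[OF B, symmetric])
  then have 2: "(\<Prod>z\<in>?B - {cnj ?t}. cnj ?t - z) = cnj (\<Prod>z\<in>?B - {?t}. ?t - z)" by simp
  show ?thesis
    unfolding Q0_coeff_eq[OF w] Q0_coeff_eq[OF \<tau>_weierstrass[OF w]] aff_\<tau>[OF w] 1 2 by simp
qed

sublocale frame_on W u
  by unfold_locales (rule W_finite, rule u_W_nonzero)

text \<open>Dual fibres are lines and \<open>u\<close> vanishes at no Weierstrass point, so any
  functional there is a multiple of \<open>u p\<close>; the factor is the quotient of the values at
  a frame vector.\<close>

lemma range_comb: "range comb = weierstrass_space S \<pi> \<xi>"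
proof (intro equalityI subsetI)
  fix v assume "v \<in> range comb"
  then obtain f where v: "v = comb f" by blast
  have "(\<lambda>e. f p * u p e) \<in> fibre (dual_bundle \<xi>) p" if p: "p \<in> W" for p
    using D.section_in[OF u_mero W_points[OF p]] by (simp add: dual_fibre_iff algebra_simps)
  then show "v \<in> weierstrass_space S \<pi> \<xi>"
    by (auto simp: v weierstrass_space_def comb_def)
next
  fix v assume v: "v \<in> weierstrass_space S \<pi> \<xi>"
  have "\<exists>c. v p = (\<lambda>e. c * u p e)" if p: "p \<in> W" for p
  proof -
    have vp: "v p \<in> fibre (dual_bundle \<xi>) p" using v p by (simp add: weierstrass_space_def)
    have up: "u p \<in> fibre (dual_bundle \<xi>) p" by (rule D.section_in[OF u_mero W_points[OF p]])
    obtain U \<phi> where t: "(U, \<phi>) \<in> trivs \<xi>" "p \<in> U" using triv_ex[OF W_points[OF p]] .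
    let ?e = "frame \<xi> \<phi> p"
    have "(\<lambda>e. 0) \<in> fibre (dual_bundle \<xi>) p" by (simp add: dual_fibre_iff)
    from dual_eqI[OF t up this] have nz: "u p ?e \<noteq> 0" using u_W_nonzero[OF p] by auto
    have "(\<lambda>e. (v p ?e / u p ?e) * u p e) \<in> fibre (dual_bundle \<xi>) p"
      using up by (simp add: dual_fibre_iff algebra_simps add_divide_distrib)
    from dual_eqI[OF t vp this] nz have "v p = (\<lambda>e. (v p ?e / u p ?e) * u p e)" by simp
    then show ?thesis ..
  qed
  then obtain f where f: "\<And>p. p \<in> W \<Longrightarrow> v p = (\<lambda>e. f p * u p e)" by metis
  have "v = comb f"
  proof
    fix p show "v p = comb f p"
      using f[of p] v by (simp add: comb_def weierstrass_space_def)
  qed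
  then show "v \<in> range comb" by blast
qed

text \<open>Since \<open>u\<close> is invariant, the involution permutes the basis vectors, so on
  coordinates it is conjugation combined with the permutation \<open>\<tau>\<close>.\<close>

lemma conj_comb: "weierstrass_conj S \<pi> \<tau> \<xi> \<sigma> (comb f) = comb (\<lambda>p. cnj (f (\<tau> p)))"
proof
  fix p
  show "weierstrass_conj S \<pi> \<tau> \<xi> \<sigma> (comb f) p = comb (\<lambda>p. cnj (f (\<tau> p))) p"
  proof (cases "p \<in> W")
    case True
    have \<tau>p: "\<tau> p \<in> W" "\<tau> p \<in> points S" using \<tau>_weierstrass[OF True] W_points by auto
    have "u p = dual_real_structure \<tau> \<xi> \<sigma> (\<tau> p) (u (\<tau> p))"
      using u_real[OF \<tau>p(2)] invol[OF W_points[OF True]] by simp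
    then have "(\<lambda>e. cnj (f (\<tau> p)) * u p e) =
        dual_real_structure \<tau> \<xi> \<sigma> (\<tau> p) (\<lambda>e. f (\<tau> p) * u (\<tau> p) e)"
      by (simp add: dual_real_structure_def fun_eq_iff)
    then show ?thesis using True \<tau>p by (simp add: weierstrass_conj_def comb_def)
  qed (simp add: weierstrass_conj_def comb_def)
qed

end

section \<open>Enumeration of the branch points and assembly of the normal form\<close>

lemma sgn_from_pos:
  fixes x :: real
  assumes "x \<noteq> 0" "x > 0 \<longleftrightarrow> even k"
  shows "complex_of_real (sgn x) = (- 1) ^ k"
  using assms by (cases "even k") (auto simp: sgn_real_def)

theorem theorem4p1:
  fixes S :: "'a surface" and \<pi> :: "'a \<Rightarrow> complex option" and \<tau> :: "'a \<Rightarrow> 'a"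
    and g n s :: nat
    and \<xi> :: "('a, 'e) line_bundle" and \<sigma> :: "'a \<Rightarrow> 'e \<Rightarrow> 'e"
    and u :: "'a \<Rightarrow> 'e \<Rightarrow> complex" and m :: "complex \<Rightarrow> int"
    and r a b :: "nat \<Rightarrow> real" and \<epsilon> :: "nat \<Rightarrow> complex"
  assumes curve: "real_hyperelliptic_curve S \<pi> \<tau> g"
    and infinity_unbranched: "None \<notin> branch_points S \<pi>"
    and line_bundle: "holomorphic_line_bundle S \<xi>"
    and real_bundle: "real_structure S \<tau> \<xi> \<sigma>"
    and degree: "has_degree S \<xi> (2 * int g + 1)"
    and u_meromorphic: "meromorphic_section S (dual_bundle \<xi>) u"
    and u_nonzero: "nonzero_section S (dual_bundle \<xi>) u"
    and u_real: "\<And>p. p \<in> points S \<Longrightarrow> u (\<tau> p) = dual_real_structure \<tau> \<xi> \<sigma> p (u p)"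
    and u_regular: "\<And>p. p \<in> points S \<Longrightarrow> \<pi> p \<in> insert None (branch_points S \<pi>) \<Longrightarrow>
          section_ord S (dual_bundle \<xi>) u p = 0"
    and real_branch: "{x. Some (complex_of_real x) \<in> branch_points S \<pi>} = r ` {1..2 * n}"
    and r_increasing: "strict_mono_on {1..2 * n} r"
    and upper_branch: "{z. Some z \<in> branch_points S \<pi> \<and> Im z > 0} =
          (\<lambda>j. Complex (a j) (b j)) ` {1..s}"
    and upper_distinct: "inj_on (\<lambda>j. Complex (a j) (b j)) {1..s}"
    and count: "n + s = g + 1"
    and infinity_real: "None \<in> \<pi> ` real_points S \<tau>"
    and m_def: "m = pushforward_mult S \<pi> (dual_bundle \<xi>) u"
    and first_even: "n > 0 \<Longrightarrow> \<not> odd_interval m {..r 1}"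
    and \<epsilon>_def: "\<epsilon> = (\<lambda>i. (- 1) ^ (odd_count m n r i + 1))"
  shows "(\<exists>B :: nat \<Rightarrow> 'a \<Rightarrow> 'e \<Rightarrow> complex.
           inj_on B {1..2 * n + 2 * s} \<and>
           vfun.independent (B ` {1..2 * n + 2 * s}) \<and>
           vfun.span (B ` {1..2 * n + 2 * s}) = weierstrass_space S \<pi> \<xi> \<and>
           (\<forall>k\<in>{1..2 * n + 2 * s}. weierstrass_conj S \<pi> \<tau> \<xi> \<sigma> (B k) = B k) \<and>
           (\<forall>(x :: nat \<Rightarrow> complex) (z :: nat \<Rightarrow> complex) (w :: nat \<Rightarrow> complex).
              let v = (\<Sum>i=1..2 * n. vscale (x i) (B i)) +
                      (\<Sum>j=1..s. vscale (z j) (B (2 * n + j))) +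
                      (\<Sum>j=1..s. vscale (w j) (B (2 * n + s + j)))
              in Q0 S \<pi> \<xi> u v =
                   (\<Sum>i=1..n. \<epsilon> i * ((x (2 * i - 1))\<^sup>2 - (x (2 * i))\<^sup>2)) +
                   (\<Sum>j=1..s. (z j)\<^sup>2 - (w j)\<^sup>2) \<and>
                 Q1 S \<pi> \<xi> u v =
                   (\<Sum>i=1..n. \<epsilon> i * (of_real (r (2 * i - 1)) * (x (2 * i - 1))\<^sup>2
                                      - of_real (r (2 * i)) * (x (2 * i))\<^sup>2)) +
                   (\<Sum>j=1..s. of_real (a j) * (z j)\<^sup>2 - of_real (a j) * (w j)\<^sup>2
                               + 2 * of_real (b j) * z j * w j))) \<and>
         (n > 0 \<longrightarrow> \<epsilon> 1 = 1)"
proof -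
  interpret real_hyp_curve S \<pi> \<tau> g by unfold_locales (rule curve)
  define Br where "Br = {z. Some z \<in> branch_points S \<pi>}"
  let ?up = "\<lambda>j. Complex (a j) (b j)"
  have Br_cnj: "cnj z \<in> Br \<longleftrightarrow> z \<in> Br" for z using branch_conj[of "Some z"] by (simp add: Br_def)
  have Br_real: "of_real x \<in> Br \<longleftrightarrow> x \<in> r ` {1..2 * n}" for x
    using real_branch by (auto simp: Br_def)
  have Br_up: "z \<in> Br \<and> Im z > 0 \<longleftrightarrow> z \<in> ?up ` {1..s}" for z
    using upper_branch by (auto simp: Br_def)
  have Br_R: "{z \<in> Br. Im z = 0} = complex_of_real ` r ` {1..2 * n}"
  proof (intro equalityI subsetI)
    fix z assume "z \<in> {z \<in> Br. Im z = 0}"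
    then have "z = of_real (Re z)" "z \<in> Br" by (auto simp: complex_eq_iff)
    then show "z \<in> complex_of_real ` r ` {1..2 * n}" using Br_real by (metis imageI)
  qed (use Br_real in auto)
  have Br_U: "{z \<in> Br. Im z > 0} = ?up ` {1..s}" using Br_up by blast
  have Br_closed: "\<And>z. z \<in> Br \<Longrightarrow> cnj z \<in> Br" using Br_cnj by simp
  have Br_eq: "Br = complex_of_real ` r ` {1..2 * n} \<union> (?up ` {1..s} \<union> cnj ` ?up ` {1..s})"
    unfolding Br_R[symmetric] Br_U[symmetric] by (rule split_conj_closed(1)[OF Br_closed])
  have Br_disj1: "complex_of_real ` r ` {1..2 * n} \<inter> (?up ` {1..s} \<union> cnj ` ?up ` {1..s}) = {}"
    unfolding Br_R[symmetric] Br_U[symmetric] by (rule split_conj_closed(2)[OF Br_closed])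
  have Br_disj2: "?up ` {1..s} \<inter> cnj ` ?up ` {1..s} = {}"
    unfolding Br_U[symmetric] by (rule split_conj_closed(3)[OF Br_closed])
  have br_sub: "branch_points S \<pi> \<subseteq> Some ` Br"
  proof
    fix q assume "q \<in> branch_points S \<pi>"
    then show "q \<in> Some ` Br" using infinity_unbranched by (cases q) (auto simp: Br_def)
  qed
  have finBr: "finite Br" unfolding Br_eq by simp
  then have fin: "finite (branch_points S \<pi>)" using br_sub finite_surj by blast
  have xi_bundle: "holo_line_bundle S \<xi>" by unfold_locales (rule line_bundle)
  interpret real_section S \<pi> \<tau> g \<xi> \<sigma> u
    by (intro real_section.intro real_line_bundle.intro real_section_axioms.intro real_line_bundle_axioms.intro
        real_hyp_curve_axioms xi_bundle antiholo invol real_bundle infinity_unbranched degree u_meromorphic u_nonzero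
        u_real u_regular fin)
  have m_mult: "m = mult" by (simp add: m_def mult_def)
  have gap: "even (m (of_real x))" if "k \<in> {1..n}" "r (2 * k - 1) < x" "x < r (2 * k)" for k x
  proof -
    have K: "2 * k - 1 \<le> 2 * n" "Suc (2 * k - 1) = 2 * k" "odd (2 * k - 1)" using that(1) by auto
    have notin: "x \<notin> r ` {1..2 * n}"
    proof
      assume "x \<in> r ` {1..2 * n}"
      then obtain j where j: "j \<in> {1..2 * n}" "x = r j" by blast
      have kk: "2 * k - 1 \<in> {1..2 * n}" "2 * k \<in> {1..2 * n}"
        using that(1) unfolding atLeastAtMost_iff by linarith+
      have "2 * k - 1 < j" "j < 2 * k"
        using strict_mono_on_less[OF r_increasing kk(1) j(1)]
          strict_mono_on_less[OF r_increasing j(1) kk(2)] that(2,3) j(2) by auto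
      then show False by linarith
    qed
    \<comment> \<open>The gap is the component with \<open>2 * k - 1\<close> branch points to its
      left. Starting from real points near minus infinity, an odd number of switches leads to values
      without real points.\<close>
    have "real_over x \<longleftrightarrow> even (2 * k - 1)"
    proof (rule alternating_intervals[OF r_increasing _ _ _ K(1)])
      show "\<forall>\<^sub>F t' in nhds t. real_over t' = real_over t" if "t \<notin> r ` {1..2 * n}" for t
        by (rule real_over_locally_const) (use that Br_real Br_def in auto)
      show "\<exists>\<eta>>0. \<exists>e. \<forall>y. y \<noteq> 0 \<longrightarrow> \<bar>y\<bar> < \<eta> \<longrightarrow> t + y \<notin> r ` {1..2 * n} \<longrightarrow>
          real_over (t + y) = (e = (0 < y))" if "t \<in> r ` {1..2 * n}" for t
      proof -
        have "Some (complex_of_real t) \<in> branch_points S \<pi>" using that Br_real Br_def by auto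
        then obtain \<eta> e where \<eta>: "\<eta> > 0"
          "\<And>y. y \<noteq> 0 \<Longrightarrow> \<bar>y\<bar> < \<eta> \<Longrightarrow> Some (of_real (t + y)) \<notin> branch_points S \<pi> \<Longrightarrow>
            real_over (t + y) \<longleftrightarrow> (e \<longleftrightarrow> y > 0)"
          by (rule real_over_switch) (rule that)
        have "real_over (t + y) \<longleftrightarrow> (e \<longleftrightarrow> y > 0)"
          if "y \<noteq> 0" "\<bar>y\<bar> < \<eta>" "t + y \<notin> r ` {1..2 * n}" for y
          by (rule \<eta>(2)) (use that Br_real[of "t + y"] Br_def in auto)
        with \<eta>(1) show ?thesis by (intro exI[of _ \<eta>] exI[of _ e]) auto
      qed
      show "\<forall>\<^sub>F t in at_bot. real_over t"
        by (rule real_over_at_bot[OF infinity_unbranched infinity_real])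
      show "2 * k - 1 = 0 \<or> r (2 * k - 1) < x" using that(2) by simp
      show "2 * k - 1 = 2 * n \<or> x < r (Suc (2 * k - 1))" using that(3) K(2) by simp
    qed
    then have "\<not> real_over x" using K(3) by simp
    then show ?thesis
      unfolding m_mult by (rule mult_even[rotated]) (use notin Br_real Br_def in auto)
  qed
  have m_r: "m (of_real (r k)) = 0" if "k \<in> {1..2 * n}" for k
    unfolding m_mult by (rule mult_branch) (use that Br_real Br_def in auto)
  interpret divisor_signs m n r
    by unfold_locales (use mult_finite mult_cnj r_increasing gap m_r in \<open>simp_all add: m_mult\<close>)
  \<comment> \<open>The branch values in the block order used for the normal form: real, upper half
    plane, then their conjugates in the same order.\<close>
  define T where "T k = (if k \<le> 2 * n then complex_of_real (r k)
      else if k \<le> 2 * n + s then ?up (k - 2 * n) else cnj (?up (k - (2 * n + s))))" for k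
  have T_real: "T k = of_real (r k)" if "k \<in> {1..2 * n}" for k using that by (simp add: T_def)
  have T_up: "T (2 * n + j) = ?up j" and T_down: "T (2 * n + s + j) = cnj (?up j)"
    if "j \<in> {1..s}" for j using that by (auto simp: T_def)
  have K_eq: "{1..2 * n + 2 * s} = {1..2 * n} \<union> ((+) (2 * n) ` {1..s} \<union> (+) (2 * n + s) ` {1..s})"
    by (auto simp: image_iff)
  have T_img: "T ` {1..2 * n + 2 * s} = Br"
    unfolding K_eq Br_eq image_Un image_image
    by (intro arg_cong2[of _ _ _ _ "(\<union>)"] image_cong refl) (simp_all add: T_real T_up T_down)
  \<comment> \<open>Injectivity by counting: \<open>T\<close> maps onto \<open>Br\<close>, and the
    three disjoint blocks give \<open>Br\<close> as many elements as there are indices.\<close>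
  have T_bij: "bij_betw T {1..2 * n + 2 * s} Br"
  proof -
    have "card Br = 2 * n + 2 * s"
    proof -
      have "card (complex_of_real ` r ` {1..2 * n}) = card (r ` {1..2 * n})"
        by (rule card_image) (simp add: inj_on_def)
      also have "\<dots> = 2 * n"
        using card_image[OF strict_mono_on_imp_inj_on[OF r_increasing]] by simp
      finally have "card (complex_of_real ` r ` {1..2 * n}) = 2 * n" .
      moreover have "card (?up ` {1..s}) = s" using upper_distinct by (simp add: card_image)
      moreover have "card (cnj ` ?up ` {1..s}) = card (?up ` {1..s})"
        by (rule card_image) (simp add: inj_on_def)
      ultimately show ?thesis unfolding Br_eq using Br_disj1 Br_disj2 by (simp add: card_Un_disjoint)
    qed
    then have "inj_on T {1..2 * n + 2 * s}"
      using T_img by (intro eq_card_imp_inj_on) simp_all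
    then show ?thesis using T_img by (simp add: bij_betw_def)
  qed
  define P where "P = inv_into W aff \<circ> T"
  have aff_Br: "bij_betw aff W Br" using aff_bij by (simp add: Br_def)
  have P_bij: "bij_betw P {1..2 * n + 2 * s} W"
    unfolding P_def by (rule bij_betw_trans[OF T_bij bij_betw_inv_into[OF aff_Br]])
  have P_W: "P k \<in> W" and aff_P: "aff (P k) = T k" if "k \<in> {1..2 * n + 2 * s}" for k
  proof -
    show "P k \<in> W" using bij_betwE[OF P_bij] that by blast
    have "T k \<in> Br" using bij_betwE[OF T_bij] that by blast
    then show "aff (P k) = T k"
      using bij_betw_inv_into_right[OF aff_Br] by (simp add: P_def)
  qed
  have inK: "k \<in> {1..2 * n} \<Longrightarrow> k \<in> {1..2 * n + 2 * s}" "j \<in> {1..s} \<Longrightarrow> 2 * n + j \<in> {1..2 * n + 2 * s}"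
    "j \<in> {1..s} \<Longrightarrow> 2 * n + s + j \<in> {1..2 * n + 2 * s}" for k j by auto
  have \<tau>_P: "\<tau> (P k) = P l"
    if "k \<in> {1..2 * n + 2 * s}" "l \<in> {1..2 * n + 2 * s}" "cnj (T k) = T l" for k l
  proof -
    have "aff (\<tau> (P k)) = aff (P l)"
      using aff_\<tau>[OF P_W[OF that(1)]] aff_P[OF that(1)] aff_P[OF that(2)] that(3) by simp
    then show ?thesis
      using inj_on_eq_iff[OF bij_betw_imp_inj_on[OF aff_bij]] \<tau>_weierstrass[OF P_W[OF that(1)]]
        P_W[OF that(2)] by blast
  qed
  let ?q = "Q0_coeff S \<pi> \<xi> u"
  \<comment> \<open>Two signs multiply: the divisor product has the parity of the mass to the right
    of \<open>r k\<close>, and the branch product that of the \<open>2 * n - k\<close> real branch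
    points there, which is the parity of \<open>k\<close>.\<close>
  have q_real: "\<exists>x. ?q (P k) = of_real x \<and> x \<noteq> 0 \<and> (x > 0 \<longleftrightarrow> (even (mass {r k<..}) \<longleftrightarrow> even k))"
    if k: "k \<in> {1..2 * n}" for k
  proof -
    obtain s1 where s1: "(\<Prod>\<alpha> | m \<alpha> \<noteq> 0. (of_real (r k) - \<alpha>) powi m \<alpha>) = of_real s1" "s1 \<noteq> 0"
      "s1 > 0 \<longleftrightarrow> even (mass {r k<..})"
      by (rule divisor_prod_sign[OF m_r[OF k]])
    let ?f = "\<lambda>z. complex_of_real (r k) - z" and ?A = "Br - {complex_of_real (r k)}"
    let ?X = "{x. of_real x \<in> ?A \<and> Re (?f (of_real x)) < 0}"
    have "\<exists>s2. prod ?f ?A = of_real s2 \<and> s2 \<noteq> 0 \<and> (s2 > 0 \<longleftrightarrow> even (card ?X))"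
    proof (rule prod_conj_equivariant[of ?A ?f])
      fix z assume z: "z \<in> ?A"
      then show "cnj z \<in> ?A" using Br_cnj by (auto simp: complex_eq_iff)
      show "?f (cnj z) = cnj (?f z)" "?f z \<noteq> 0" using z by auto
    qed (use finBr in auto)
    then obtain s2 where s2: "prod ?f ?A = of_real s2" "s2 \<noteq> 0" "s2 > 0 \<longleftrightarrow> even (card ?X)" by blast
    have "x \<in> ?X \<longleftrightarrow> x \<in> r ` {k<..2 * n}" for x
    proof -
      have "x \<in> ?X \<longleftrightarrow> x \<in> r ` {1..2 * n} \<and> r k < x" by (auto simp: Br_real)
      also have "\<dots> \<longleftrightarrow> (\<exists>j\<in>{1..2 * n}. k < j \<and> x = r j)"
        using strict_mono_on_less[OF r_increasing k] by blast
      also have "\<dots> \<longleftrightarrow> x \<in> r ` {k<..2 * n}" using k by auto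
      finally show ?thesis .
    qed
    then have "?X = r ` {k<..2 * n}" by (rule Set.set_eqI)
    moreover have "inj_on r {k<..2 * n}"
      using strict_mono_on_imp_inj_on[OF r_increasing] by (rule inj_on_subset) auto
    ultimately have "card ?X = 2 * n - k" by (simp add: card_image)
    then have X: "even (card ?X) \<longleftrightarrow> even k" using k by auto
    have "aff (P k) = of_real (r k)" using aff_P[OF inK(1)[OF k]] T_real[OF k] by simp
    then have "?q (P k) = of_real (s1 * s2)"
      using Q0_coeff_eq[OF P_W[OF inK(1)[OF k]]] s1(1) s2(1) by (simp add: m_mult Br_def)
    moreover have "s1 * s2 > 0 \<longleftrightarrow> (s1 > 0 \<longleftrightarrow> s2 > 0)"
      using s1(2) s2(2) by (auto simp: zero_less_mult_iff)
    ultimately show ?thesis using s1 s2 X by (intro exI[of _ "s1 * s2"]) simp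
  qed
  obtain Q where Q: "\<And>k. k \<in> {1..2 * n} \<Longrightarrow> ?q (P k) = of_real (Q k)"
    "\<And>k. k \<in> {1..2 * n} \<Longrightarrow> Q k \<noteq> 0"
    "\<And>k. k \<in> {1..2 * n} \<Longrightarrow> Q k > 0 \<longleftrightarrow> (even (mass {r k<..}) \<longleftrightarrow> even k)"
    using q_real by metis
  have sign: "of_real (sgn (Q (2 * i - 1))) = \<epsilon> i" "of_real (sgn (Q (2 * i))) = - \<epsilon> i"
    if i: "i \<in> {1..n}" for i
  proof -
    have idx: "2 * i - 1 \<in> {1..2 * n}" "2 * i \<in> {1..2 * n}"
      using i unfolding atLeastAtMost_iff by linarith+
    \<comment> \<open>The odd index contributes an extra minus sign, the \<open>+ 1\<close> in the
      exponent of \<open>\<epsilon> i\<close>; at the even index it is absent, which gives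
      \<open>- \<epsilon> i\<close>.\<close>
    have "odd (2 * i - 1)" using i by auto
    then have "Q (2 * i - 1) > 0 \<longleftrightarrow> even (odd_count m n r i + 1)"
      using Q(3)[OF idx(1)] mass_right_parity[OF i] by simp
    from sgn_from_pos[OF Q(2)[OF idx(1)] this]
    show "of_real (sgn (Q (2 * i - 1))) = \<epsilon> i" by (simp add: \<epsilon>_def)
    have "Q (2 * i) > 0 \<longleftrightarrow> even (odd_count m n r i)"
      using Q(3)[OF idx(2)] mass_right_parity'[OF i] by simp
    from sgn_from_pos[OF Q(2)[OF idx(2)] this]
    show "of_real (sgn (Q (2 * i))) = - \<epsilon> i" by (simp add: \<epsilon>_def)
  qed
  have Q01: "Q0 S \<pi> \<xi> u = diagonal_form W u ?q"
    "Q1 S \<pi> \<xi> u = diagonal_form W u (\<lambda>p. aff p * ?q p)"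
    by (simp_all add: Q0_def Q1_def Q1_coeff_def[abs_def])
  have \<epsilon>1: "\<epsilon> 1 = 1" if "n > 0"
    using odd_count_first[OF that] mult_sum_odd first_even[OF that] by (simp add: \<epsilon>_def m_mult)
  show ?thesis
    unfolding Q01 range_comb[symmetric]
  proof (intro conjI impI, rule normal_form[OF P_bij conj_comb])
    show "\<tau> (P k) = P k" if "k \<in> {1..2 * n}" for k
      by (rule \<tau>_P) (use that inK T_real in auto)
    fix j assume j: "j \<in> {1..s}"
    show down: "\<tau> (P (2 * n + j)) = P (2 * n + s + j)"
      by (rule \<tau>_P[OF inK(2)[OF j] inK(3)[OF j]]) (simp add: T_up[OF j] T_down[OF j])
    show "\<tau> (P (2 * n + s + j)) = P (2 * n + j)"
      by (rule \<tau>_P[OF inK(3)[OF j] inK(2)[OF j]]) (simp add: T_up[OF j] T_down[OF j])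
    show "?q (P (2 * n + j)) \<noteq> 0" by (rule Q0_coeff_nonzero[OF P_W[OF inK(2)[OF j]]])
    show "?q (P (2 * n + s + j)) = cnj (?q (P (2 * n + j)))"
      using Q0_coeff_\<tau>[OF P_W[OF inK(2)[OF j]]] unfolding down .
    show "aff (P (2 * n + j)) = ?up j" "aff (P (2 * n + s + j)) = cnj (?up j)"
      using aff_P[OF inK(2)[OF j]] aff_P[OF inK(3)[OF j]] T_up[OF j] T_down[OF j] by simp_all
  next
    show "aff (P k) = of_real (r k)" if "k \<in> {1..2 * n}" for k
      using aff_P[OF inK(1)[OF that]] T_real[OF that] by simp
  qed (fact Q(1) Q(2) sign \<epsilon>1)+
qed

end
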